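(* Let $X$ be a finite $G$-set such that $X^S=\emptyset$. Then $\Delta(X)$ is a capped Dade $kG$-module.
   Context: $G$ is a finite group, $p$ a prime, $S$ a Sylow $p$-subgroup of $G$, $k$ an algebraically closed field of characteristic $p$. All $kG$-modules are finitely generated, and all $G$-sets are non-empty and finite. $\Delta(X)$ is the kernel of the augmentation map $\varepsilon:kX\to k$, $\sum_x c_x x\mapsto\sum_x c_x$. A $p$-permutation $kG$-module is a direct summand of a permutation $kG$-module. A $kG$-module $M$ is a Dade $kG$-module if $\mathrm{End}_k(M)\cong k^n\oplus W$ for some integer $n\ge 0$ and some $p$-permutation module $W$ all of whose indecomposable summands have vertices that are non-Sylow $p$-subgroups of $G$; it is capped if it has an indecomposable summand with vertex $S$. *)

theory Defs
  imports
    "HOL-Algebra.Group_Action"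
    "HOL-Algebra.Algebraic_Closure"
    "HOL-Computational_Algebra.Primes"
    "Jordan_Normal_Form.Missing_VectorSpace"
begin

subsection \<open>Modules over a group algebra\<close>

text \<open>
  A finitely generated module over the group algebra of a finite group \<open>G\<close> over a field \<open>K\<close> is
  a finite-dimensional \<open>K\<close>-space on which \<open>G\<close> acts linearly. The fields \<open>mult\<close> and \<open>one\<close>, which
  the record \<open>module\<close> inherits from \<open>ring\<close>, play no role.
\<close>

record ('k, 'v, 'g) gmodule = "('k, 'v) module" +
  act :: "'g \<Rightarrow> 'v \<Rightarrow> 'v"

locale kG_module = vectorspace K M + group G
  for K :: "('k, 'a) ring_scheme" and G :: "('g, 'b) monoid_scheme"
    and M :: "('k, 'v, 'g) gmodule" +
  assumes fin_dim: "fin_dim"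
    and act_linear: "g \<in> carrier G \<Longrightarrow> act M g \<in> module_hom K M M"
    and act_one: "v \<in> carrier M \<Longrightarrow> act M \<one>\<^bsub>G\<^esub> v = v"
    and act_mult: "\<lbrakk>g \<in> carrier G; h \<in> carrier G; v \<in> carrier M\<rbrakk>
      \<Longrightarrow> act M (g \<otimes>\<^bsub>G\<^esub> h) v = act M g (act M h v)"

definition with_action :: "('k, 'v) module \<Rightarrow> ('g \<Rightarrow> 'v \<Rightarrow> 'v) \<Rightarrow> ('k, 'v, 'g) gmodule"
  where "with_action M a = module.extend M (gmodule.fields a)"

definition kG_hom :: "('k, 'a) ring_scheme \<Rightarrow> ('g, 'b) monoid_scheme \<Rightarrow>
    ('k, 'v, 'g) gmodule \<Rightarrow> ('k, 'w, 'g) gmodule \<Rightarrow> ('v \<Rightarrow> 'w) set"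
  where "kG_hom K G M N =
    {f \<in> module_hom K M N. \<forall>g\<in>carrier G. \<forall>v\<in>carrier M. f (act M g v) = act N g (f v)}"

definition kG_iso :: "('k, 'a) ring_scheme \<Rightarrow> ('g, 'b) monoid_scheme \<Rightarrow>
    ('k, 'v, 'g) gmodule \<Rightarrow> ('k, 'w, 'g) gmodule \<Rightarrow> bool"
  where "kG_iso K G M N \<longleftrightarrow> (\<exists>f\<in>kG_hom K G M N. bij_betw f (carrier M) (carrier N))"

definition kG_submodule :: "('k, 'a) ring_scheme \<Rightarrow> ('g, 'b) monoid_scheme \<Rightarrow>
    ('k, 'v, 'g) gmodule \<Rightarrow> 'v set \<Rightarrow> bool"
  where "kG_submodule K G M N \<longleftrightarrow>
    submodule K N M \<and> (\<forall>g\<in>carrier G. \<forall>v\<in>N. act M g v \<in> N)"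

definition gmodule_sum ::
    "('k, 'v, 'g) gmodule \<Rightarrow> ('k, 'w, 'g) gmodule \<Rightarrow> ('k, 'v \<times> 'w, 'g) gmodule"
  where "gmodule_sum M N =
    with_action (direct_sum (module.truncate M) (module.truncate N))
      (\<lambda>g (v, w). (act M g v, act N g w))"

definition internal_direct_sum :: "('k, 'a) ring_scheme \<Rightarrow> ('g, 'b) monoid_scheme \<Rightarrow>
    ('k, 'v, 'g) gmodule \<Rightarrow> 'v set \<Rightarrow> 'v set \<Rightarrow> bool"
  where "internal_direct_sum K G M A B \<longleftrightarrow>
    kG_submodule K G M A \<and> kG_submodule K G M B \<and>
    A \<inter> B = {\<zero>\<^bsub>M\<^esub>} \<and> A <+>\<^bsub>M\<^esub> B = carrier M"

definition iso_to_summand :: "('k, 'a) ring_scheme \<Rightarrow> ('g, 'b) monoid_scheme \<Rightarrow>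
    ('k, 'v, 'g) gmodule \<Rightarrow> ('k, 'w, 'g) gmodule \<Rightarrow> bool"
  where "iso_to_summand K G L M \<longleftrightarrow>
    (\<exists>A B. internal_direct_sum K G M A B \<and> kG_iso K G L (M\<lparr>carrier := A\<rparr>))"

definition indecomposable :: "('k, 'a) ring_scheme \<Rightarrow> ('g, 'b) monoid_scheme \<Rightarrow>
    ('k, 'v, 'g) gmodule \<Rightarrow> bool"
  where "indecomposable K G M \<longleftrightarrow> carrier M \<noteq> {\<zero>\<^bsub>M\<^esub>} \<and>
    (\<forall>A B. internal_direct_sum K G M A B \<longrightarrow> A = {\<zero>\<^bsub>M\<^esub>} \<or> B = {\<zero>\<^bsub>M\<^esub>})"

definition indecomposable_summand :: "('k, 'a) ring_scheme \<Rightarrow> ('g, 'b) monoid_scheme \<Rightarrow>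
    ('k, 'v, 'g) gmodule \<Rightarrow> 'v set \<Rightarrow> bool"
  where "indecomposable_summand K G M N \<longleftrightarrow>
    (\<exists>N'. internal_direct_sum K G M N N') \<and> indecomposable K G (M\<lparr>carrier := N\<rparr>)"


subsection \<open>Permutation modules and augmentation kernels\<close>

text \<open>
  An element \<open>\<Sum>x. c x \<cdot> x\<close> of \<open>k\<Omega>\<close> is represented by its coefficient function \<open>c\<close>, so the
  coefficient of \<open>g \<cdot> c\<close> at \<open>x\<close> is the coefficient of \<open>c\<close> at \<open>g\<inverse> x\<close>.
\<close>

definition perm_module :: "('k, 'a) ring_scheme \<Rightarrow> ('g, 'b) monoid_scheme \<Rightarrow>
    'x set \<Rightarrow> ('g \<Rightarrow> 'x \<Rightarrow> 'x) \<Rightarrow> ('k, 'x \<Rightarrow> 'k, 'g) gmodule"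
  where "perm_module K G \<Omega> \<phi> =
    with_action (ring.func_space K \<Omega>) (\<lambda>g c. \<lambda>x\<in>\<Omega>. c (\<phi> (inv\<^bsub>G\<^esub> g) x))"

definition augmentation :: "('k, 'a) ring_scheme \<Rightarrow> 'x set \<Rightarrow> ('x \<Rightarrow> 'k) \<Rightarrow> 'k"
  where "augmentation K \<Omega> c = (\<Oplus>\<^bsub>K\<^esub>x\<in>\<Omega>. c x)"

definition Delta :: "('k, 'a) ring_scheme \<Rightarrow> ('g, 'b) monoid_scheme \<Rightarrow>
    'x set \<Rightarrow> ('g \<Rightarrow> 'x \<Rightarrow> 'x) \<Rightarrow> ('k, 'x \<Rightarrow> 'k, 'g) gmodule"
  where "Delta K G \<Omega> \<phi> = (perm_module K G \<Omega> \<phi>)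
    \<lparr>carrier := {c \<in> carrier (perm_module K G \<Omega> \<phi>). augmentation K \<Omega> c = \<zero>\<^bsub>K\<^esub>}\<rparr>"

text \<open>
  Every non-empty finite \<open>G\<close>-set is isomorphic to one whose underlying set consists of natural
  numbers, so the type of \<open>Y\<close> is no restriction.
\<close>

definition p_permutation :: "('k, 'a) ring_scheme \<Rightarrow> ('g, 'b) monoid_scheme \<Rightarrow>
    ('k, 'v, 'g) gmodule \<Rightarrow> bool"
  where "p_permutation K G M \<longleftrightarrow> kG_module K G M \<and>
    (\<exists>(Y :: nat set) \<psi>. finite Y \<and> Y \<noteq> {} \<and> group_action G Y \<psi> \<and>
      iso_to_summand K G M (perm_module K G Y \<psi>))"


subsection \<open>Relative projectivity and vertices\<close>

definition fun_module :: "'z set \<Rightarrow> ('k, 'v, 'c) module_scheme \<Rightarrow> ('k, 'z \<Rightarrow> 'v) module"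
  where "fun_module Z M = \<lparr>carrier = Z \<rightarrow>\<^sub>E carrier M,
    monoid.mult = (\<lambda>f f'. undefined), one = undefined,
    zero = (\<lambda>z\<in>Z. \<zero>\<^bsub>M\<^esub>), add = (\<lambda>f f'. \<lambda>z\<in>Z. f z \<oplus>\<^bsub>M\<^esub> f' z),
    smult = (\<lambda>c f. \<lambda>z\<in>Z. c \<odot>\<^bsub>M\<^esub> f z)\<rparr>"

text \<open>
  The tensor product of \<open>kG\<close> with \<open>V\<close> over \<open>kH\<close> is represented by functions: \<open>f\<close> stands for the sum
  of the elements \<open>g \<otimes> f g\<close>, where \<open>g\<close> runs over representatives of the cosets \<open>gH\<close>. Since
  \<open>gh \<otimes> h\<inverse> v = g \<otimes> v\<close>, the equivariance condition makes the choice of representatives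
  irrelevant.
\<close>

definition induced_module :: "('g, 'b) monoid_scheme \<Rightarrow> 'g set \<Rightarrow>
    ('k, 'v, 'g) gmodule \<Rightarrow> ('k, 'g \<Rightarrow> 'v, 'g) gmodule"
  where "induced_module G H V = with_action
    ((fun_module (carrier G) V)\<lparr>carrier := {f \<in> carrier G \<rightarrow>\<^sub>E carrier V.
       \<forall>g\<in>carrier G. \<forall>h\<in>H. f (g \<otimes>\<^bsub>G\<^esub> h) = act V (inv\<^bsub>G\<^esub> h) (f g)}\<rparr>)
    (\<lambda>g f. \<lambda>x\<in>carrier G. f (inv\<^bsub>G\<^esub> g \<otimes>\<^bsub>G\<^esub> x))"

text \<open>
  Every finite-dimensional \<open>K\<close>-space is isomorphic to a space of functions from \<open>{..<n}\<close> to \<open>K\<close>,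
  so the type of \<open>V\<close> is no restriction.
\<close>

definition relatively_projective :: "('k, 'a) ring_scheme \<Rightarrow> ('g, 'b) monoid_scheme \<Rightarrow>
    'g set \<Rightarrow> ('k, 'v, 'g) gmodule \<Rightarrow> bool"
  where "relatively_projective K G H M \<longleftrightarrow>
    (\<exists>V :: ('k, nat \<Rightarrow> 'k, 'g) gmodule. kG_module K (G\<lparr>carrier := H\<rparr>) V \<and>
      iso_to_summand K G M (induced_module G H V))"

definition is_vertex :: "('k, 'a) ring_scheme \<Rightarrow> ('g, 'b) monoid_scheme \<Rightarrow>
    ('k, 'v, 'g) gmodule \<Rightarrow> 'g set \<Rightarrow> bool"
  where "is_vertex K G M Q \<longleftrightarrow> subgroup Q G \<and> relatively_projective K G Q M \<and>
    (\<forall>R. subgroup R G \<and> R \<subseteq> Q \<and> relatively_projective K G R M \<longrightarrow> R = Q)"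


subsection \<open>Dade modules\<close>

definition p_subgroup :: "nat \<Rightarrow> ('g, 'b) monoid_scheme \<Rightarrow> 'g set \<Rightarrow> bool"
  where "p_subgroup p G Q \<longleftrightarrow> subgroup Q G \<and> (\<exists>n. card Q = p ^ n)"

definition sylow_subgroup :: "nat \<Rightarrow> ('g, 'b) monoid_scheme \<Rightarrow> 'g set \<Rightarrow> bool"
  where "sylow_subgroup p G Q \<longleftrightarrow> subgroup Q G \<and> card Q = p ^ multiplicity p (order G)"

definition End_module :: "('k, 'a) ring_scheme \<Rightarrow> ('g, 'b) monoid_scheme \<Rightarrow>
    ('k, 'v, 'g) gmodule \<Rightarrow> ('k, 'v \<Rightarrow> 'v, 'g) gmodule"
  where "End_module K G M = with_action
    ((fun_module (carrier M) M)\<lparr>carrier := module_hom K M M \<inter> extensional (carrier M)\<rparr>)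
    (\<lambda>g f. \<lambda>v\<in>carrier M. act M g (f (act M (inv\<^bsub>G\<^esub> g) v)))"

definition trivial_module :: "('k, 'a) ring_scheme \<Rightarrow> nat \<Rightarrow> ('k, nat \<Rightarrow> 'k, 'g) gmodule"
  where "trivial_module K n = with_action (ring.func_space K {..<n}) (\<lambda>g c. c)"

text \<open>
  The module \<open>W\<close> below is isomorphic to a submodule of the endomorphism module, so the type of \<open>W\<close>
  is no restriction.
\<close>

definition Dade_module :: "('k, 'a) ring_scheme \<Rightarrow> ('g, 'b) monoid_scheme \<Rightarrow> nat \<Rightarrow>
    ('k, 'v, 'g) gmodule \<Rightarrow> bool"
  where "Dade_module K G p M \<longleftrightarrow> kG_module K G M \<and>
    (\<exists>(n :: nat) (W :: ('k, 'v \<Rightarrow> 'v, 'g) gmodule).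
      p_permutation K G W \<and>
      (\<forall>N. indecomposable_summand K G W N \<longrightarrow>
        (\<forall>Q. is_vertex K G (W\<lparr>carrier := N\<rparr>) Q \<longrightarrow>
          p_subgroup p G Q \<and> \<not> sylow_subgroup p G Q)) \<and>
      kG_iso K G (End_module K G M) (gmodule_sum (trivial_module K n) W))"

definition capped_Dade_module :: "('k, 'a) ring_scheme \<Rightarrow> ('g, 'b) monoid_scheme \<Rightarrow> nat \<Rightarrow>
    'g set \<Rightarrow> ('k, 'v, 'g) gmodule \<Rightarrow> bool"
  where "capped_Dade_module K G p S M \<longleftrightarrow> Dade_module K G p M \<and>
    (\<exists>N. indecomposable_summand K G M N \<and> is_vertex K G (M\<lparr>carrier := N\<rparr>) S)"

end

theory Submission
  imports Defs "HOL-Algebra.Sylow"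
begin

text \<open>
  With \<open>d y x = y - x\<close>, an endomorphism \<open>f\<close> of \<open>\<Delta>(X)\<close> is represented by the matrix whose entry at
  \<open>(x, y)\<close> is the coefficient of \<open>f (d y x)\<close> at \<open>x\<close>. This identifies \<open>End (\<Delta>(X))\<close> with the matrices
  over \<open>X \<times> X\<close> that have zero diagonal and constant column sums. As \<open>S\<close> has no fixed point, \<open>p\<close> divides
  the order of \<open>X\<close>; hence the column sum of the identity is \<open>1\<close>, so \<open>End (\<Delta>(X))\<close> is the sum of the scalars
  and the space \<open>W\<close> of matrices with zero column sums, and \<open>W\<close> is an explicit direct summand
  of \<open>k[X \<times> X]\<close>. An indecomposable summand of \<open>W\<close> is therefore projective relative to a point
  stabilizer, and by Mackey's formula each of its vertices fixes a point of \<open>X\<close>, which a Sylow subgroup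
  does not. Finally, the trace of the identity of \<open>\<Delta>(X)\<close> is \<open>-1\<close>, whereas a projection that is a
  relative trace from a subgroup of index divisible by \<open>p\<close> has trace \<open>0\<close>; so some indecomposable
  summand of \<open>\<Delta>(X)\<close> has vertex \<open>S\<close>.
\<close>

section \<open>Linear representations and direct summands\<close>

text \<open>A vertex is here any subgroup that is minimal for relative projectivity: that it is a
  p-group has to be proved, and every vertex has to be treated as it comes. The device for this is
  to replace the subgroup in Higman's criterion by a finite G-set \<open>Y\<close>: a family of
  linear endomorphisms indexed by \<open>Y\<close>, permuted by \<open>G\<close>, with sum the
  identity. Such families pass to direct summands, can be composed over a product of G-sets, split
  along orbits when the module is indecomposable, and can be averaged along a map of transitive
  G-sets whose fibre size is invertible. Mackey's formula becomes the orbit decomposition of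
  \<open>Y \<times> G/Q\<close>. Induced modules serve to translate between the two notions. The
  trace is read off without a basis: if a zero-diagonal matrix A on k[X] extends the endomorphism f
  of \<Delta>(X), then tr A = 0, and A acts on the one-dimensional quotient k[X]/\<Delta>(X) by its
  common column sum; so this sum is -tr f. The summand with vertex \<open>S\<close> is the image of
  an equivariant idempotent of nonzero trace whose rank is minimal.\<close>

locale linear_rep = vectorspace K M + group G
  for K :: "('k, 'a) ring_scheme" and G :: "('g, 'b) monoid_scheme"
    and M :: "('k, 'v, 'g) gmodule" +
  assumes act_linear: "g \<in> carrier G \<Longrightarrow> act M g \<in> module_hom K M M"
    and act_one: "v \<in> carrier M \<Longrightarrow> act M \<one>\<^bsub>G\<^esub> v = v"
    and act_mult: "\<lbrakk>g \<in> carrier G; h \<in> carrier G; v \<in> carrier M\<rbrakk>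
      \<Longrightarrow> act M (g \<otimes>\<^bsub>G\<^esub> h) v = act M g (act M h v)"
begin

lemma act_closed [intro, simp]: "\<lbrakk>g \<in> carrier G; v \<in> carrier M\<rbrakk> \<Longrightarrow> act M g v \<in> carrier M"
  using module_hom_closed[OF act_linear] by blast

lemma act_add: "\<lbrakk>g \<in> carrier G; v \<in> carrier M; w \<in> carrier M\<rbrakk>
    \<Longrightarrow> act M g (v \<oplus>\<^bsub>M\<^esub> w) = act M g v \<oplus>\<^bsub>M\<^esub> act M g w"
  by (rule module_hom_add[OF act_linear])

lemma act_smult: "\<lbrakk>g \<in> carrier G; c \<in> carrier K; v \<in> carrier M\<rbrakk>
    \<Longrightarrow> act M g (c \<odot>\<^bsub>M\<^esub> v) = c \<odot>\<^bsub>M\<^esub> act M g v"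
  by (rule module_hom_smult[OF act_linear])

lemma act_inv1 [simp]: "\<lbrakk>g \<in> carrier G; v \<in> carrier M\<rbrakk> \<Longrightarrow> act M g (act M (inv\<^bsub>G\<^esub> g) v) = v"
  by (metis act_mult act_one inv_closed r_inv)

lemma act_inv2 [simp]: "\<lbrakk>g \<in> carrier G; v \<in> carrier M\<rbrakk> \<Longrightarrow> act M (inv\<^bsub>G\<^esub> g) (act M g v) = v"
  by (metis act_mult act_one inv_closed l_inv)

end

text \<open>Separates finite dimension from the linear action. Function spaces, induced modules and
  endomorphism modules are handled as linear representations; dimension is added only where a rank
  argument or a definition asks for it.\<close>

lemma kG_module_iff: "kG_module K G M \<longleftrightarrow> linear_rep K G M \<and> vectorspace.fin_dim K M"
proof
  assume "kG_module K G M"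
  then interpret kG_module K G M .
  show "linear_rep K G M \<and> vectorspace.fin_dim K M"
    by (auto intro!: linear_rep.intro linear_rep_axioms.intro vectorspace_axioms group_axioms
        simp: act_linear act_one act_mult fin_dim)
next
  assume *: "linear_rep K G M \<and> vectorspace.fin_dim K M"
  then interpret linear_rep K G M by simp
  show "kG_module K G M"
    using * by (auto intro!: kG_module.intro kG_module_axioms.intro vectorspace_axioms group_axioms
        simp: act_linear act_one act_mult)
qed

lemma module_homI:
  assumes "\<And>v. v \<in> carrier M \<Longrightarrow> f v \<in> carrier N"
    and "\<And>v w. \<lbrakk>v \<in> carrier M; w \<in> carrier M\<rbrakk> \<Longrightarrow> f (v \<oplus>\<^bsub>M\<^esub> w) = f v \<oplus>\<^bsub>N\<^esub> f w"
    and "\<And>c v. \<lbrakk>c \<in> carrier K; v \<in> carrier M\<rbrakk> \<Longrightarrow> f (c \<odot>\<^bsub>M\<^esub> v) = c \<odot>\<^bsub>N\<^esub> f v"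
  shows "f \<in> module_hom K M N"
  using assms by (auto simp: module_hom_def)

lemma module_hom_mem: "\<lbrakk>f \<in> module_hom K M N; v \<in> carrier M\<rbrakk> \<Longrightarrow> f v \<in> carrier N"
  using module_hom_closed by blast

lemma module_hom_cong:
  assumes "f \<in> module_hom K M N" "module K M" "\<And>v. v \<in> carrier M \<Longrightarrow> f v = f' v"
  shows "f' \<in> module_hom K M N"
proof -
  interpret M: module K M by fact
  show ?thesis
    using assms(1)
    by (auto intro!: module_homI simp: module_hom_def simp flip: assms(3))
qed

lemma module_hom_comp:
  "\<lbrakk>f \<in> module_hom K L M; f' \<in> module_hom K M N\<rbrakk> \<Longrightarrow> (\<lambda>v. f' (f v)) \<in> module_hom K L N"
  by (auto intro!: module_homI simp: module_hom_def Pi_iff)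

lemma module_hom_zero:
  assumes "f \<in> module_hom K M N" "module K M" "module K N"
  shows "f \<zero>\<^bsub>M\<^esub> = \<zero>\<^bsub>N\<^esub>"
proof -
  interpret mod_hom K M N f
    using assms by (intro mod_hom.intro mod_hom_axioms.intro)
  show ?thesis by (rule f0_is_0)
qed

lemma module_hom_minus:
  assumes "f \<in> module_hom K M N" "module K M" "module K N" "v \<in> carrier M" "w \<in> carrier M"
  shows "f (v \<ominus>\<^bsub>M\<^esub> w) = f v \<ominus>\<^bsub>N\<^esub> f w"
proof -
  interpret mod_hom K M N f
    using assms by (intro mod_hom.intro mod_hom_axioms.intro)
  show ?thesis using assms by simp
qed

lemma module_hom_finsum:
  assumes f: "f \<in> module_hom K M N" and "module K M" "module K N" and g: "g \<in> A \<rightarrow> carrier M"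
  shows "f (\<Oplus>\<^bsub>M\<^esub>a\<in>A. g a) = (\<Oplus>\<^bsub>N\<^esub>a\<in>A. f (g a))"
proof -
  interpret M: module K M by fact
  interpret N: module K N by fact
  from g show ?thesis
  proof (induct A rule: infinite_finite_induct)
    case (insert a A)
    then show ?case
      using module_hom_mem[OF f] by (simp add: module_hom_add[OF f] Pi_iff)
  qed (auto simp: module_hom_zero[OF f \<open>module K M\<close> \<open>module K N\<close>])
qed

lemma kG_homI:
  assumes "f \<in> module_hom K M N"
    and "\<And>g v. \<lbrakk>g \<in> carrier G; v \<in> carrier M\<rbrakk> \<Longrightarrow> f (act M g v) = act N g (f v)"
  shows "f \<in> kG_hom K G M N"
  using assms by (auto simp: kG_hom_def)

lemma kG_hom_module_hom: "f \<in> kG_hom K G M N \<Longrightarrow> f \<in> module_hom K M N"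
  by (simp add: kG_hom_def)

lemma kG_hom_act:
  "\<lbrakk>f \<in> kG_hom K G M N; g \<in> carrier G; v \<in> carrier M\<rbrakk> \<Longrightarrow> f (act M g v) = act N g (f v)"
  by (simp add: kG_hom_def)

lemma kG_hom_comp:
  "\<lbrakk>f \<in> kG_hom K G L M; f' \<in> kG_hom K G M N\<rbrakk> \<Longrightarrow> (\<lambda>v. f' (f v)) \<in> kG_hom K G L N"
  by (intro kG_homI) (auto intro: module_hom_comp[OF kG_hom_module_hom kG_hom_module_hom]
      simp: kG_hom_act module_hom_mem[OF kG_hom_module_hom])

lemma kG_hom_id: "(\<lambda>v. v) \<in> kG_hom K G M M"
  by (auto intro!: kG_homI module_homI)

lemma kG_hom_inv:
  assumes f: "f \<in> kG_hom K G M N" and b: "bij_betw f (carrier M) (carrier N)"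
    and M: "linear_rep K G M"
  shows "inv_into (carrier M) f \<in> kG_hom K G N M"
proof -
  interpret M: linear_rep K G M by fact
  let ?h = "inv_into (carrier M) f"
  have h: "?h w \<in> carrier M" "f (?h w) = w" if "w \<in> carrier N" for w
    using b that by (auto simp: bij_betw_def inv_into_into f_inv_into_f)
  have hf: "?h (f v) = v" if "v \<in> carrier M" for v
    using b that by (simp add: bij_betw_inv_into_left)
  note f' = kG_hom_module_hom[OF f]
  show ?thesis
  proof (intro kG_homI module_homI)
    fix v w assume "v \<in> carrier N" "w \<in> carrier N"
    then show "?h (v \<oplus>\<^bsub>N\<^esub> w) = ?h v \<oplus>\<^bsub>M\<^esub> ?h w"
      using h hf[of "?h v \<oplus>\<^bsub>M\<^esub> ?h w"] by (simp add: module_hom_add[OF f'])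
  next
    fix c w assume "c \<in> carrier K" "w \<in> carrier N"
    then show "?h (c \<odot>\<^bsub>N\<^esub> w) = c \<odot>\<^bsub>M\<^esub> ?h w"
      using h hf[of "c \<odot>\<^bsub>M\<^esub> ?h w"] by (simp add: module_hom_smult[OF f'])
  next
    fix g w assume "g \<in> carrier G" "w \<in> carrier N"
    then show "?h (act N g w) = act M g (?h w)"
      using h hf[of "act M g (?h w)"] by (simp add: kG_hom_act[OF f])
  qed (use h in auto)
qed

lemma linear_rep_submodule:
  assumes M: "linear_rep K G M" and A: "kG_submodule K G M A"
  shows "linear_rep K G (M\<lparr>carrier := A\<rparr>)"
proof -
  interpret M: linear_rep K G M by fact
  have sub: "submodule K A M" and st: "\<And>g v. \<lbrakk>g \<in> carrier G; v \<in> A\<rbrakk> \<Longrightarrow> act M g v \<in> A"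
    using A by (auto simp: kG_submodule_def)
  have AM: "v \<in> A \<Longrightarrow> v \<in> carrier M" for v using submodule.subset[OF sub] by blast
  have vs: "vectorspace K (M\<lparr>carrier := A\<rparr>)"
    by (rule M.subspace_is_vs) (simp add: subspace_def sub M.vectorspace_axioms)
  show ?thesis
    by (intro linear_rep.intro linear_rep_axioms.intro vs M.group_axioms module_homI)
      (auto simp: st AM M.act_add M.act_smult M.act_one M.act_mult)
qed

lemma kG_submoduleI:
  assumes M: "linear_rep K G M" and "A \<subseteq> carrier M" "\<zero>\<^bsub>M\<^esub> \<in> A"
    and "\<And>v w. \<lbrakk>v \<in> A; w \<in> A\<rbrakk> \<Longrightarrow> v \<oplus>\<^bsub>M\<^esub> w \<in> A"
    and "\<And>c v. \<lbrakk>c \<in> carrier K; v \<in> A\<rbrakk> \<Longrightarrow> c \<odot>\<^bsub>M\<^esub> v \<in> A"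
    and "\<And>g v. \<lbrakk>g \<in> carrier G; v \<in> A\<rbrakk> \<Longrightarrow> act M g v \<in> A"
  shows "kG_submodule K G M A"
proof -
  interpret M: linear_rep K G M by fact
  show ?thesis
    using assms by (auto simp: kG_submodule_def intro!: submodule.intro M.module_axioms)
qed

lemma kG_submodule_subset: "kG_submodule K G M A \<Longrightarrow> A \<subseteq> carrier M"
  by (simp add: kG_submodule_def submodule_def)

lemma kG_submodule_image:
  assumes "linear_rep K G L" "linear_rep K G M" "f \<in> kG_hom K G L M"
  shows "kG_submodule K G M (f ` carrier L)"
proof -
  interpret L: linear_rep K G L by fact
  interpret M: linear_rep K G M by fact
  note f = kG_hom_module_hom[OF assms(3)]
  show ?thesis
  proof (rule kG_submoduleI[OF assms(2)])
    show "\<zero>\<^bsub>M\<^esub> \<in> f ` carrier L"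
      using module_hom_zero[OF f L.module_axioms M.module_axioms] by (metis L.M.zero_closed imageI)
  next
    fix v w assume "v \<in> f ` carrier L" "w \<in> f ` carrier L"
    then obtain a b where ab: "a \<in> carrier L" "b \<in> carrier L" "v = f a" "w = f b" by blast
    then have "v \<oplus>\<^bsub>M\<^esub> w = f (a \<oplus>\<^bsub>L\<^esub> b)" using module_hom_add[OF f] by simp
    then show "v \<oplus>\<^bsub>M\<^esub> w \<in> f ` carrier L" using ab by auto
  next
    fix c v assume "c \<in> carrier K" "v \<in> f ` carrier L"
    then obtain a where ab: "a \<in> carrier L" "v = f a" by blast
    then have "c \<odot>\<^bsub>M\<^esub> v = f (c \<odot>\<^bsub>L\<^esub> a)" using module_hom_smult[OF f] \<open>c \<in> carrier K\<close> by simp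
    then show "c \<odot>\<^bsub>M\<^esub> v \<in> f ` carrier L" using ab \<open>c \<in> carrier K\<close> by auto
  next
    fix g v assume "g \<in> carrier G" "v \<in> f ` carrier L"
    then obtain a where ab: "a \<in> carrier L" "v = f a" by blast
    then have "act M g v = f (act L g a)" using kG_hom_act[OF assms(3)] \<open>g \<in> carrier G\<close> by simp
    then show "act M g v \<in> f ` carrier L" using ab \<open>g \<in> carrier G\<close> by auto
  qed (use module_hom_mem[OF f] in auto)
qed

lemma kG_submodule_kernel:
  assumes "linear_rep K G L" "linear_rep K G M" "f \<in> kG_hom K G L M"
  shows "kG_submodule K G L {v \<in> carrier L. f v = \<zero>\<^bsub>M\<^esub>}"
proof -
  interpret L: linear_rep K G L by fact
  interpret M: linear_rep K G M by fact
  note f = kG_hom_module_hom[OF assms(3)]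
  have "act M g \<zero>\<^bsub>M\<^esub> = \<zero>\<^bsub>M\<^esub>" if "g \<in> carrier G" for g
    using module_hom_zero[OF M.act_linear[OF that] M.module_axioms M.module_axioms] .
  then show ?thesis
    by (intro kG_submoduleI[OF assms(1)])
      (auto simp: module_hom_zero[OF f L.module_axioms M.module_axioms] module_hom_add[OF f]
        module_hom_smult[OF f] kG_hom_act[OF assms(3)])
qed

lemma linear_rep_image:
  assumes "linear_rep K G L" "linear_rep K G M" "f \<in> kG_hom K G L M" 
  shows "linear_rep K G (M\<lparr>carrier := f ` carrier L\<rparr>)"
  using linear_rep_submodule kG_submodule_image assms by blast

lemma fin_dim_surjective_image:
  assumes "kG_module K G L" "linear_rep K G M" "f \<in> module_hom K L M"
    "f ` carrier L = carrier M"
  shows "kG_module K G M"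
proof -
  interpret L: kG_module K G L by fact
  interpret M: linear_rep K G M by fact
  interpret linear_map K L M f
    by (intro linear_map.intro mod_hom.intro mod_hom_axioms.intro L.vectorspace_axioms
        M.vectorspace_axioms L.module_axioms M.module_axioms assms)
  show ?thesis
    using surj_fin_dim[OF L.fin_dim assms(4)] assms(2) by (simp add: kG_module_iff)
qed

lemma (in abelian_group) minus_eq_zero_iff:
  "\<lbrakk>a \<in> carrier G; b \<in> carrier G\<rbrakk> \<Longrightarrow> a \<ominus> b = \<zero> \<longleftrightarrow> a = b"
  by (metis a_minus_def add.inv_closed add.inv_inv minus_equality r_neg)

text \<open>Uniqueness of the two components makes taking components linear and equivariant. This
  turns a decomposition into subspaces into maps, which can be composed.\<close>

lemma internal_direct_sum_projections:
  assumes M: "linear_rep K G M" and AB: "internal_direct_sum K G M A B"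
  obtains e f where "e \<in> kG_hom K G M (M\<lparr>carrier := A\<rparr>)" "f \<in> kG_hom K G M (M\<lparr>carrier := B\<rparr>)"
    "\<And>a. a \<in> A \<Longrightarrow> e a = a" "\<And>b. b \<in> B \<Longrightarrow> e b = \<zero>\<^bsub>M\<^esub>"
    "\<And>v. v \<in> carrier M \<Longrightarrow> v = e v \<oplus>\<^bsub>M\<^esub> f v"
proof -
  interpret M: linear_rep K G M by fact
  have subA: "kG_submodule K G M A" and subB: "kG_submodule K G M B"
    and int: "A \<inter> B = {\<zero>\<^bsub>M\<^esub>}" and sum: "A <+>\<^bsub>M\<^esub> B = carrier M"
    using AB by (auto simp: internal_direct_sum_def)
  interpret A: linear_rep K G "M\<lparr>carrier := A\<rparr>" by (rule linear_rep_submodule[OF M subA])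
  interpret B: linear_rep K G "M\<lparr>carrier := B\<rparr>" by (rule linear_rep_submodule[OF M subB])
  have AM: "a \<in> carrier M" if "a \<in> A" for a using subA that kG_submodule_subset by blast
  have BM: "a \<in> carrier M" if "a \<in> B" for a using subB that kG_submodule_subset by blast
  have ex: "\<exists>a\<in>A. \<exists>b\<in>B. v = a \<oplus>\<^bsub>M\<^esub> b" if "v \<in> carrier M" for v
    using that sum by (auto simp: set_add_def' simp flip: sum)
  have minus: "a \<ominus>\<^bsub>M\<^esub> b \<in> C" if "submodule K C M" "a \<in> C" "b \<in> C" for a b C
  proof -
    have "b \<in> carrier M" using that submodule.subset by blast
    then have "\<ominus>\<^bsub>M\<^esub> b = (\<ominus>\<^bsub>K\<^esub> \<one>\<^bsub>K\<^esub>) \<odot>\<^bsub>M\<^esub> b" using M.smult_minus_1 by simp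
    then have "\<ominus>\<^bsub>M\<^esub> b \<in> C" using that submodule.smult_closed by fastforce
    then show ?thesis using that submodule.m_closed by (fastforce simp: a_minus_def)
  qed
  have uniq: "a = a' \<and> b = b'" if *: "a \<in> A" "a' \<in> A" "b \<in> B" "b' \<in> B"
      and eq: "a \<oplus>\<^bsub>M\<^esub> b = a' \<oplus>\<^bsub>M\<^esub> b'" for a a' b b'
  proof -
    note c = *(1,2)[THEN AM] *(3,4)[THEN BM]
    have "a \<ominus>\<^bsub>M\<^esub> a' = a \<ominus>\<^bsub>M\<^esub> a' \<oplus>\<^bsub>M\<^esub> (b \<ominus>\<^bsub>M\<^esub> b)"
      using c by (simp add: M.M.r_neg a_minus_def)
    also have "\<dots> = (a \<oplus>\<^bsub>M\<^esub> b) \<ominus>\<^bsub>M\<^esub> a' \<ominus>\<^bsub>M\<^esub> b"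
      using c by (simp add: a_minus_def M.M.a_ac)
    also have "\<dots> = (a' \<oplus>\<^bsub>M\<^esub> b') \<ominus>\<^bsub>M\<^esub> a' \<ominus>\<^bsub>M\<^esub> b" by (simp add: eq)
    also have "\<dots> = (b' \<ominus>\<^bsub>M\<^esub> b) \<oplus>\<^bsub>M\<^esub> (a' \<ominus>\<^bsub>M\<^esub> a')"
      using c by (simp add: a_minus_def M.M.a_ac)
    also have "\<dots> = b' \<ominus>\<^bsub>M\<^esub> b" using c by (simp add: M.M.r_neg a_minus_def)
    finally have d: "a \<ominus>\<^bsub>M\<^esub> a' = b' \<ominus>\<^bsub>M\<^esub> b" .
    have "a \<ominus>\<^bsub>M\<^esub> a' \<in> A" "b' \<ominus>\<^bsub>M\<^esub> b \<in> B"
      using minus subA subB * by (auto simp: kG_submodule_def)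
    with d int have "a \<ominus>\<^bsub>M\<^esub> a' = \<zero>\<^bsub>M\<^esub>" "b' \<ominus>\<^bsub>M\<^esub> b = \<zero>\<^bsub>M\<^esub>" by auto
    then show ?thesis using c by (metis M.M.minus_eq_zero_iff)
  qed
  define e where "e v = (THE a. a \<in> A \<and> (\<exists>b\<in>B. v = a \<oplus>\<^bsub>M\<^esub> b))" for v
  define f where "f v = (THE b. b \<in> B \<and> (\<exists>a\<in>A. v = a \<oplus>\<^bsub>M\<^esub> b))" for v
  have e: "e (a \<oplus>\<^bsub>M\<^esub> b) = a" if "a \<in> A" "b \<in> B" for a b
    unfolding e_def using that uniq by (intro the_equality) blast+
  have f: "f (a \<oplus>\<^bsub>M\<^esub> b) = b" if "a \<in> A" "b \<in> B" for a b
    unfolding f_def using that uniq by (intro the_equality) blast+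
  have add: "(a \<oplus>\<^bsub>M\<^esub> b) \<oplus>\<^bsub>M\<^esub> (a' \<oplus>\<^bsub>M\<^esub> b') = (a \<oplus>\<^bsub>M\<^esub> a') \<oplus>\<^bsub>M\<^esub> (b \<oplus>\<^bsub>M\<^esub> b')"
    if "a \<in> A" "a' \<in> A" "b \<in> B" "b' \<in> B" for a a' b b'
    using that AM BM by (simp add: M.M.a_ac)
  have smult: "c \<odot>\<^bsub>M\<^esub> (a \<oplus>\<^bsub>M\<^esub> b) = (c \<odot>\<^bsub>M\<^esub> a) \<oplus>\<^bsub>M\<^esub> (c \<odot>\<^bsub>M\<^esub> b)"
    if "c \<in> carrier K" "a \<in> A" "b \<in> B" for a b c
    using that AM BM by (simp add: M.smult_r_distr)
  have act: "act M g (a \<oplus>\<^bsub>M\<^esub> b) = (act M g a) \<oplus>\<^bsub>M\<^esub> (act M g b)"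
    if "g \<in> carrier G" "a \<in> A" "b \<in> B" for a b g
    using that AM BM by (simp add: M.act_add)
  have cl: "a \<oplus>\<^bsub>M\<^esub> a' \<in> A" "c \<odot>\<^bsub>M\<^esub> a \<in> A" "act M g a \<in> A"
    if "a \<in> A" "a' \<in> A" "c \<in> carrier K" "g \<in> carrier G" for a a' c g
    using that A.M.a_closed A.smult_closed A.act_closed by auto
  have cl': "a \<oplus>\<^bsub>M\<^esub> a' \<in> B" "c \<odot>\<^bsub>M\<^esub> a \<in> B" "act M g a \<in> B"
    if "a \<in> B" "a' \<in> B" "c \<in> carrier K" "g \<in> carrier G" for a a' c g
    using that B.M.a_closed B.smult_closed B.act_closed by auto
  have zA: "\<zero>\<^bsub>M\<^esub> \<in> A" and zB: "\<zero>\<^bsub>M\<^esub> \<in> B" using int by auto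
  \<comment> \<open>Each fact in \<open>cl\<close> carries all four premises. Those foreign to its
    conclusion are discharged by dummy values, so that the facts become usable as rewrite
    rules.\<close>
  note cl = cl[OF _ _ M.R.zero_closed M.one_closed] cl(2)[OF _ zA _ M.one_closed]
      cl(3)[OF _ zA M.R.zero_closed]
  note cl' = cl'[OF _ _ M.R.zero_closed M.one_closed] cl'(2)[OF _ zB _ M.one_closed]
      cl'(3)[OF _ zB M.R.zero_closed]
  show ?thesis
  proof (rule that)
    show "e \<in> kG_hom K G M (M\<lparr>carrier := A\<rparr>)"
    proof (intro kG_homI module_homI)
      fix v w assume "v \<in> carrier M" "w \<in> carrier M"
      then obtain a b a' b' where "a \<in> A" "a' \<in> A" "b \<in> B" "b' \<in> B"
        and v: "v = a \<oplus>\<^bsub>M\<^esub> b" "w = a' \<oplus>\<^bsub>M\<^esub> b'" by (meson ex)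
      then show "e (v \<oplus>\<^bsub>M\<^esub> w) = e v \<oplus>\<^bsub>M\<lparr>carrier := A\<rparr>\<^esub> e w"
        by (simp add: add e cl cl')
    qed (auto dest!: ex simp: smult act e cl cl')
    show "f \<in> kG_hom K G M (M\<lparr>carrier := B\<rparr>)"
    proof (intro kG_homI module_homI)
      fix v w assume "v \<in> carrier M" "w \<in> carrier M"
      then obtain a b a' b' where "a \<in> A" "a' \<in> A" "b \<in> B" "b' \<in> B"
        and v: "v = a \<oplus>\<^bsub>M\<^esub> b" "w = a' \<oplus>\<^bsub>M\<^esub> b'" by (meson ex)
      then show "f (v \<oplus>\<^bsub>M\<^esub> w) = f v \<oplus>\<^bsub>M\<lparr>carrier := B\<rparr>\<^esub> f w"
        by (simp add: add f cl cl')
    qed (auto dest!: ex simp: smult act f cl cl')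
    show "e a = a" if "a \<in> A" for a using e[OF that zB] that AM by simp
    show "e b = \<zero>\<^bsub>M\<^esub>" if "b \<in> B" for b using e[OF zA that] that BM by simp
    show "v = e v \<oplus>\<^bsub>M\<^esub> f v" if "v \<in> carrier M" for v using ex[OF that] e f by auto
  qed
qed

lemma internal_direct_sum_idempotent:
  assumes M: "linear_rep K G M" and e: "e \<in> kG_hom K G M M"
    and idem: "\<And>v. v \<in> carrier M \<Longrightarrow> e (e v) = e v"
  shows "internal_direct_sum K G M (e ` carrier M) {v \<in> carrier M. e v = \<zero>\<^bsub>M\<^esub>}"
proof -
  interpret M: linear_rep K G M by fact
  note e' = kG_hom_module_hom[OF e]
  note ec = module_hom_mem[OF e']
  have z: "e \<zero>\<^bsub>M\<^esub> = \<zero>\<^bsub>M\<^esub>" by (rule module_hom_zero[OF e' M.module_axioms M.module_axioms])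
  have "v \<in> e ` carrier M <+>\<^bsub>M\<^esub> {v \<in> carrier M. e v = \<zero>\<^bsub>M\<^esub>}" if v: "v \<in> carrier M" for v
  proof -
    have "e (v \<ominus>\<^bsub>M\<^esub> e v) = e v \<ominus>\<^bsub>M\<^esub> e v"
      using v ec idem by (simp add: module_hom_minus[OF e' M.module_axioms M.module_axioms])
    then have "v \<ominus>\<^bsub>M\<^esub> e v \<in> {v \<in> carrier M. e v = \<zero>\<^bsub>M\<^esub>}"
      using v ec by (simp add: M.M.r_neg a_minus_def)
    moreover have "v = e v \<oplus>\<^bsub>M\<^esub> (v \<ominus>\<^bsub>M\<^esub> e v)"
      using v ec by (simp add: a_minus_def M.M.a_lcomm M.M.r_neg)
    ultimately show ?thesis using v unfolding set_add_def' by blast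
  qed
  then show ?thesis
    unfolding internal_direct_sum_def
    using kG_submodule_image[OF M M e] kG_submodule_kernel[OF M M e] ec z idem
    by (auto simp: set_add_def' rev_image_eqI[OF M.M.zero_closed])
qed

text \<open>The composite of \<open>q\<close> and \<open>i\<close> is an idempotent endomorphism of
  \<open>M\<close> with the same image as \<open>i\<close>. As a retract, a direct summand can be
  carried along by composing maps.\<close>

lemma retract_imp_iso_to_summand:
  assumes L: "linear_rep K G L" and M: "linear_rep K G M"
    and i: "i \<in> kG_hom K G L M" and q: "q \<in> kG_hom K G M L"
    and qi: "\<And>v. v \<in> carrier L \<Longrightarrow> q (i v) = v"
  shows "iso_to_summand K G L M"
proof -
  note ic = module_hom_mem[OF kG_hom_module_hom[OF i]] and qc = module_hom_mem[OF kG_hom_module_hom[OF q]]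
  let ?e = "\<lambda>v. i (q v)"
  have eq: "?e ` carrier M = i ` carrier L"
    using ic qc qi by (auto simp: image_iff) (metis)
  have "internal_direct_sum K G M (?e ` carrier M) {v \<in> carrier M. ?e v = \<zero>\<^bsub>M\<^esub>}"
    using qi qc by (intro internal_direct_sum_idempotent M kG_hom_comp[OF q i]) auto
  then have "internal_direct_sum K G M (i ` carrier L) {v \<in> carrier M. ?e v = \<zero>\<^bsub>M\<^esub>}"
    unfolding eq .
  moreover have "kG_iso K G L (M\<lparr>carrier := i ` carrier L\<rparr>)"
    unfolding kG_iso_def
  proof (intro bexI)
    show "bij_betw i (carrier L) (carrier (M\<lparr>carrier := i ` carrier L\<rparr>))"
      using qi by (auto simp: bij_betw_def intro: inj_on_inverseI[of _ q])
    show "i \<in> kG_hom K G L (M\<lparr>carrier := i ` carrier L\<rparr>)"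
      using i by (auto simp: kG_hom_def module_hom_def)
  qed
  ultimately show ?thesis unfolding iso_to_summand_def by blast
qed

lemma iso_to_summand_retract:
  assumes L: "linear_rep K G L" and M: "linear_rep K G M" and LM: "iso_to_summand K G L M"
  obtains i q where "i \<in> kG_hom K G L M" "q \<in> kG_hom K G M L"
    "\<And>v. v \<in> carrier L \<Longrightarrow> q (i v) = v"
proof -
  obtain A B i where AB: "internal_direct_sum K G M A B"
    and i: "i \<in> kG_hom K G L (M\<lparr>carrier := A\<rparr>)" and b: "bij_betw i (carrier L) A"
    using LM by (auto simp: iso_to_summand_def kG_iso_def)
  obtain e where e: "e \<in> kG_hom K G M (M\<lparr>carrier := A\<rparr>)" and ea: "\<And>a. a \<in> A \<Longrightarrow> e a = a"
    using internal_direct_sum_projections[OF M AB] by metis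
  have AM: "A \<subseteq> carrier M"
    using AB kG_submodule_subset[of K G M A] by (simp add: internal_direct_sum_def)
  have j: "inv_into (carrier L) i \<in> kG_hom K G (M\<lparr>carrier := A\<rparr>) L"
    using b by (intro kG_hom_inv[OF i _ L]) simp
  show ?thesis
  proof (rule that)
    show "i \<in> kG_hom K G L M" using i AM by (auto simp: kG_hom_def module_hom_def)
    show "(\<lambda>v. inv_into (carrier L) i (e v)) \<in> kG_hom K G M L"
      by (rule kG_hom_comp[OF e j])
    show "inv_into (carrier L) i (e (i v)) = v" if "v \<in> carrier L" for v
      using that b ea by (simp add: bij_betw_inv_into_left bij_betwE)
  qed
qed

lemma kG_module_summand:
  assumes M: "kG_module K G M" and AB: "internal_direct_sum K G M A B"
  shows "kG_module K G (M\<lparr>carrier := A\<rparr>)"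
proof -
  have M': "linear_rep K G M" using M by (simp add: kG_module_iff)
  obtain e where e: "e \<in> kG_hom K G M (M\<lparr>carrier := A\<rparr>)" and ea: "\<And>a. a \<in> A \<Longrightarrow> e a = a"
    using internal_direct_sum_projections[OF M' AB] by metis
  have A: "kG_submodule K G M A" using AB by (simp add: internal_direct_sum_def)
  have "e ` carrier M = A"
    using module_hom_mem[OF kG_hom_module_hom[OF e]] ea kG_submodule_subset[OF A]
    by (auto simp: image_iff) (metis subsetD)
  then show ?thesis
    using fin_dim_surjective_image[OF M linear_rep_submodule[OF M' A] kG_hom_module_hom[OF e]]
    by simp
qed

section \<open>Fitting's lemma\<close>

context vectorspace
begin

text \<open>For a subspace this is its dimension, measured inside \<open>V\<close>. Chains of images
  and kernels can thus be compared without making each of them a vector space of its own.\<close>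

definition rk :: "'c set \<Rightarrow> nat"
  where "rk A = Max (card ` {B. B \<subseteq> A \<and> lin_indpt B})"

lemma
  assumes fin_dim "A \<subseteq> carrier V"
  shows rk_obtains: "\<exists>B\<subseteq>A. lin_indpt B \<and> card B = rk A"
    and card_le_rk: "\<lbrakk>B \<subseteq> A; lin_indpt B\<rbrakk> \<Longrightarrow> card B \<le> rk A"
    and rk_le_dim: "rk A \<le> dim"
proof -
  let ?S = "card ` {B. B \<subseteq> A \<and> lin_indpt B}"
  have le: "n \<le> dim" if "n \<in> ?S" for n using that li_le_dim(2) assms by auto
  then have fin: "finite ?S" by (meson finite_nat_set_iff_bounded_le)
  have ne: "?S \<noteq> {}" using lin_dep_def by auto
  have "rk A \<in> ?S" unfolding rk_def using Max_in[OF fin ne] .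
  then show "\<exists>B\<subseteq>A. lin_indpt B \<and> card B = rk A" "rk A \<le> dim" using le by auto
  show "\<lbrakk>B \<subseteq> A; lin_indpt B\<rbrakk> \<Longrightarrow> card B \<le> rk A"
    unfolding rk_def using fin by (intro Max_ge) auto
qed

text \<open>An independent subset of \<open>A\<close> of maximal size stays independent when a
  vector of \<open>A' - A\<close> is added, because its span lies inside the subspace
  \<open>A\<close>.\<close>

lemma rk_strict_mono:
  assumes fd: fin_dim and A: "submodule K A V" and AA': "A \<subset> A'" and A': "A' \<subseteq> carrier V"
  shows "rk A < rk A'"
proof -
  have AV: "A \<subseteq> carrier V" using AA' A' by blast
  obtain B where B: "B \<subseteq> A" "lin_indpt B" "card B = rk A" using rk_obtains[OF fd AV] by blast
  obtain v where v: "v \<in> A'" "v \<notin> A" using AA' by blast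
  have BV: "B \<subseteq> carrier V" using B AV by blast
  have "span B \<subseteq> A" using span_is_subset[OF B(1) A] .
  then have "lin_indpt (B \<union> {v})"
    using lin_dep_iff_in_span[OF BV B(2), of v] v B(1) A' by blast
  then have "card (B \<union> {v}) \<le> rk A'" using B v AA' by (intro card_le_rk fd A') auto
  moreover have "card (B \<union> {v}) = Suc (card B)"
    using v B li_le_dim(1)[OF fd BV] by (subst card_Un_disjoint) auto
  ultimately show ?thesis using B by simp
qed

lemma rk_eq_imp_eq:
  assumes fin_dim "submodule K A V" "A \<subseteq> A'" "A' \<subseteq> carrier V" "rk A' \<le> rk A"
  shows "A = A'"
  using assms rk_strict_mono[of A A'] by (metis not_le psubsetI)

end

lemma kG_hom_funpow: "f \<in> kG_hom K G M M \<Longrightarrow> f ^^ k \<in> kG_hom K G M M"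
proof (induction k)
  case 0
  then show ?case using kG_hom_id[of K G M] by (simp add: id_def)
next
  case (Suc k)
  then show ?case using kG_hom_comp[of "f ^^ k" K G M M f M] by (simp add: comp_def)
qed

text \<open>The images of the powers of \<open>f\<close> decrease and the kernels increase. Once
  both chains are stationary, \<open>M\<close> is the direct sum of the image and the kernel of that
  power, and indecomposability makes one of them vanish.\<close>

lemma fitting:
  assumes M: "kG_module K G M" and ind: "indecomposable K G M" and f: "f \<in> kG_hom K G M M"
  shows "bij_betw f (carrier M) (carrier M) \<or> (\<exists>k. \<forall>v\<in>carrier M. (f ^^ k) v = \<zero>\<^bsub>M\<^esub>)"
proof -
  interpret M: kG_module K G M by fact
  have rep: "linear_rep K G M" using M by (simp add: kG_module_iff)
  define im where "im k = (f ^^ k) ` carrier M" for k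
  define ker where "ker k = {v \<in> carrier M. (f ^^ k) v = \<zero>\<^bsub>M\<^esub>}" for k
  note fk = kG_hom_funpow[OF f]
  note fkc = module_hom_mem[OF kG_hom_module_hom[OF fk]]
  note fkz = module_hom_zero[OF kG_hom_module_hom[OF fk] M.module_axioms M.module_axioms]
  have sub: "submodule K (im k) M" "submodule K (ker k) M" for k
    using kG_submodule_image[OF rep rep fk] kG_submodule_kernel[OF rep rep fk]
    by (auto simp: im_def ker_def kG_submodule_def)
  have subset: "im k \<subseteq> carrier M" "ker k \<subseteq> carrier M" for k using fkc by (auto simp: im_def ker_def)
  have im_anti: "im (k + j) \<subseteq> im k" for k j using fkc by (auto simp: im_def funpow_add)
  have ker_mono: "ker k \<subseteq> ker (j + k)" for k j using fkz by (auto simp: ker_def funpow_add)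
  obtain k1 where k1: "\<And>j. M.rk (im k1) \<le> M.rk (im j)"
    using ex_has_least_nat[of "\<lambda>_. True" 0 "\<lambda>k. M.rk (im k)"] by auto
  obtain k2 where k2: "\<And>j. M.rk (ker j) \<le> M.rk (ker k2)"
    using ex_has_greatest_nat[of "\<lambda>_. True" 0 "\<lambda>k. M.rk (ker k)" "Suc M.dim"]
      M.rk_le_dim[OF M.fin_dim subset(2)] le_imp_less_Suc by blast
  \<comment> \<open>The image has least rank at \<open>k1\<close> and the kernel has greatest rank
    at \<open>k2\<close>. Beyond these exponents inclusion and equal rank force equality, so the sum
    serves both chains.\<close>
  define k where "k = k1 + k2"
  have im_eq: "im (k1 + j) = im k1" for j
    using M.rk_eq_imp_eq[OF M.fin_dim sub(1) im_anti subset(1)] k1 by metis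
  have ker_eq: "ker (j + k2) = ker k2" for j
    using M.rk_eq_imp_eq[OF M.fin_dim sub(2) ker_mono subset(2)] k2 by metis
  have im2: "im (k + k) = im k" using im_eq[of k2] im_eq[of "k2 + k"] by (simp add: k_def add.assoc)
  have ker2: "ker (k + k) = ker k"
    using ker_eq[of k1] ker_eq[of "k + k1"] by (simp add: k_def add.assoc)
  have "im k \<inter> ker k = {\<zero>\<^bsub>M\<^esub>}"
  proof -
    have "v = \<zero>\<^bsub>M\<^esub>" if v: "v \<in> im k \<inter> ker k" for v
    proof -
      obtain w where w: "w \<in> carrier M" "v = (f ^^ k) w" using v by (auto simp: im_def)
      then have "w \<in> ker (k + k)" using v by (auto simp: ker_def funpow_add)
      then have "w \<in> ker k" using ker2 by simp
      then show ?thesis using w by (simp add: ker_def)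
    qed
    then show ?thesis using submodule.zero_closed[OF sub(1)] submodule.zero_closed[OF sub(2)] by blast
  qed
  moreover have "im k <+>\<^bsub>M\<^esub> ker k = carrier M"
  proof -
    have "v \<in> im k <+>\<^bsub>M\<^esub> ker k" if v: "v \<in> carrier M" for v
    proof -
      have "(f ^^ k) v \<in> im (k + k)" using im2 v by (auto simp: im_def)
      then obtain w where w: "w \<in> carrier M" "(f ^^ k) v = (f ^^ k) ((f ^^ k) w)"
        by (auto simp: im_def funpow_add)
      let ?a = "(f ^^ k) w"
      have a: "?a \<in> carrier M" "?a \<in> im k" using w fkc by (auto simp: im_def)
      have "(f ^^ k) (v \<ominus>\<^bsub>M\<^esub> ?a) = \<zero>\<^bsub>M\<^esub>"
        using v a w fkc
        by (simp add: module_hom_minus[OF kG_hom_module_hom[OF fk] M.module_axioms M.module_axioms]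
            M.M.minus_eq_zero_iff)
      then have "v \<ominus>\<^bsub>M\<^esub> ?a \<in> ker k" using v a by (simp add: ker_def)
      moreover have "v = ?a \<oplus>\<^bsub>M\<^esub> (v \<ominus>\<^bsub>M\<^esub> ?a)"
        using v a by (simp add: a_minus_def M.M.a_lcomm M.M.r_neg)
      ultimately show ?thesis using a unfolding set_add_def' by blast
    qed
    moreover have "h \<oplus>\<^bsub>M\<^esub> h' \<in> carrier M" if "h \<in> im k" "h' \<in> ker k" for h h'
      using that subset by (intro M.M.a_closed) blast+
    ultimately show ?thesis unfolding set_add_def' by blast
  qed
  ultimately have "internal_direct_sum K G M (im k) (ker k)"
    using kG_submodule_image[OF rep rep fk] kG_submodule_kernel[OF rep rep fk]
    by (simp add: internal_direct_sum_def im_def ker_def)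
  then consider "im k = {\<zero>\<^bsub>M\<^esub>}" | "ker k = {\<zero>\<^bsub>M\<^esub>}"
    using ind by (auto simp: indecomposable_def)
  then show ?thesis
  proof cases
    case 1
    then have "\<forall>v\<in>carrier M. (f ^^ k) v = \<zero>\<^bsub>M\<^esub>" by (auto simp: im_def)
    then show ?thesis by blast
  next
    case 2
    note f' = kG_hom_module_hom[OF f]
    have "ker 1 \<subseteq> {\<zero>\<^bsub>M\<^esub>}"
    \<comment> \<open>The kernel of the zeroth power is trivially zero and need not contain the
      kernel of \<open>f\<close>. For \<open>k = 0\<close> the inclusion has to come from the
      kernels being stationary from \<open>k2\<close> on.\<close>
    proof (cases "k = 0")
      case True
      have "ker 1 \<subseteq> ker (1 + k2)" using ker_mono[of 1 k2] by (simp add: add.commute)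
      also have "\<dots> = ker k" using ker_eq[of 1] ker_eq[of k1] by (simp add: k_def)
      finally show ?thesis using 2 by simp
    next
      case False
      then show ?thesis using ker_mono[of 1 "k - 1"] 2 by simp
    qed
    then have ker1: "f v = \<zero>\<^bsub>M\<^esub> \<Longrightarrow> v \<in> carrier M \<Longrightarrow> v = \<zero>\<^bsub>M\<^esub>" for v by (auto simp: ker_def)
    have inj: "inj_on f (carrier M)"
    proof (rule inj_onI)
      fix v w assume vw: "v \<in> carrier M" "w \<in> carrier M" "f v = f w"
      then have "f (v \<ominus>\<^bsub>M\<^esub> w) = \<zero>\<^bsub>M\<^esub>"
        using module_hom_mem[OF f']
        by (simp add: module_hom_minus[OF f' M.module_axioms M.module_axioms] M.M.minus_eq_zero_iff)
      then show "v = w" using ker1 vw by (metis M.M.minus_closed M.M.minus_eq_zero_iff)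
    qed
    have "v \<in> f ` carrier M" if v: "v \<in> carrier M" for v
    proof -
      \<comment> \<open>Surjectivity: since the images are stationary, \<open>f ^^ k1\<close> sends
        \<open>v\<close> and some \<open>f w\<close> to the same vector, and the injective
        \<open>f ^^ k1\<close> can be cancelled.\<close>
      have "(f ^^ k1) v \<in> im (k1 + 1)" using v im_eq[of 1] unfolding im_def by blast
      then obtain w where w: "w \<in> carrier M" "(f ^^ k1) v = (f ^^ k1) (f w)"
        by (auto simp: im_def funpow_swap1)
      have "inj_on (f ^^ n) (carrier M)" for n
      proof (induction n)
        case (Suc n)
        have "(f ^^ n) ` carrier M \<subseteq> carrier M" using fkc by auto
        then show ?case using comp_inj_on[OF Suc inj_on_subset[OF inj]] by (simp add: comp_def)
      qed simp
      then have "inj_on (f ^^ k1) (carrier M)" .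
      then have "v = f w" using w v module_hom_mem[OF f'] by (auto dest: inj_onD)
      then show ?thesis using w by blast
    qed
    then show ?thesis using inj module_hom_mem[OF f'] by (auto simp: bij_betw_def)
  qed
qed

text \<open>If neither map is bijective, both are nilpotent by Fitting's lemma. On the last nonzero
  iterate \<open>w\<close> of a vector under \<open>h\<close> one has \<open>h w = 0\<close>, hence
  \<open>f w = w\<close>, which contradicts the nilpotency of \<open>f\<close>.\<close>

lemma indecomposable_local:
  assumes M: "kG_module K G M" and ind: "indecomposable K G M"
    and f: "f \<in> kG_hom K G M M" and h: "h \<in> kG_hom K G M M"
    and sum: "\<And>v. v \<in> carrier M \<Longrightarrow> f v \<oplus>\<^bsub>M\<^esub> h v = v"
  shows "bij_betw f (carrier M) (carrier M) \<or> bij_betw h (carrier M) (carrier M)"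
proof (rule ccontr)
  assume *: "\<not> ?thesis"
  interpret M: kG_module K G M by fact
  note fc = module_hom_mem[OF kG_hom_module_hom[OF f]] and hc = module_hom_mem[OF kG_hom_module_hom[OF h]]
  obtain k where k: "\<And>v. v \<in> carrier M \<Longrightarrow> (f ^^ k) v = \<zero>\<^bsub>M\<^esub>"
    using fitting[OF M ind f] * by auto
  obtain l where l: "\<And>v. v \<in> carrier M \<Longrightarrow> (h ^^ l) v = \<zero>\<^bsub>M\<^esub>"
    using fitting[OF M ind h] * by auto
  obtain v where v: "v \<in> carrier M" "v \<noteq> \<zero>\<^bsub>M\<^esub>"
    using ind M.M.zero_closed by (auto simp: indecomposable_def)
  define j where "j = (LEAST j. (h ^^ j) v = \<zero>\<^bsub>M\<^esub>)"
  have j: "(h ^^ j) v = \<zero>\<^bsub>M\<^esub>" unfolding j_def using l[OF v(1)] by (rule LeastI)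
  with v obtain i where i: "j = Suc i" by (cases j) auto
  define w where "w = (h ^^ i) v"
  have "w \<noteq> \<zero>\<^bsub>M\<^esub>" using not_less_Least[of i "\<lambda>j. (h ^^ j) v = \<zero>\<^bsub>M\<^esub>"] i j_def w_def by auto
  have w: "w \<in> carrier M"
    using v module_hom_mem[OF kG_hom_module_hom[OF kG_hom_funpow[OF h]]] by (simp add: w_def)
  have "h w = \<zero>\<^bsub>M\<^esub>" using j i by (simp add: w_def)
  then have fw: "f w = w" using sum[OF w] fc[OF w] by simp
  have "(f ^^ n) w = w" for n by (induction n) (auto simp: fw)
  then show False using k[OF w] \<open>w \<noteq> \<zero>\<^bsub>M\<^esub>\<close> by simp
qed

section \<open>Change of the underlying set\<close>

text \<open>\<open>relatively_projective\<close> asks for a module whose vectors are functions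
  \<open>nat \<Rightarrow> 'k\<close>. The restriction of a module to a subgroup is moved to that
  type by copying its structure along an injection.\<close>

definition transport :: "('v \<Rightarrow> 'w) \<Rightarrow> ('k, 'v, 'g) gmodule \<Rightarrow> ('k, 'w, 'g) gmodule"
  where "transport \<theta> M = (let \<eta> = inv_into (carrier M) \<theta> in
    \<lparr>carrier = \<theta> ` carrier M, monoid.mult = \<lambda>_ _. undefined, one = undefined, zero = \<theta> \<zero>\<^bsub>M\<^esub>,
     add = \<lambda>a b. \<theta> (\<eta> a \<oplus>\<^bsub>M\<^esub> \<eta> b), smult = \<lambda>c a. \<theta> (c \<odot>\<^bsub>M\<^esub> \<eta> a),
     act = \<lambda>g a. \<theta> (act M g (\<eta> a))\<rparr>)"

lemma transport:
  assumes M: "kG_module K G M" and inj: "inj_on \<theta> (carrier M)"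
  shows "kG_module K G (transport \<theta> M)" "\<theta> \<in> kG_hom K G M (transport \<theta> M)"
    "bij_betw \<theta> (carrier M) (carrier (transport \<theta> M))"
proof -
  interpret M: kG_module K G M by fact
  have rep: "linear_rep K G M" using M by (simp add: kG_module_iff)
  interpret rep: linear_rep K G M by fact
  let ?V = "transport \<theta> M"
  have simps: "carrier ?V = \<theta> ` carrier M" "zero ?V = \<theta> \<zero>\<^bsub>M\<^esub>"
    "\<And>v w. v \<in> carrier M \<Longrightarrow> w \<in> carrier M \<Longrightarrow> \<theta> v \<oplus>\<^bsub>?V\<^esub> \<theta> w = \<theta> (v \<oplus>\<^bsub>M\<^esub> w)"
    "\<And>c v. v \<in> carrier M \<Longrightarrow> c \<odot>\<^bsub>?V\<^esub> \<theta> v = \<theta> (c \<odot>\<^bsub>M\<^esub> v)"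
    "\<And>g v. v \<in> carrier M \<Longrightarrow> act ?V g (\<theta> v) = \<theta> (act M g v)"
    using inj by (simp_all add: transport_def Let_def)
  have "module K ?V"
  proof (rule module_criteria)
    show "\<forall>v\<in>carrier ?V. \<exists>n\<in>carrier ?V. v \<oplus>\<^bsub>?V\<^esub> n = \<zero>\<^bsub>?V\<^esub>"
    proof
      fix v assume "v \<in> carrier ?V"
      then obtain w where "w \<in> carrier M" "v = \<theta> w" by (auto simp: simps)
      then show "\<exists>n\<in>carrier ?V. v \<oplus>\<^bsub>?V\<^esub> n = \<zero>\<^bsub>?V\<^esub>"
        by (intro bexI[of _ "\<theta> (\<ominus>\<^bsub>M\<^esub> w)"]) (auto simp: simps M.M.r_neg)
    qed
  qed (auto simp: simps M.R.is_cring M.M.a_ac M.smult_assoc1 M.smult_l_distr M.smult_r_distr)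
  then have vs: "vectorspace K ?V" by (intro vectorspace.intro M.field_axioms)
  have V: "linear_rep K G ?V"
    by (intro linear_rep.intro linear_rep_axioms.intro vs M.group_axioms module_homI)
      (auto simp: simps rep.act_add rep.act_smult M.act_one M.act_mult)
  show hom: "\<theta> \<in> kG_hom K G M ?V"
    by (intro kG_homI module_homI) (auto simp: simps)
  show "bij_betw \<theta> (carrier M) (carrier ?V)" using inj by (simp add: simps bij_betw_def)
  show "kG_module K G ?V"
    by (rule fin_dim_surjective_image[OF M V kG_hom_module_hom[OF hom]]) (simp add: simps)
qed

text \<open>The coordinates are chosen coefficients with respect to a finite spanning set. They
  determine the vector, which gives injectivity; linearity with respect to the copied operations is
  then produced by \<open>transport\<close>.\<close>

lemma kG_module_coordinates:
  fixes K :: "('k, 'a) ring_scheme" and M :: "('k, 'v, 'g) gmodule"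
  assumes M: "kG_module K G M"
  obtains \<theta> :: "'v \<Rightarrow> nat \<Rightarrow> 'k" where "inj_on \<theta> (carrier M)"
proof -
  interpret M: kG_module K G M by fact
  obtain A where A: "finite A" "A \<subseteq> carrier M" "M.span A = carrier M"
    using M.fin_dim by (auto simp: M.fin_dim_def)
  obtain h where h: "bij_betw h {..<card A} A"
    using A ex_bij_betw_nat_finite atLeast0LessThan by metis
  define c where "c v = (SOME a. a \<in> A \<rightarrow> carrier K \<and> M.lincomb a A = v)" for v
  have c: "c v \<in> A \<rightarrow> carrier K \<and> M.lincomb (c v) A = v" if "v \<in> carrier M" for v
  proof -
    have "\<exists>a. a \<in> A \<rightarrow> carrier K \<and> M.lincomb a A = v"
      using M.finite_in_span[OF A(1,2), of v] that A(3) by simp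
    then show ?thesis unfolding c_def by (rule someI_ex)
  qed
  show ?thesis
  proof (rule that[of "\<lambda>v i. c v (h i)"], rule inj_onI)
    fix v w assume v: "v \<in> carrier M" and w: "w \<in> carrier M" and eq: "(\<lambda>i. c v (h i)) = (\<lambda>i. c w (h i))"
    have "c v a = c w a" if "a \<in> A" for a
      using that h eq by (metis bij_betw_imp_surj_on imageE)
    then have "M.lincomb (c v) A = M.lincomb (c w) A"
      using c[OF w] by (intro M.lincomb_cong A) auto
    then show "v = w" using c[OF v] c[OF w] by simp
  qed
qed

section \<open>Projectivity relative to a finite G-set\<close>

text \<open>In contrast to \<open>group_action\<close>, the maps are constrained on \<open>Y\<close>
  only and need not be extensional. Stable subsets and subgroups therefore act through the very same
  \<psi>.\<close>

locale gset = group G for G :: "('g, 'b) monoid_scheme" (structure) +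
  fixes Y :: "'y set" and \<psi> :: "'g \<Rightarrow> 'y \<Rightarrow> 'y"
  assumes finite_set: "finite Y"
    and closed: "\<lbrakk>g \<in> carrier G; y \<in> Y\<rbrakk> \<Longrightarrow> \<psi> g y \<in> Y"
    and one_act: "y \<in> Y \<Longrightarrow> \<psi> \<one> y = y"
    and mult_act: "\<lbrakk>g \<in> carrier G; h \<in> carrier G; y \<in> Y\<rbrakk> \<Longrightarrow> \<psi> (g \<otimes> h) y = \<psi> g (\<psi> h y)"
begin

lemma act_inv [simp]:
  assumes "g \<in> carrier G" "y \<in> Y"
  shows "\<psi> g (\<psi> (inv g) y) = y" "\<psi> (inv g) (\<psi> g y) = y"
  using assms by (simp_all add: one_act flip: mult_act)

lemma bij: "g \<in> carrier G \<Longrightarrow> bij_betw (\<psi> g) Y Y"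
  by (rule bij_betw_byWitness[where f' = "\<psi> (inv g)"]) (auto simp: closed)

lemma group_action: "group_action G Y (\<lambda>g. \<lambda>y\<in>Y. \<psi> g y)"
proof -
  have B: "(\<lambda>y\<in>Y. \<psi> g y) \<in> carrier (BijGroup Y)" if "g \<in> carrier G" for g
    using bij[OF that] by (auto simp: BijGroup_def Bij_def cong: bij_betw_cong)
  have "(\<lambda>g. \<lambda>y\<in>Y. \<psi> g y) \<in> hom G (BijGroup Y)"
  proof (rule homI)
    fix g h assume gh: "g \<in> carrier G" "h \<in> carrier G"
    show "(\<lambda>y\<in>Y. \<psi> (g \<otimes> h) y) = (\<lambda>y\<in>Y. \<psi> g y) \<otimes>\<^bsub>BijGroup Y\<^esub> (\<lambda>y\<in>Y. \<psi> h y)"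
      using B[OF gh(1)] B[OF gh(2)] gh
      by (auto simp: BijGroup_def compose_def fun_eq_iff mult_act closed)
  qed (use B in auto)
  then show ?thesis
    by (intro group_action.intro group_hom.intro group_hom_axioms.intro group_axioms group_BijGroup)
qed

definition stab :: "'y \<Rightarrow> 'g set"
  where "stab y = {g \<in> carrier G. \<psi> g y = y}"

lemma stab_subgroup: "y \<in> Y \<Longrightarrow> subgroup (stab y) G"
  using group_action.stabilizer_subgroup[OF group_action, of y]
  by (simp add: stabilizer_def stab_def)

lemma orbit_stab:
  "y \<in> Y \<Longrightarrow> card ((\<lambda>g. \<psi> g y) ` carrier G) * card (stab y) = order G"
  using group_action.orbit_stabilizer_theorem[OF group_action, of y]
  by (simp add: stabilizer_def stab_def orbit_def image_def Bex_def Collect_conj_eq conj_commute)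

lemma subset:
  assumes "Z \<subseteq> Y" "\<And>g z. \<lbrakk>g \<in> carrier G; z \<in> Z\<rbrakk> \<Longrightarrow> \<psi> g z \<in> Z"
  shows "gset G Z \<psi>"
  using assms finite_subset[OF _ finite_set] by unfold_locales (auto simp: one_act mult_act subset_iff)

end

lemma group_action_gset:
  assumes "group_action G Y \<phi>" "finite Y"
  shows "gset G Y \<phi>"
proof -
  interpret group_action G Y \<phi> by fact
  interpret group G using group_hom by (simp add: group_hom_def)
  show ?thesis
  proof unfold_locales
    show "\<phi> g y \<in> Y" if "g \<in> carrier G" "y \<in> Y" for g y
      using element_image[OF that refl] .
    show "\<phi> \<one>\<^bsub>G\<^esub> y = y" if "y \<in> Y" for y
      using fun_cong[OF id_eq_one, of y] that by simp
  qed (use assms(2) composition_rule in auto)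
qed

lemma gset_times:
  assumes "gset G Y \<psi>" "gset G Z \<chi>"
  shows "gset G (Y \<times> Z) (\<lambda>g (y, z). (\<psi> g y, \<chi> g z))"
proof -
  interpret Y: gset G Y \<psi> by fact
  interpret Z: gset G Z \<chi> by fact
  show ?thesis
    by unfold_locales (auto simp: Y.finite_set Z.finite_set Y.closed Z.closed Y.one_act Z.one_act
        Y.mult_act Z.mult_act)
qed

section \<open>Coset spaces as G-sets\<close>

definition left_cosets :: "('g, 'b) monoid_scheme \<Rightarrow> 'g set \<Rightarrow> 'g set set"
  where "left_cosets G H = (\<lambda>g. g <#\<^bsub>G\<^esub> H) ` carrier G"

lemma (in group) mem_l_coset: "\<lbrakk>subgroup H G; g \<in> carrier G\<rbrakk> \<Longrightarrow> g \<in> g <# H"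
  using subgroup.one_closed by (force simp: l_coset_def)

lemma (in group) l_coset_eq_iff:
  assumes "subgroup H G" "g \<in> carrier G" "h \<in> carrier G"
  shows "g <# H = h <# H \<longleftrightarrow> inv g \<otimes> h \<in> H"
proof
  assume "g <# H = h <# H"
  then have "h \<in> g <# H" using mem_l_coset[OF assms(1,3)] by simp
  then obtain k where "k \<in> H" "h = g \<otimes> k" by (auto simp: l_coset_def)
  then show "inv g \<otimes> h \<in> H"
    using assms subgroup.mem_carrier[OF assms(1)] by (simp flip: m_assoc)
next
  assume *: "inv g \<otimes> h \<in> H"
  have "h <# H = (g \<otimes> (inv g \<otimes> h)) <# H" using assms by (simp flip: m_assoc)
  also have "\<dots> = g <# ((inv g \<otimes> h) <# H)"
    using assms subgroup.subset by (intro lcos_m_assoc[symmetric]) auto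
  also have "(inv g \<otimes> h) <# H = H" using * assms by (intro coset_join3) auto
  finally show "g <# H = h <# H" by simp
qed

lemma (in group) gset_left_cosets:
  assumes "subgroup H G" "finite (carrier G)"
  shows "gset G (left_cosets G H) (l_coset G)"
proof -
  have HG: "H \<subseteq> carrier G" using assms subgroup.subset by blast
  show ?thesis
  proof unfold_locales
    fix g h C assume "g \<in> carrier G" "h \<in> carrier G" "C \<in> left_cosets G H"
    then show "(g \<otimes> h) <# C = g <# (h <# C)"
      using HG l_coset_subset_G by (auto simp: left_cosets_def lcos_m_assoc m_assoc)
  qed (use HG assms(2) in \<open>auto simp: left_cosets_def lcos_m_assoc\<close>)
qed

lemma (in group) stab_left_cosets:
  assumes "subgroup H G" "finite (carrier G)"
  shows "gset.stab G (l_coset G) H = H"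
proof -
  interpret gset G "left_cosets G H" "l_coset G" by (rule gset_left_cosets[OF assms])
  have HG: "H \<subseteq> carrier G" using assms subgroup.subset by blast
  have "g <# H = H \<longleftrightarrow> g \<in> H" if "g \<in> carrier G" for g
    using l_coset_eq_iff[OF assms(1) one_closed that] lcos_mult_one[OF HG] that by auto
  then show ?thesis using HG by (auto simp: stab_def)
qed

lemma (in group) self_mem_left_cosets: "subgroup H G \<Longrightarrow> H \<in> left_cosets G H"
  using lcos_mult_one[OF subgroup.subset] by (force simp: left_cosets_def)

lemma (in group) card_left_cosets:
  assumes "subgroup H G" "finite (carrier G)"
  shows "card (left_cosets G H) * card H = order G"
  using gset.orbit_stab[OF gset_left_cosets[OF assms] self_mem_left_cosets[OF assms(1)]]
  by (simp add: stab_left_cosets[OF assms] left_cosets_def)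

text \<open>
  For \<open>Y = G/H\<close> this is Higman's criterion for projectivity relative to \<open>H\<close>: the relative trace of the
  \<open>H\<close>-endomorphism \<open>s H\<close> is the identity.
\<close>

definition set_projective :: "('k, 'a) ring_scheme \<Rightarrow> ('g, 'b) monoid_scheme \<Rightarrow>
    ('k, 'v, 'g) gmodule \<Rightarrow> 'y set \<Rightarrow> ('g \<Rightarrow> 'y \<Rightarrow> 'y) \<Rightarrow> bool"
  where "set_projective K G M Y \<psi> \<longleftrightarrow> (\<exists>s. (\<forall>y\<in>Y. s y \<in> module_hom K M M) \<and>
    (\<forall>g\<in>carrier G. \<forall>y\<in>Y. \<forall>v\<in>carrier M. act M g (s y v) = s (\<psi> g y) (act M g v)) \<and>
    (\<forall>v\<in>carrier M. (\<Oplus>\<^bsub>M\<^esub>y\<in>Y. s y v) = v))"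

lemma set_projectiveI:
  assumes "\<And>y. y \<in> Y \<Longrightarrow> s y \<in> module_hom K M M"
    and "\<And>g y v. \<lbrakk>g \<in> carrier G; y \<in> Y; v \<in> carrier M\<rbrakk>
      \<Longrightarrow> act M g (s y v) = s (\<psi> g y) (act M g v)"
    and "\<And>v. v \<in> carrier M \<Longrightarrow> (\<Oplus>\<^bsub>M\<^esub>y\<in>Y. s y v) = v"
  shows "set_projective K G M Y \<psi>"
  using assms unfolding set_projective_def by blast

lemma set_projectiveE:
  assumes "set_projective K G M Y \<psi>"
  obtains s where "\<And>y. y \<in> Y \<Longrightarrow> s y \<in> module_hom K M M"
    and "\<And>g y v. \<lbrakk>g \<in> carrier G; y \<in> Y; v \<in> carrier M\<rbrakk>
      \<Longrightarrow> act M g (s y v) = s (\<psi> g y) (act M g v)"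
    and "\<And>v. v \<in> carrier M \<Longrightarrow> (\<Oplus>\<^bsub>M\<^esub>y\<in>Y. s y v) = v"
  using assms unfolding set_projective_def by blast

lemma set_projective_retract:
  assumes L: "linear_rep K G L" and M: "linear_rep K G M"
    and i: "i \<in> kG_hom K G L M" and q: "q \<in> kG_hom K G M L"
    and qi: "\<And>v. v \<in> carrier L \<Longrightarrow> q (i v) = v"
    and p: "set_projective K G M Y \<psi>"
  shows "set_projective K G L Y \<psi>"
proof -
  interpret L: linear_rep K G L by fact
  interpret M: linear_rep K G M by fact
  obtain s where s: "\<And>y. y \<in> Y \<Longrightarrow> s y \<in> module_hom K M M"
    "\<And>g y v. \<lbrakk>g \<in> carrier G; y \<in> Y; v \<in> carrier M\<rbrakk>
      \<Longrightarrow> act M g (s y v) = s (\<psi> g y) (act M g v)"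
    "\<And>v. v \<in> carrier M \<Longrightarrow> (\<Oplus>\<^bsub>M\<^esub>y\<in>Y. s y v) = v"
    using set_projectiveE[OF p] by metis
  note i' = kG_hom_module_hom[OF i] and q' = kG_hom_module_hom[OF q]
  show ?thesis
  proof (rule set_projectiveI[where s = "\<lambda>y v. q (s y (i v))"])
    show "(\<lambda>v. q (s y (i v))) \<in> module_hom K L L" if "y \<in> Y" for y
      using module_hom_comp[OF module_hom_comp[OF i' s(1)[OF that]] q'] .
    show "act L g (q (s y (i v))) = q (s (\<psi> g y) (i (act L g v)))"
      if "g \<in> carrier G" "y \<in> Y" "v \<in> carrier L" for g y v
      using that s module_hom_mem[OF i'] module_hom_mem[OF s(1)]
      by (simp add: kG_hom_act[OF i] flip: kG_hom_act[OF q])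
    show "(\<Oplus>\<^bsub>L\<^esub>y\<in>Y. q (s y (i v))) = v" if v: "v \<in> carrier L" for v
    proof -
      have "(\<Oplus>\<^bsub>L\<^esub>y\<in>Y. q (s y (i v))) = q (\<Oplus>\<^bsub>M\<^esub>y\<in>Y. s y (i v))"
        using v module_hom_mem[OF i'] module_hom_mem[OF s(1)]
        by (intro module_hom_finsum[OF q' M.module_axioms L.module_axioms, symmetric]) auto
      then show ?thesis using v s(3) module_hom_mem[OF i'] qi by simp
    qed
  qed
qed

text \<open>The composites of \<open>s y\<close> with \<open>t z\<close> form the family; summing
  over \<open>z\<close> and then over \<open>y\<close> gives the identity. For two coset spaces the
  stabilizers in the product are intersections of conjugates, which is how Mackey's formula
  enters.\<close>

lemma set_projective_times:
  assumes M: "linear_rep K G M" and Y: "gset G Y \<psi>" and Z: "gset G Z \<chi>"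
    and pY: "set_projective K G M Y \<psi>" and pZ: "set_projective K G M Z \<chi>"
  shows "set_projective K G M (Y \<times> Z) (\<lambda>g (y, z). (\<psi> g y, \<chi> g z))"
proof -
  interpret M: linear_rep K G M by fact
  interpret Y: gset G Y \<psi> by fact
  interpret Z: gset G Z \<chi> by fact
  obtain s where s: "\<And>y. y \<in> Y \<Longrightarrow> s y \<in> module_hom K M M"
    "\<And>g y v. \<lbrakk>g \<in> carrier G; y \<in> Y; v \<in> carrier M\<rbrakk>
      \<Longrightarrow> act M g (s y v) = s (\<psi> g y) (act M g v)"
    "\<And>v. v \<in> carrier M \<Longrightarrow> (\<Oplus>\<^bsub>M\<^esub>y\<in>Y. s y v) = v"
    using set_projectiveE[OF pY] by metis
  obtain t where t: "\<And>z. z \<in> Z \<Longrightarrow> t z \<in> module_hom K M M"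
    "\<And>g z v. \<lbrakk>g \<in> carrier G; z \<in> Z; v \<in> carrier M\<rbrakk>
      \<Longrightarrow> act M g (t z v) = t (\<chi> g z) (act M g v)"
    "\<And>v. v \<in> carrier M \<Longrightarrow> (\<Oplus>\<^bsub>M\<^esub>z\<in>Z. t z v) = v"
    using set_projectiveE[OF pZ] by metis
  note sc = module_hom_mem[OF s(1)] and tc = module_hom_mem[OF t(1)]
  let ?s = "\<lambda>(y, z) v. s y (t z v)"
  show ?thesis
  proof (rule set_projectiveI[where s = ?s])
    show "?s p \<in> module_hom K M M" if "p \<in> Y \<times> Z" for p
      using that module_hom_comp[OF t(1) s(1)] by auto
    show "act M g (?s p v) = ?s ((\<lambda>(y, z). (\<psi> g y, \<chi> g z)) p) (act M g v)"
      if "g \<in> carrier G" "p \<in> Y \<times> Z" "v \<in> carrier M" for g p v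
      using that s(2) t(2) tc by auto
    show "(\<Oplus>\<^bsub>M\<^esub>p\<in>Y \<times> Z. ?s p v) = v" if v: "v \<in> carrier M" for v
    proof -
      have "(\<Oplus>\<^bsub>M\<^esub>p\<in>Y \<times> Z. ?s p v) = (\<Oplus>\<^bsub>M\<^esub>p\<in>Y \<times> Z. case p of (y, z) \<Rightarrow> s y (t z v))"
        using v sc tc by (intro M.M.finsum_cong') auto
      also have "\<dots> = (\<Oplus>\<^bsub>M\<^esub>y\<in>Y. \<Oplus>\<^bsub>M\<^esub>z\<in>Z. s y (t z v))"
        using v sc tc by (intro M.M.add.finprod_finprod[symmetric] Y.finite_set Z.finite_set) auto
      also have "\<dots> = (\<Oplus>\<^bsub>M\<^esub>y\<in>Y. s y (\<Oplus>\<^bsub>M\<^esub>z\<in>Z. t z v))"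
        using v sc tc
        by (intro M.M.finsum_cong' module_hom_finsum[OF s(1) M.module_axioms M.module_axioms, symmetric])
          auto
      also have "\<dots> = v" using v t(3) s(3) by simp
      finally show ?thesis .
    qed
  qed
qed

text \<open>The one-point set is G/G. This family is the starting point for the descent to a Sylow
  subgroup.\<close>

lemma set_projective_singleton:
  assumes M: "linear_rep K G M"
  shows "set_projective K G M {()} (\<lambda>_ _. ())"
proof -
  interpret M: linear_rep K G M by fact
  show ?thesis
    by (rule set_projectiveI[where s = "\<lambda>_ v. v"])
      (auto intro: module_homI)
qed

text \<open>
  Fitting's lemma makes the endomorphism ring local, so splitting \<open>Y\<close> into two stable parts splits
  the identity into two endomorphisms of which one is invertible.
\<close>

lemma set_projective_orbit:
  assumes M: "kG_module K G M" and ind: "indecomposable K G M"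
    and "gset G Y \<psi>" and "set_projective K G M Y \<psi>"
  shows "\<exists>y\<in>Y. set_projective K G M ((\<lambda>g. \<psi> g y) ` carrier G) \<psi>"
  using assms(3,4)
proof (induction "card Y" arbitrary: Y rule: less_induct)
  case less
  have rep: "linear_rep K G M" using M by (simp add: kG_module_iff)
  interpret M: linear_rep K G M by fact
  interpret gset G Y \<psi> by (rule less.prems)
  obtain s where s: "\<And>y. y \<in> Y \<Longrightarrow> s y \<in> module_hom K M M"
    "\<And>g y v. \<lbrakk>g \<in> carrier G; y \<in> Y; v \<in> carrier M\<rbrakk>
      \<Longrightarrow> act M g (s y v) = s (\<psi> g y) (act M g v)"
    "\<And>v. v \<in> carrier M \<Longrightarrow> (\<Oplus>\<^bsub>M\<^esub>y\<in>Y. s y v) = v"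
    using set_projectiveE[OF less.prems(2)] by metis
  note sc = module_hom_mem[OF s(1)]
  have "Y \<noteq> {}"
    using s(3) ind M.M.zero_closed by (auto simp: indecomposable_def)
  then obtain y where y: "y \<in> Y" by blast
  let ?O = "(\<lambda>g. \<psi> g y) ` carrier G"
  have stable: "\<psi> g z \<in> ?O" if "g \<in> carrier G" "z \<in> ?O" for g z
    using that y by (auto simp flip: mult_act)
  have OY: "?O \<subseteq> Y" using y closed by auto
  have stable': "\<psi> g z \<in> Y - ?O" if g: "g \<in> carrier G" and z: "z \<in> Y - ?O" for g z
  proof -
    have "z \<in> ?O" if "\<psi> g z \<in> ?O" using stable[OF M.inv_closed[OF g] that] g z by simp
    then show ?thesis using g z closed by blast
  qed
  \<comment> \<open>A partial sum over a stable subset \<open>Z\<close> is equivariant, because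
    \<open>G\<close> permutes its terms.\<close>
  define t where "t Z v = (\<Oplus>\<^bsub>M\<^esub>z\<in>Z. s z v)" for Z v
  have t: "t Z \<in> kG_hom K G M M"
    if "Z \<subseteq> Y" and Z: "\<And>g z. \<lbrakk>g \<in> carrier G; z \<in> Z\<rbrakk> \<Longrightarrow> \<psi> g z \<in> Z" for Z
  proof (intro kG_homI module_homI)
    have ZY: "z \<in> Z \<Longrightarrow> z \<in> Y" for z using that by blast
    show "t Z v \<in> carrier M" if "v \<in> carrier M" for v
      unfolding t_def using that sc ZY by (intro M.M.finsum_closed) auto
    show "t Z (v \<oplus>\<^bsub>M\<^esub> w) = t Z v \<oplus>\<^bsub>M\<^esub> t Z w" if "v \<in> carrier M" "w \<in> carrier M" for v w
    proof -
      have "t Z (v \<oplus>\<^bsub>M\<^esub> w) = (\<Oplus>\<^bsub>M\<^esub>z\<in>Z. s z v \<oplus>\<^bsub>M\<^esub> s z w)"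
        unfolding t_def using that sc ZY module_hom_add[OF s(1)]
        by (intro M.M.finsum_cong') auto
      then show ?thesis unfolding t_def using that sc ZY by (simp add: Pi_iff)
    qed
    show "t Z (c \<odot>\<^bsub>M\<^esub> v) = c \<odot>\<^bsub>M\<^esub> t Z v" if "c \<in> carrier K" "v \<in> carrier M" for c v
    proof -
      have "t Z (c \<odot>\<^bsub>M\<^esub> v) = (\<Oplus>\<^bsub>M\<^esub>z\<in>Z. c \<odot>\<^bsub>M\<^esub> s z v)"
        unfolding t_def using that sc ZY module_hom_smult[OF s(1)]
        by (intro M.M.finsum_cong') auto
      also have "\<dots> = c \<odot>\<^bsub>M\<^esub> t Z v"
        unfolding t_def using that sc ZY by (intro M.finsum_smult[symmetric]) auto
      finally show ?thesis .
    qed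
    show "t Z (act M g v) = act M g (t Z v)" if g: "g \<in> carrier G" and v: "v \<in> carrier M" for g v
    proof -
      have "act M g (t Z v) = (\<Oplus>\<^bsub>M\<^esub>z\<in>Z. act M g (s z v))"
        unfolding t_def using v sc ZY
        by (intro module_hom_finsum[OF M.act_linear[OF g] M.module_axioms M.module_axioms]) auto
      also have "\<dots> = (\<Oplus>\<^bsub>M\<^esub>z\<in>Z. s (\<psi> g z) (act M g v))"
        using g v s(2) sc ZY Z by (intro M.M.finsum_cong') auto
      also have "\<dots> = t Z (act M g v)"
        unfolding t_def
        by (rule M.M.finsum_reindex_bij_witness[where i = "\<psi> (inv\<^bsub>G\<^esub> g)" and j = "\<psi> g"])
          (use g v Z ZY sc in auto)
      finally show ?thesis by simp
    qed
  qed
  have split: "t ?O v \<oplus>\<^bsub>M\<^esub> t (Y - ?O) v = v" if "v \<in> carrier M" for v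
  proof -
    have "t ?O v \<oplus>\<^bsub>M\<^esub> t (Y - ?O) v = t (?O \<union> (Y - ?O)) v"
      unfolding t_def using that sc OY finite_subset[OF OY finite_set] finite_set
      by (intro M.M.finsum_Un_disjoint[symmetric]) auto
    also have "?O \<union> (Y - ?O) = Y" using OY by blast
    finally show ?thesis using s(3)[OF that] by (simp add: t_def)
  qed
  \<comment> \<open>If the partial sum over \<open>Z\<close> is invertible, its inverse composed
    with the \<open>s z\<close> gives a family over \<open>Z\<close> whose sum is the identity
    again.\<close>
  have restrict: "set_projective K G M Z \<psi>"
    if ZY: "Z \<subseteq> Y" and Z: "\<And>g z. \<lbrakk>g \<in> carrier G; z \<in> Z\<rbrakk> \<Longrightarrow> \<psi> g z \<in> Z"
      and b: "bij_betw (t Z) (carrier M) (carrier M)" for Z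
  proof -
    let ?u = "inv_into (carrier M) (t Z)"
    have u: "?u \<in> kG_hom K G M M" by (rule kG_hom_inv[OF t[OF ZY Z] b rep])
    note u' = kG_hom_module_hom[OF u]
    have ZY: "z \<in> Z \<Longrightarrow> z \<in> Y" for z using ZY by blast
    show ?thesis
    proof (rule set_projectiveI[where s = "\<lambda>z v. ?u (s z v)"])
      show "(\<lambda>v. ?u (s z v)) \<in> module_hom K M M" if "z \<in> Z" for z
        using module_hom_comp[OF s(1) u'] that ZY by blast
      show "act M g (?u (s z v)) = ?u (s (\<psi> g z) (act M g v))"
        if "g \<in> carrier G" "z \<in> Z" "v \<in> carrier M" for g z v
        using that s(2) sc ZY by (simp flip: kG_hom_act[OF u])
      show "(\<Oplus>\<^bsub>M\<^esub>z\<in>Z. ?u (s z v)) = v" if "v \<in> carrier M" for v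
      proof -
        have "(\<Oplus>\<^bsub>M\<^esub>z\<in>Z. ?u (s z v)) = ?u (\<Oplus>\<^bsub>M\<^esub>z\<in>Z. s z v)"
          using that sc ZY
          by (intro module_hom_finsum[OF u' M.module_axioms M.module_axioms, symmetric]) auto
        also have "\<dots> = ?u (t Z v)" by (simp only: t_def)
        also have "\<dots> = v" using b that by (simp add: bij_betw_inv_into_left)
        finally show ?thesis .
      qed
    qed
  qed
  consider "bij_betw (t ?O) (carrier M) (carrier M)" | "bij_betw (t (Y - ?O)) (carrier M) (carrier M)"
    using indecomposable_local[OF M ind t[OF OY stable] t[OF Diff_subset stable'] split] by blast
  then show ?case
  proof cases
    case 1
    then show ?thesis using restrict[OF OY stable] y by blast
  next
    case 2
    have "y \<in> ?O" using y one_act by force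
    then have "card (Y - ?O) < card Y" using y finite_set by (intro psubset_card_mono) auto
    moreover have "gset G (Y - ?O) \<psi>" by (rule subset[OF Diff_subset stable'])
    ultimately show ?thesis
      using less.hyps[of "Y - ?O"] restrict[OF Diff_subset stable' 2] by blast
  qed
qed

text \<open>Since \<open>H\<close> fixes \<open>z\<close>, sending gH to g z is a well-defined
  equivariant map \<open>q\<close> from G/H onto \<open>Z\<close>. Its fibres have \<open>m\<close>
  elements, so the endomorphisms \<open>s (q C)\<close> divided by \<open>m\<close> again add up to
  the identity. With \<open>m = 1\<close> this identifies an orbit with a coset space; with
  \<open>m\<close> prime to the characteristic it descends to a smaller subgroup.\<close>

lemma set_projective_left_cosets:
  assumes M: "linear_rep K G M" and fin: "finite (carrier G)"
    and Z: "gset G Z \<chi>" and p: "set_projective K G M Z \<chi>"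
    and z: "z \<in> Z" and trans: "(\<lambda>g. \<chi> g z) ` carrier G = Z"
    and H: "subgroup H G" "H \<subseteq> gset.stab G \<chi> z"
    and m: "card (gset.stab G \<chi> z) = m * card H" "[m] \<cdot>\<^bsub>K\<^esub> \<one>\<^bsub>K\<^esub> \<noteq> \<zero>\<^bsub>K\<^esub>"
  shows "set_projective K G M (left_cosets G H) (l_coset G)"
proof -
  interpret M: linear_rep K G M by fact
  interpret Z: gset G Z \<chi> by fact
  let ?C = "left_cosets G H"
  interpret C: gset G ?C "l_coset G" by (rule M.gset_left_cosets[OF H(1) fin])
  obtain s where s: "\<And>z. z \<in> Z \<Longrightarrow> s z \<in> module_hom K M M"
    "\<And>g z v. \<lbrakk>g \<in> carrier G; z \<in> Z; v \<in> carrier M\<rbrakk>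
      \<Longrightarrow> act M g (s z v) = s (\<chi> g z) (act M g v)"
    "\<And>v. v \<in> carrier M \<Longrightarrow> (\<Oplus>\<^bsub>M\<^esub>z\<in>Z. s z v) = v"
    using set_projectiveE[OF p] by metis
  note sc = module_hom_mem[OF s(1)]
  define q where "q C = \<chi> (SOME g. g \<in> carrier G \<and> C = g <#\<^bsub>G\<^esub> H) z" for C
  have q: "q (g <#\<^bsub>G\<^esub> H) = \<chi> g z" if g: "g \<in> carrier G" for g
  proof -
    define h where "h = (SOME h. h \<in> carrier G \<and> g <#\<^bsub>G\<^esub> H = h <#\<^bsub>G\<^esub> H)"
    have h: "h \<in> carrier G" "g <#\<^bsub>G\<^esub> H = h <#\<^bsub>G\<^esub> H"
      using someI[of "\<lambda>h. h \<in> carrier G \<and> g <#\<^bsub>G\<^esub> H = h <#\<^bsub>G\<^esub> H" g] g by (auto simp: h_def)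
    then have "inv\<^bsub>G\<^esub> g \<otimes>\<^bsub>G\<^esub> h \<in> Z.stab z" using H g by (auto simp: M.l_coset_eq_iff)
    then have "\<chi> (inv\<^bsub>G\<^esub> g) (\<chi> h z) = z" using g h z by (simp add: Z.stab_def Z.mult_act)
    then have "\<chi> h z = \<chi> g z" using g h z Z.act_inv(1)[OF g, of "\<chi> h z"] Z.closed by simp
    then show ?thesis by (simp add: q_def h_def)
  qed
  have qZ: "q C \<in> Z" if "C \<in> ?C" for C using that q z Z.closed by (auto simp: left_cosets_def)
  have q_act: "q (g <#\<^bsub>G\<^esub> C) = \<chi> g (q C)" if "g \<in> carrier G" "C \<in> ?C" for g C
    using that z subgroup.subset[OF H(1)]
    by (auto simp: left_cosets_def q M.lcos_m_assoc Z.mult_act)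
  define F where "F w = {C \<in> ?C. q C = w}" for w
  have F: "card (F (\<chi> g w)) = card (F w)" if g: "g \<in> carrier G" and w: "w \<in> Z" for g w
  proof -
    have "bij_betw (\<lambda>C. g <#\<^bsub>G\<^esub> C) (F w) (F (\<chi> g w))"
      by (rule bij_betw_byWitness[where f' = "\<lambda>C. inv\<^bsub>G\<^esub> g <#\<^bsub>G\<^esub> C"])
        (use g w C.closed q_act in \<open>auto simp: F_def\<close>)
    then show ?thesis using bij_betw_same_card by metis
  qed
  \<comment> \<open>Equivariance makes all fibres equally large. Their common size follows by
    computing the order of \<open>G\<close> once through the cosets of \<open>H\<close> and once
    through the orbit \<open>Z\<close> and its stabilizer.\<close>
  have "card (F w) = m" if "w \<in> Z" for w
  proof -
    have cw: "card (F w) = card (F z)" if w: "w \<in> Z" for w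
    proof -
      obtain g where "g \<in> carrier G" "w = \<chi> g z" using w trans by blast
      then show ?thesis using F z by simp
    qed
    have "?C = (\<Union>w\<in>Z. F w)" using qZ by (auto simp: F_def)
    then have "card ?C = (\<Sum>w\<in>Z. card (F w))"
      using C.finite_set Z.finite_set by (simp only:) (intro card_UN_disjoint, auto simp: F_def)
    also have "\<dots> = card Z * card (F z)" using cw by simp
    finally have "card Z * card (F z) * card H = card Z * (m * card H)"
      using M.card_left_cosets[OF H(1) fin] Z.orbit_stab[OF z] m trans by simp
    moreover have "card Z \<noteq> 0" using z Z.finite_set by auto
    moreover have "card H \<noteq> 0"
      using subgroup.one_closed[OF H(1)] finite_subset[OF subgroup.subset[OF H(1)] fin] by auto
    ultimately show ?thesis using cw[OF that] by simp
  qed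
  note cardF = this
  define c where "c = [m] \<cdot>\<^bsub>K\<^esub> \<one>\<^bsub>K\<^esub>"
  have c: "c \<in> carrier K" "c \<noteq> \<zero>\<^bsub>K\<^esub>" using m by (auto simp: c_def)
  then have cU: "c \<in> Units K" using M.field_Units by simp
  have ic: "inv\<^bsub>K\<^esub> c \<in> carrier K" using cU by (rule M.R.Units_inv_closed)
  have sum: "(\<Oplus>\<^bsub>M\<^esub>C\<in>F w. inv\<^bsub>K\<^esub> c \<odot>\<^bsub>M\<^esub> v) = v" if "w \<in> Z" "v \<in> carrier M" for w v
  proof -
    have "(\<Oplus>\<^bsub>M\<^esub>C\<in>F w. inv\<^bsub>K\<^esub> c \<odot>\<^bsub>M\<^esub> v) = (\<Oplus>\<^bsub>K\<^esub>C\<in>F w. inv\<^bsub>K\<^esub> c) \<odot>\<^bsub>M\<^esub> v"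
      using that ic by (intro M.finsum_smult_r[symmetric]) auto
    also have "(\<Oplus>\<^bsub>K\<^esub>C\<in>F w. inv\<^bsub>K\<^esub> c) = [m] \<cdot>\<^bsub>K\<^esub> (inv\<^bsub>K\<^esub> c)"
      using ic cardF[OF that(1)] by (simp add: M.R.add.finprod_const)
    also have "\<dots> = c \<otimes>\<^bsub>K\<^esub> inv\<^bsub>K\<^esub> c"
      using ic by (simp add: c_def M.R.add_pow_ldistr)
    also have "\<dots> = \<one>\<^bsub>K\<^esub>" using cU by simp
    finally show ?thesis using that by simp
  qed
  show ?thesis
  proof (rule set_projectiveI[where s = "\<lambda>C v. inv\<^bsub>K\<^esub> c \<odot>\<^bsub>M\<^esub> s (q C) v"])
    show "(\<lambda>v. inv\<^bsub>K\<^esub> c \<odot>\<^bsub>M\<^esub> s (q C) v) \<in> module_hom K M M" if "C \<in> ?C" for C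
    proof (rule module_homI)
      fix d v assume "d \<in> carrier K" "v \<in> carrier M"
      then show "inv\<^bsub>K\<^esub> c \<odot>\<^bsub>M\<^esub> s (q C) (d \<odot>\<^bsub>M\<^esub> v) = d \<odot>\<^bsub>M\<^esub> (inv\<^bsub>K\<^esub> c \<odot>\<^bsub>M\<^esub> s (q C) v)"
        using qZ[OF that] sc ic
        by (simp add: module_hom_smult[OF s(1)] M.R.m_comm flip: M.smult_assoc1)
    qed (use qZ[OF that] sc ic in \<open>auto simp: module_hom_add[OF s(1)] M.smult_r_distr\<close>)
    show "act M g (inv\<^bsub>K\<^esub> c \<odot>\<^bsub>M\<^esub> s (q C) v) = inv\<^bsub>K\<^esub> c \<odot>\<^bsub>M\<^esub> s (q (g <#\<^bsub>G\<^esub> C)) (act M g v)"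
      if "g \<in> carrier G" "C \<in> ?C" "v \<in> carrier M" for g C v
      using that qZ sc ic by (simp add: M.act_smult s(2) q_act)
    show "(\<Oplus>\<^bsub>M\<^esub>C\<in>?C. inv\<^bsub>K\<^esub> c \<odot>\<^bsub>M\<^esub> s (q C) v) = v" if v: "v \<in> carrier M" for v
    proof -
      have "?C = (\<Union>w\<in>Z. F w)" using qZ by (auto simp: F_def)
      then have "(\<Oplus>\<^bsub>M\<^esub>C\<in>?C. inv\<^bsub>K\<^esub> c \<odot>\<^bsub>M\<^esub> s (q C) v)
          = (\<Oplus>\<^bsub>M\<^esub>C\<in>(\<Union>w\<in>Z. F w). inv\<^bsub>K\<^esub> c \<odot>\<^bsub>M\<^esub> s (q C) v)" by simp
      also have "\<dots> = (\<Oplus>\<^bsub>M\<^esub>w\<in>Z. \<Oplus>\<^bsub>M\<^esub>C\<in>F w. inv\<^bsub>K\<^esub> c \<odot>\<^bsub>M\<^esub> s (q C) v)"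
        using C.finite_set Z.finite_set v ic sc
        by (intro M.M.add.finprod_UN_disjoint) (auto simp: F_def pairwise_def disjnt_def)
      also have "\<dots> = (\<Oplus>\<^bsub>M\<^esub>w\<in>Z. \<Oplus>\<^bsub>M\<^esub>C\<in>F w. inv\<^bsub>K\<^esub> c \<odot>\<^bsub>M\<^esub> s w v)"
        using v ic sc by (intro M.M.finsum_cong') (auto simp: F_def intro!: M.M.finsum_cong' M.M.finsum_closed)
      also have "\<dots> = (\<Oplus>\<^bsub>M\<^esub>w\<in>Z. s w v)"
        using v sc sum by (intro M.M.finsum_cong') auto
      also have "\<dots> = v" using s(3) v .
      finally show ?thesis .
    qed
  qed
qed

section \<open>Permutation modules and induced modules\<close>

lemma with_action_simps [simp]:
  "carrier (with_action M a) = carrier M" "zero (with_action M a) = zero M"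
  "add (with_action M a) = add M" "smult (with_action M a) = smult M"
  "act (with_action M a) = a"
  by (simp_all add: with_action_def module.defs gmodule.defs)

lemma with_action_carrier_update:
  "with_action (M\<lparr>carrier := A\<rparr>) a = (with_action M a)\<lparr>carrier := A\<rparr>"
  by (simp add: with_action_def module.defs gmodule.defs)

lemma module_with_action:
  assumes "module K M"
  shows "module K (with_action M a)"
proof -
  interpret M: module K M by fact
  show ?thesis
  proof (rule module_criteria)
    show "\<forall>v\<in>carrier (with_action M a). \<exists>n\<in>carrier (with_action M a).
        v \<oplus>\<^bsub>with_action M a\<^esub> n = \<zero>\<^bsub>with_action M a\<^esub>"
      using M.M.r_neg by auto
  qed (auto simp: M.R.is_cring M.M.a_ac M.smult_assoc1 M.smult_l_distr M.smult_r_distr)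
qed

lemma linear_rep_with_action:
  assumes "module K M" "field K" "group G"
    and "\<And>g. g \<in> carrier G \<Longrightarrow> a g \<in> module_hom K M M"
    and "\<And>v. v \<in> carrier M \<Longrightarrow> a \<one>\<^bsub>G\<^esub> v = v"
    and "\<And>g h v. \<lbrakk>g \<in> carrier G; h \<in> carrier G; v \<in> carrier M\<rbrakk> \<Longrightarrow> a (g \<otimes>\<^bsub>G\<^esub> h) v = a g (a h v)"
  shows "linear_rep K G (with_action M a)"
  using assms
  by (intro linear_rep.intro linear_rep_axioms.intro vectorspace.intro module_with_action)
    (auto simp: module_hom_def)

lemma fun_module_simps [simp]:
  "carrier (fun_module Z M) = Z \<rightarrow>\<^sub>E carrier M" "zero (fun_module Z M) = (\<lambda>z\<in>Z. \<zero>\<^bsub>M\<^esub>)"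
  "add (fun_module Z M) = (\<lambda>f f'. \<lambda>z\<in>Z. f z \<oplus>\<^bsub>M\<^esub> f' z)"
  "smult (fun_module Z M) = (\<lambda>c f. \<lambda>z\<in>Z. c \<odot>\<^bsub>M\<^esub> f z)"
  by (simp_all add: fun_module_def)

lemma fun_module_is_module:
  assumes "module K M"
  shows "module K (fun_module Z M)"
proof -
  interpret M: module K M by fact
  show ?thesis
  proof (rule module_criteria)
    show "\<forall>v\<in>carrier (fun_module Z M). \<exists>n\<in>carrier (fun_module Z M).
        v \<oplus>\<^bsub>fun_module Z M\<^esub> n = \<zero>\<^bsub>fun_module Z M\<^esub>"
    proof
      fix v assume "v \<in> carrier (fun_module Z M)"
      then show "\<exists>n\<in>carrier (fun_module Z M). v \<oplus>\<^bsub>fun_module Z M\<^esub> n = \<zero>\<^bsub>fun_module Z M\<^esub>"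
        by (intro bexI[of _ "\<lambda>z\<in>Z. \<ominus>\<^bsub>M\<^esub> v z"]) (auto simp: fun_eq_iff M.M.r_neg PiE_iff)
    qed
    show "\<forall>v\<in>carrier (fun_module Z M). v \<oplus>\<^bsub>fun_module Z M\<^esub> \<zero>\<^bsub>fun_module Z M\<^esub> = v"
      by (auto simp: fun_eq_iff PiE_iff extensional_def)
    show "\<forall>v\<in>carrier (fun_module Z M). \<one>\<^bsub>K\<^esub> \<odot>\<^bsub>fun_module Z M\<^esub> v = v"
      by (auto simp: fun_eq_iff PiE_iff extensional_def)
  qed (auto simp: M.R.is_cring fun_eq_iff M.M.a_ac M.smult_assoc1 M.smult_l_distr M.smult_r_distr
        PiE_iff)
qed

lemma finsum_pointwise:
  assumes "abelian_monoid P" "abelian_monoid R"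
    and "\<zero>\<^bsub>P\<^esub> y = \<zero>\<^bsub>R\<^esub>"
    and "\<And>u v. \<lbrakk>u \<in> carrier P; v \<in> carrier P\<rbrakk> \<Longrightarrow> (u \<oplus>\<^bsub>P\<^esub> v) y = u y \<oplus>\<^bsub>R\<^esub> v y"
    and "\<And>u. u \<in> carrier P \<Longrightarrow> u y \<in> carrier R"
    and "f \<in> A \<rightarrow> carrier P"
  shows "(\<Oplus>\<^bsub>P\<^esub>a\<in>A. f a) y = (\<Oplus>\<^bsub>R\<^esub>a\<in>A. f a y)"
proof -
  interpret P: abelian_monoid P by fact
  interpret R: abelian_monoid R by fact
  show ?thesis
    using assms(6)
  proof (induct A rule: infinite_finite_induct)
    case (insert a A)
    then show ?case by (simp add: assms(4,5) Pi_iff)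
  qed (auto simp: assms(3))
qed

section \<open>Permutation modules\<close>

lemma perm_module_simps [simp]:
  assumes "field K"
  shows "carrier (perm_module K G Y \<psi>) = Y \<rightarrow>\<^sub>E carrier K"
    "zero (perm_module K G Y \<psi>) = (\<lambda>y\<in>Y. \<zero>\<^bsub>K\<^esub>)"
    "add (perm_module K G Y \<psi>) = (\<lambda>f f'. \<lambda>y\<in>Y. f y \<oplus>\<^bsub>K\<^esub> f' y)"
    "smult (perm_module K G Y \<psi>) = (\<lambda>c f. \<lambda>y\<in>Y. c \<otimes>\<^bsub>K\<^esub> f y)"
    "act (perm_module K G Y \<psi>) = (\<lambda>g c. \<lambda>x\<in>Y. c (\<psi> (inv\<^bsub>G\<^esub> g) x))"
proof -
  interpret field K by fact
  show "carrier (perm_module K G Y \<psi>) = Y \<rightarrow>\<^sub>E carrier K"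
    "zero (perm_module K G Y \<psi>) = (\<lambda>y\<in>Y. \<zero>\<^bsub>K\<^esub>)"
    "add (perm_module K G Y \<psi>) = (\<lambda>f f'. \<lambda>y\<in>Y. f y \<oplus>\<^bsub>K\<^esub> f' y)"
    "smult (perm_module K G Y \<psi>) = (\<lambda>c f. \<lambda>y\<in>Y. c \<otimes>\<^bsub>K\<^esub> f y)"
    "act (perm_module K G Y \<psi>) = (\<lambda>g c. \<lambda>x\<in>Y. c (\<psi> (inv\<^bsub>G\<^esub> g) x))"
    by (simp_all add: perm_module_def func_space_def)
qed

lemma linear_rep_perm_module:
  assumes K: "field K" and Y: "gset G Y \<psi>"
  shows "linear_rep K G (perm_module K G Y \<psi>)"
proof -
  interpret K: field K by fact
  interpret Y: gset G Y \<psi> by fact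
  have m: "module K (K.func_space Y)" by (rule K.func_space_is_module)
  have [simp]: "carrier (K.func_space Y) = Y \<rightarrow>\<^sub>E carrier K"
    "add (K.func_space Y) = (\<lambda>f f'. \<lambda>y\<in>Y. f y \<oplus>\<^bsub>K\<^esub> f' y)"
    "smult (K.func_space Y) = (\<lambda>c f. \<lambda>y\<in>Y. c \<otimes>\<^bsub>K\<^esub> f y)"
    by (simp_all add: K.func_space_def)
  show ?thesis
    unfolding perm_module_def
    by (rule linear_rep_with_action[OF m K Y.group_axioms])
      (auto intro!: module_homI simp: fun_eq_iff Y.closed Y.one_act Y.mult_act PiE_iff extensional_def
        Y.inv_mult_group)
qed

lemma perm_module_finsum:
  assumes K: "field K" and Y: "gset G Y \<psi>" and "y \<in> Y" "f \<in> A \<rightarrow> (Y \<rightarrow>\<^sub>E carrier K)"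
  shows "(\<Oplus>\<^bsub>perm_module K G Y \<psi>\<^esub>a\<in>A. f a) y = (\<Oplus>\<^bsub>K\<^esub>a\<in>A. f a y)"
proof -
  interpret K: field K by fact
  interpret P: linear_rep K G "perm_module K G Y \<psi>" by (rule linear_rep_perm_module[OF K Y])
  show ?thesis
    using assms by (intro finsum_pointwise P.M.abelian_monoid_axioms K.abelian_monoid_axioms) auto
qed

lemma perm_module_decomposition:
  assumes K: "field K" and Y: "gset G Y \<psi>" and v: "v \<in> carrier (perm_module K G Y \<psi>)"
  shows "(\<Oplus>\<^bsub>perm_module K G Y \<psi>\<^esub>y\<in>Y. (\<lambda>x\<in>Y. if y = x then v x else \<zero>\<^bsub>K\<^esub>)) = v"
    (is "?sum = v")
proof (rule extensionalityI[of _ Y])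
  interpret K: field K by fact
  interpret Y: gset G Y \<psi> by fact
  let ?P = "perm_module K G Y \<psi>"
  interpret P: linear_rep K G ?P by (rule linear_rep_perm_module[OF K Y])
  have "?sum \<in> carrier ?P"
    using v by (intro P.M.finsum_closed) (auto simp: K)
  then show "?sum \<in> extensional Y" by (simp add: K PiE_iff)
  show "v \<in> extensional Y" using v by (simp add: K PiE_iff)
  fix x assume x: "x \<in> Y"
  have "?sum x = (\<Oplus>\<^bsub>K\<^esub>y\<in>Y. (\<lambda>x\<in>Y. if y = x then v x else \<zero>\<^bsub>K\<^esub>) x)"
    using v x by (intro perm_module_finsum[OF K Y]) (auto simp: K)
  also have "\<dots> = (\<Oplus>\<^bsub>K\<^esub>y\<in>Y. if x = y then v y else \<zero>\<^bsub>K\<^esub>)"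
    using v x by (intro K.finsum_cong') (auto simp: K)
  also have "\<dots> = v x"
    using v x by (intro K.add.finprod_singleton Y.finite_set) (auto simp: K)
  finally show "?sum x = v x" .
qed

text \<open>The coordinate projections are the family: \<open>g\<close> carries the line spanned by
  \<open>y\<close> to the line spanned by \<psi> g y.\<close>

lemma set_projective_perm_module:
  assumes K: "field K" and Y: "gset G Y \<psi>"
  shows "set_projective K G (perm_module K G Y \<psi>) Y \<psi>"
proof -
  interpret Y: gset G Y \<psi> by fact
  let ?P = "perm_module K G Y \<psi>"
  interpret P: linear_rep K G ?P by (rule linear_rep_perm_module[OF K Y])
  let ?s = "\<lambda>y c. \<lambda>x\<in>Y. if y = x then c x else \<zero>\<^bsub>K\<^esub>"
  show ?thesis
  proof (rule set_projectiveI[where s = ?s])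
    show "?s y \<in> module_hom K ?P ?P" if "y \<in> Y" for y
      by (rule module_homI) (auto simp: K fun_eq_iff)
    show "act ?P g (?s y v) = ?s (\<psi> g y) (act ?P g v)"
      if "g \<in> carrier G" "y \<in> Y" "v \<in> carrier ?P" for g y v
    proof -
      have "y = \<psi> (inv\<^bsub>G\<^esub> g) x \<longleftrightarrow> \<psi> g y = x" if "x \<in> Y" for x
        using that \<open>g \<in> carrier G\<close> \<open>y \<in> Y\<close> by auto
      then show ?thesis using that by (auto simp: K fun_eq_iff Y.closed)
    qed
  qed (rule perm_module_decomposition[OF K Y])
qed

lemma kG_module_spanned:
  fixes Y :: "'y set"
  assumes M: "linear_rep K G M" and Y: "finite Y" and x: "\<And>y. y \<in> Y \<Longrightarrow> x y \<in> carrier M"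
    and span: "\<And>v. v \<in> carrier M
      \<Longrightarrow> \<exists>c\<in>Y \<rightarrow> carrier K. v = (\<Oplus>\<^bsub>M\<^esub>y\<in>Y. c y \<odot>\<^bsub>M\<^esub> x y)"
  shows "kG_module K G M"
proof -
  interpret M: linear_rep K G M by fact
  have xM: "x ` Y \<subseteq> carrier M" using x by blast
  interpret sp: submodule K "M.span (x ` Y)" M by (rule M.span_is_submodule[OF xM])
  have fin: "(\<Oplus>\<^bsub>M\<^esub>a\<in>A. f a) \<in> M.span (x ` Y)" if "f \<in> A \<rightarrow> M.span (x ` Y)" for f and A :: "'y set"
    using that
  proof (induct A rule: infinite_finite_induct)
    case (insert a A)
    then have "f \<in> insert a A \<rightarrow> carrier M" using sp.subset by blast
    then have "(\<Oplus>\<^bsub>M\<^esub>a\<in>insert a A. f a) = f a \<oplus>\<^bsub>M\<^esub> (\<Oplus>\<^bsub>M\<^esub>a\<in>A. f a)"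
      using insert by (intro M.M.finsum_insert) auto
    then show ?case using insert by auto
  qed auto
  have "carrier M \<subseteq> M.span (x ` Y)"
  proof
    fix v assume "v \<in> carrier M"
    then obtain c where "c \<in> Y \<rightarrow> carrier K" "v = (\<Oplus>\<^bsub>M\<^esub>y\<in>Y. c y \<odot>\<^bsub>M\<^esub> x y)" using span by blast
    then show "v \<in> M.span (x ` Y)" using M.in_own_span[OF xM] by (auto intro!: fin)
  qed
  then have "M.fin_dim" unfolding M.fin_dim_def using xM Y sp.subset by blast
  then show ?thesis using M by (simp add: kG_module_iff)
qed

lemma kG_module_perm_module:
  assumes K: "field K" and Y: "gset G Y \<psi>"
  shows "kG_module K G (perm_module K G Y \<psi>)"
proof -
  interpret K: field K by fact
  let ?P = "perm_module K G Y \<psi>"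
  let ?\<delta> = "\<lambda>y. \<lambda>x\<in>Y. if y = x then \<one>\<^bsub>K\<^esub> else \<zero>\<^bsub>K\<^esub>"
  interpret P: linear_rep K G ?P by (rule linear_rep_perm_module[OF K Y])
  show ?thesis
  proof (rule kG_module_spanned[OF P.linear_rep_axioms gset.finite_set[OF Y]])
    show "?\<delta> y \<in> carrier ?P" for y by (auto simp: K)
    fix v assume v: "v \<in> carrier ?P"
    have val: "v y \<in> carrier K" if "y \<in> Y" for y using v that by (auto simp: K)
    have "(\<Oplus>\<^bsub>?P\<^esub>y\<in>Y. v y \<odot>\<^bsub>?P\<^esub> ?\<delta> y) = (\<Oplus>\<^bsub>?P\<^esub>y\<in>Y. (\<lambda>x\<in>Y. if y = x then v x else \<zero>\<^bsub>K\<^esub>))"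
      using val by (intro P.M.finsum_cong') (auto simp: K fun_eq_iff)
    then show "\<exists>c\<in>Y \<rightarrow> carrier K. v = (\<Oplus>\<^bsub>?P\<^esub>y\<in>Y. c y \<odot>\<^bsub>?P\<^esub> ?\<delta> y)"
      using perm_module_decomposition[OF K Y v] val by (intro bexI[of _ v]) auto
  qed
qed

section \<open>Induced modules and the two directions of Higman's criterion\<close>

lemma (in group) mem_left_coset_iff:
  assumes "subgroup H G" "C \<in> left_cosets G H" "x \<in> carrier G"
  shows "x \<in> C \<longleftrightarrow> x <# H = C"
proof -
  obtain g where g: "g \<in> carrier G" "C = g <# H" using assms(2) by (auto simp: left_cosets_def)
  show ?thesis
    unfolding g(2)
    using l_repr_independence[OF _ g(1) assms(1), of x] mem_l_coset[OF assms(1,3)] by auto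
qed

lemma induced_module_simps [simp]:
  "carrier (induced_module G H V) = {f \<in> carrier G \<rightarrow>\<^sub>E carrier V.
       \<forall>g\<in>carrier G. \<forall>h\<in>H. f (g \<otimes>\<^bsub>G\<^esub> h) = act V (inv\<^bsub>G\<^esub> h) (f g)}"
  "zero (induced_module G H V) = (\<lambda>x\<in>carrier G. \<zero>\<^bsub>V\<^esub>)"
  "add (induced_module G H V) = (\<lambda>f f'. \<lambda>x\<in>carrier G. f x \<oplus>\<^bsub>V\<^esub> f' x)"
  "smult (induced_module G H V) = (\<lambda>c f. \<lambda>x\<in>carrier G. c \<odot>\<^bsub>V\<^esub> f x)"
  "act (induced_module G H V) = (\<lambda>g f. \<lambda>x\<in>carrier G. f (inv\<^bsub>G\<^esub> g \<otimes>\<^bsub>G\<^esub> x))"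
  by (simp_all add: induced_module_def)

lemma linear_rep_induced_module:
  assumes G: "group G" and H: "subgroup H G" and V: "linear_rep K (G\<lparr>carrier := H\<rparr>) V"
  shows "linear_rep K G (induced_module G H V)"
proof -
  interpret G: group G by fact
  interpret V: linear_rep K "G\<lparr>carrier := H\<rparr>" V by fact
  interpret H: subgroup H G by fact
  let ?a = "\<lambda>g f. \<lambda>x\<in>carrier G. f (inv\<^bsub>G\<^esub> g \<otimes>\<^bsub>G\<^esub> x)"
  let ?F = "with_action (fun_module (carrier G) V) ?a"
  let ?I = "{f \<in> carrier G \<rightarrow>\<^sub>E carrier V.
       \<forall>g\<in>carrier G. \<forall>h\<in>H. f (g \<otimes>\<^bsub>G\<^esub> h) = act V (inv\<^bsub>G\<^esub> h) (f g)}"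
  have F: "linear_rep K G ?F"
    by (rule linear_rep_with_action[OF fun_module_is_module[OF V.module_axioms] V.field_axioms G])
      (auto intro!: module_homI simp: fun_eq_iff G.m_assoc G.inv_mult_group PiE_iff extensional_def)
  have "act V h \<zero>\<^bsub>V\<^esub> = \<zero>\<^bsub>V\<^esub>" if "h \<in> H" for h
    using module_hom_zero[OF V.act_linear V.module_axioms V.module_axioms] that by simp
  then have "kG_submodule K G ?F ?I"
    by (intro kG_submoduleI[OF F]) (auto simp: V.act_add V.act_smult PiE_iff extensional_def simp flip: G.m_assoc)
  then show ?thesis
    using linear_rep_submodule[OF F] by (simp add: induced_module_def with_action_carrier_update)
qed

text \<open>\<open>?s C\<close> cuts a function down to the coset \<open>C\<close>. In the tensor
  product this is the projection onto the component g \<otimes> V with C = gH. The result stays in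
  the induced module because the equivariance condition relates only values within one
  coset.\<close>

lemma set_projective_induced_module:
  assumes G: "group G" and fin: "finite (carrier G)" and H: "subgroup H G"
    and V: "linear_rep K (G\<lparr>carrier := H\<rparr>) V"
  shows "set_projective K G (induced_module G H V) (left_cosets G H) (l_coset G)"
proof -
  interpret G: group G by fact
  interpret V: linear_rep K "G\<lparr>carrier := H\<rparr>" V by fact
  interpret H: subgroup H G by fact
  let ?I = "induced_module G H V" and ?C = "left_cosets G H"
  interpret I: linear_rep K G ?I by (rule linear_rep_induced_module[OF G H V])
  interpret C: gset G ?C "l_coset G" by (rule G.gset_left_cosets[OF H fin])
  note mem = G.mem_left_coset_iff[OF H]
  have zero: "act V h \<zero>\<^bsub>V\<^esub> = \<zero>\<^bsub>V\<^esub>" if "h \<in> H" for h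
    using module_hom_zero[OF V.act_linear V.module_axioms V.module_axioms] that by simp
  have mult: "(g \<otimes>\<^bsub>G\<^esub> h) <#\<^bsub>G\<^esub> H = g <#\<^bsub>G\<^esub> H" if "g \<in> carrier G" "h \<in> H" for g h
    using that H by (simp add: G.l_coset_eq_iff G.inv_mult_group G.m_assoc)
  have trans: "x \<in> g <#\<^bsub>G\<^esub> C \<longleftrightarrow> inv\<^bsub>G\<^esub> g \<otimes>\<^bsub>G\<^esub> x \<in> C"
    if "g \<in> carrier G" "x \<in> carrier G" "C \<in> ?C" for g x C
  proof -
    have "inv\<^bsub>G\<^esub> g \<otimes>\<^bsub>G\<^esub> x \<in> C \<longleftrightarrow> (inv\<^bsub>G\<^esub> g \<otimes>\<^bsub>G\<^esub> x) <#\<^bsub>G\<^esub> H = C"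
      using that by (simp add: mem)
    also have "(inv\<^bsub>G\<^esub> g \<otimes>\<^bsub>G\<^esub> x) <#\<^bsub>G\<^esub> H = inv\<^bsub>G\<^esub> g <#\<^bsub>G\<^esub> (x <#\<^bsub>G\<^esub> H)"
      using that H.subset by (simp add: G.lcos_m_assoc)
    also have "\<dots> = C \<longleftrightarrow> x <#\<^bsub>G\<^esub> H = g <#\<^bsub>G\<^esub> C"
      using that by (metis C.act_inv G.inv_closed image_eqI left_cosets_def)
    finally show ?thesis using that C.closed by (simp add: mem)
  qed
  let ?s = "\<lambda>C f. \<lambda>x\<in>carrier G. if x \<in> C then f x else \<zero>\<^bsub>V\<^esub>"
  have s: "?s C f \<in> carrier ?I" if "C \<in> ?C" "f \<in> carrier ?I" for C f
    using that by (auto simp: mem mult zero)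
  show ?thesis
  proof (rule set_projectiveI[where s = ?s])
    show "?s C \<in> module_hom K ?I ?I" if "C \<in> ?C" for C
      by (rule module_homI[OF s[OF that]]) (auto simp: fun_eq_iff)
    show "act ?I g (?s C f) = ?s (g <#\<^bsub>G\<^esub> C) (act ?I g f)"
      if "g \<in> carrier G" "C \<in> ?C" "f \<in> carrier ?I" for g C f
      using that by (auto simp: fun_eq_iff trans)
    show "(\<Oplus>\<^bsub>?I\<^esub>C\<in>?C. ?s C f) = f" if f: "f \<in> carrier ?I" for f
    proof (rule extensionalityI[of _ "carrier G"])
      have "(\<Oplus>\<^bsub>?I\<^esub>C\<in>?C. ?s C f) \<in> carrier ?I"
        using s f by (intro I.M.finsum_closed) blast
      then show "(\<Oplus>\<^bsub>?I\<^esub>C\<in>?C. ?s C f) \<in> extensional (carrier G)" by (simp add: PiE_iff)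
      show "f \<in> extensional (carrier G)" using f by (simp add: PiE_iff)
      fix x assume x: "x \<in> carrier G"
      have xC: "x <#\<^bsub>G\<^esub> H \<in> ?C" using x by (simp add: left_cosets_def)
      have "(\<Oplus>\<^bsub>?I\<^esub>C\<in>?C. ?s C f) x = (\<Oplus>\<^bsub>V\<^esub>C\<in>?C. ?s C f x)"
        using s f x
        by (intro finsum_pointwise I.M.abelian_monoid_axioms V.M.abelian_monoid_axioms) auto
      also have "\<dots> = (\<Oplus>\<^bsub>V\<^esub>C\<in>?C. if x <#\<^bsub>G\<^esub> H = C then f x else \<zero>\<^bsub>V\<^esub>)"
        using f x by (intro V.M.finsum_cong') (auto simp: mem)
      also have "\<dots> = f x"
        using f x xC by (intro V.M.add.finprod_singleton C.finite_set) auto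
      finally show "(\<Oplus>\<^bsub>?I\<^esub>C\<in>?C. ?s C f) x = f x" .
    qed
  qed
qed

text \<open>The family that the cosets provide on the induced module is inherited by its retract
  \<open>M\<close>.\<close>

lemma relatively_projective_imp_set_projective:
  fixes K :: "('k, 'a) ring_scheme" and G :: "('g, 'b) monoid_scheme"
    and M :: "('k, 'v, 'g) gmodule"
  assumes fin: "finite (carrier G)" and H: "subgroup H G" and M: "linear_rep K G M"
    and p: "relatively_projective K G H M"
  shows "set_projective K G M (left_cosets G H) (l_coset G)"
proof -
  interpret M: linear_rep K G M by fact
  obtain V :: "('k, nat \<Rightarrow> 'k, 'g) gmodule" where V: "kG_module K (G\<lparr>carrier := H\<rparr>) V"
    and s: "iso_to_summand K G M (induced_module G H V)"
    using p by (auto simp: relatively_projective_def)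
  then have V': "linear_rep K (G\<lparr>carrier := H\<rparr>) V" by (simp add: kG_module_iff)
  note I = linear_rep_induced_module[OF M.group_axioms H V']
  obtain i q where "i \<in> kG_hom K G M (induced_module G H V)" "q \<in> kG_hom K G (induced_module G H V) M"
    "\<And>v. v \<in> carrier M \<Longrightarrow> q (i v) = v"
    using iso_to_summand_retract[OF M I s] by metis
  then show ?thesis
    using set_projective_retract[OF M I] set_projective_induced_module[OF M.group_axioms fin H V']
    by metis
qed

lemma kG_module_restrict:
  assumes "kG_module K G M" "subgroup H G"
  shows "kG_module K (G\<lparr>carrier := H\<rparr>) M"
proof -
  interpret kG_module K G M by fact
  interpret H: subgroup H G by fact
  show ?thesis
    by (intro kG_module.intro kG_module_axioms.intro vectorspace_axioms fin_dim
        H.subgroup_is_group group_axioms) (auto simp: act_linear act_one act_mult)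
qed

text \<open>\<open>M\<close> is a retract of the module induced from its own restriction to
  \<open>H\<close>. The map \<open>i\<close> sends v to the sum of x \<otimes> x^-1 v over coset
  representatives x, and \<open>q\<close> applies \<open>s C\<close> to the component at
  \<open>C\<close> before adding up. Hence \<open>q (i v)\<close> is the sum of all
  \<open>s C v\<close>, which is v. The maps \<theta> and \<eta> only translate between
  \<open>M\<close> and its copy \<open>V\<close>.\<close>

lemma set_projective_imp_relatively_projective:
  fixes K :: "('k, 'a) ring_scheme" and G :: "('g, 'b) monoid_scheme"
    and M :: "('k, 'v, 'g) gmodule"
  assumes fin: "finite (carrier G)" and H: "subgroup H G" and M: "kG_module K G M"
    and p: "set_projective K G M (left_cosets G H) (l_coset G)"
  shows "relatively_projective K G H M"
proof -
  have rep: "linear_rep K G M" using M by (simp add: kG_module_iff)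
  interpret M: linear_rep K G M by fact
  interpret H: subgroup H G by fact
  have MH: "kG_module K (G\<lparr>carrier := H\<rparr>) M" by (rule kG_module_restrict[OF M H])
  obtain \<theta> :: "'v \<Rightarrow> nat \<Rightarrow> 'k" where \<theta>: "inj_on \<theta> (carrier M)"
    using kG_module_coordinates[OF M] by metis
  define V where "V = transport \<theta> M"
  note V = transport[OF MH \<theta>, folded V_def]
  have V': "linear_rep K (G\<lparr>carrier := H\<rparr>) V" using V(1) by (simp add: kG_module_iff)
  interpret V: linear_rep K "G\<lparr>carrier := H\<rparr>" V by fact
  define \<eta> where "\<eta> = inv_into (carrier M) \<theta>"
  have \<eta>: "\<eta> \<in> kG_hom K (G\<lparr>carrier := H\<rparr>) V M"
    unfolding \<eta>_def using kG_hom_inv[OF V(2,3)] MH by (simp add: kG_module_iff)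
  have \<eta>\<theta>: "\<eta> (\<theta> v) = v" if "v \<in> carrier M" for v using \<theta> that by (simp add: \<eta>_def)
  note \<theta>' = kG_hom_module_hom[OF V(2)] and \<eta>' = kG_hom_module_hom[OF \<eta>]
  note \<theta>c = module_hom_mem[OF \<theta>'] and \<eta>c = module_hom_mem[OF \<eta>']
  let ?I = "induced_module G H V" and ?C = "left_cosets G H"
  note I' = linear_rep_induced_module[OF M.group_axioms H V']
  interpret I: linear_rep K G ?I by (rule I')
  interpret C: gset G ?C "l_coset G" by (rule M.gset_left_cosets[OF H fin])
  obtain s where s: "\<And>C. C \<in> ?C \<Longrightarrow> s C \<in> module_hom K M M"
    "\<And>g C v. \<lbrakk>g \<in> carrier G; C \<in> ?C; v \<in> carrier M\<rbrakk>
      \<Longrightarrow> act M g (s C v) = s (g <#\<^bsub>G\<^esub> C) (act M g v)"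
    "\<And>v. v \<in> carrier M \<Longrightarrow> (\<Oplus>\<^bsub>M\<^esub>C\<in>?C. s C v) = v"
    using set_projectiveE[OF p] by metis
  note sc = module_hom_mem[OF s(1)]
  define i where "i v = (\<lambda>x\<in>carrier G. \<theta> (act M (inv\<^bsub>G\<^esub> x) v))" for v
  \<comment> \<open>The component of \<open>f\<close> at the coset xH, evaluated in \<open>M\<close>
    as x (f x). The equivariance of \<open>f\<close> makes this independent of the chosen
    representative.\<close>
  define F where "F f C = (let x = SOME x. x \<in> carrier G \<and> C = x <#\<^bsub>G\<^esub> H in act M x (\<eta> (f x)))" for f C
  have F: "F f (x <#\<^bsub>G\<^esub> H) = act M x (\<eta> (f x))" if x: "x \<in> carrier G" and f: "f \<in> carrier ?I" for f x
  proof -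
    define y where "y = (SOME y. y \<in> carrier G \<and> x <#\<^bsub>G\<^esub> H = y <#\<^bsub>G\<^esub> H)"
    have y: "y \<in> carrier G" "x <#\<^bsub>G\<^esub> H = y <#\<^bsub>G\<^esub> H"
      using someI[of "\<lambda>y. y \<in> carrier G \<and> x <#\<^bsub>G\<^esub> H = y <#\<^bsub>G\<^esub> H" x] x by (auto simp: y_def)
    define h where "h = inv\<^bsub>G\<^esub> x \<otimes>\<^bsub>G\<^esub> y"
    have h: "h \<in> H" "y = x \<otimes>\<^bsub>G\<^esub> h"
      using y x H by (simp_all add: h_def M.l_coset_eq_iff flip: M.m_assoc)
    have fx: "f x \<in> carrier V" using f x by auto
    have "act M y (\<eta> (f y)) = act M y (\<eta> (act V (inv\<^bsub>G\<^esub> h) (f x)))"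
      using f h x by auto
    also have "\<dots> = act M y (act M (inv\<^bsub>G\<^esub> h) (\<eta> (f x)))"
      using h fx by (simp add: kG_hom_act[OF \<eta>])
    also have "\<dots> = act M x (\<eta> (f x))"
      using h fx x \<eta>c by (simp add: M.act_mult)
    finally show ?thesis by (simp add: F_def y_def Let_def)
  qed
  have Cs: "\<exists>x\<in>carrier G. C = x <#\<^bsub>G\<^esub> H" if "C \<in> ?C" for C using that by (auto simp: left_cosets_def)
  have Fc: "F f C \<in> carrier M" if f: "f \<in> carrier ?I" and C: "C \<in> ?C" for f C
  proof -
    obtain x where x: "x \<in> carrier G" "C = x <#\<^bsub>G\<^esub> H" using Cs[OF C] by blast
    then have "f x \<in> carrier V" using f by auto
    then show ?thesis using x f \<eta>c by (simp only: F[OF x(1) f]) simp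
  qed
  have iI: "i v \<in> carrier ?I" if v: "v \<in> carrier M" for v
  proof -
    have "i v (x \<otimes>\<^bsub>G\<^esub> h) = act V (inv\<^bsub>G\<^esub> h) (i v x)" if "x \<in> carrier G" "h \<in> H" for x h
      using that v by (simp add: i_def M.inv_mult_group M.act_mult flip: kG_hom_act[OF V(2)])
    then show ?thesis using v \<theta>c by (auto simp: i_def)
  qed
  define q where "q f = (\<Oplus>\<^bsub>M\<^esub>C\<in>?C. s C (F f C))" for f
  have "i \<in> kG_hom K G M ?I"
  proof (intro kG_homI module_homI iI)
    fix g v assume "g \<in> carrier G" "v \<in> carrier M"
    then show "i (act M g v) = act ?I g (i v)"
      by (auto simp: i_def fun_eq_iff M.inv_mult_group M.act_mult)
  qed (auto simp: i_def fun_eq_iff M.act_add M.act_smult module_hom_add[OF \<theta>'] module_hom_smult[OF \<theta>'])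
  moreover have "q \<in> kG_hom K G ?I M"
  proof (intro kG_homI module_homI)
    show "q f \<in> carrier M" if "f \<in> carrier ?I" for f
      unfolding q_def using sc Fc that by (intro M.M.finsum_closed) auto
    show "q (f \<oplus>\<^bsub>?I\<^esub> f') = q f \<oplus>\<^bsub>M\<^esub> q f'" if f: "f \<in> carrier ?I" and f': "f' \<in> carrier ?I" for f f'
    proof -
      have "F (f \<oplus>\<^bsub>?I\<^esub> f') C = F f C \<oplus>\<^bsub>M\<^esub> F f' C" if C: "C \<in> ?C" for C
      proof -
        obtain x where x: "x \<in> carrier G" "C = x <#\<^bsub>G\<^esub> H" using Cs[OF C] by blast
        have "f x \<in> carrier V" "f' x \<in> carrier V" using f f' x by auto
        then have "act M x (\<eta> ((f \<oplus>\<^bsub>?I\<^esub> f') x)) = act M x (\<eta> (f x)) \<oplus>\<^bsub>M\<^esub> act M x (\<eta> (f' x))"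
          using x \<eta>c by (simp add: module_hom_add[OF \<eta>'] M.act_add)
        then show ?thesis
          unfolding x(2) F[OF x(1) f] F[OF x(1) f'] F[OF x(1) I.M.a_closed[OF f f']] .
      qed
      then have "q (f \<oplus>\<^bsub>?I\<^esub> f') = (\<Oplus>\<^bsub>M\<^esub>C\<in>?C. s C (F f C) \<oplus>\<^bsub>M\<^esub> s C (F f' C))"
        unfolding q_def using sc Fc[OF f] Fc[OF f'] module_hom_add[OF s(1)]
        by (intro M.M.finsum_cong') auto
      also have "\<dots> = q f \<oplus>\<^bsub>M\<^esub> q f'"
        unfolding q_def using sc Fc[OF f] Fc[OF f'] by (intro M.M.finsum_addf) auto
      finally show ?thesis .
    qed
    show "q (c \<odot>\<^bsub>?I\<^esub> f) = c \<odot>\<^bsub>M\<^esub> q f" if c: "c \<in> carrier K" and f: "f \<in> carrier ?I" for c f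
    proof -
      have "F (c \<odot>\<^bsub>?I\<^esub> f) C = c \<odot>\<^bsub>M\<^esub> F f C" if C: "C \<in> ?C" for C
      proof -
        obtain x where x: "x \<in> carrier G" "C = x <#\<^bsub>G\<^esub> H" using Cs[OF C] by blast
        have "f x \<in> carrier V" using f x by auto
        then have "act M x (\<eta> ((c \<odot>\<^bsub>?I\<^esub> f) x)) = c \<odot>\<^bsub>M\<^esub> act M x (\<eta> (f x))"
          using c x \<eta>c by (simp add: module_hom_smult[OF \<eta>'] M.act_smult)
        then show ?thesis
          unfolding x(2) F[OF x(1) f] F[OF x(1) I.smult_closed[OF c f]] .
      qed
      then have "q (c \<odot>\<^bsub>?I\<^esub> f) = (\<Oplus>\<^bsub>M\<^esub>C\<in>?C. c \<odot>\<^bsub>M\<^esub> s C (F f C))"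
        unfolding q_def using c sc Fc[OF f] module_hom_smult[OF s(1)]
        by (intro M.M.finsum_cong') auto
      also have "\<dots> = c \<odot>\<^bsub>M\<^esub> q f"
        unfolding q_def using c sc Fc[OF f] by (intro M.finsum_smult[symmetric]) auto
      finally show ?thesis .
    qed
    show "q (act ?I g f) = act M g (q f)" if g: "g \<in> carrier G" and f: "f \<in> carrier ?I" for g f
    proof -
      have eq: "F (act ?I g f) (g <#\<^bsub>G\<^esub> C) = act M g (F f C)" if C: "C \<in> ?C" for C
      proof -
        obtain x where x: "x \<in> carrier G" "C = x <#\<^bsub>G\<^esub> H" using Cs[OF C] by blast
        have gx: "g \<otimes>\<^bsub>G\<^esub> x \<in> carrier G" using g x by simp
        have "f x \<in> carrier V" using f x by auto
        then have "act M (g \<otimes>\<^bsub>G\<^esub> x) (\<eta> (act ?I g f (g \<otimes>\<^bsub>G\<^esub> x))) = act M g (act M x (\<eta> (f x)))"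
          using g x \<eta>c by (simp add: M.act_mult flip: M.m_assoc)
        moreover have "g <#\<^bsub>G\<^esub> (x <#\<^bsub>G\<^esub> H) = (g \<otimes>\<^bsub>G\<^esub> x) <#\<^bsub>G\<^esub> H"
          using g x H.subset by (simp add: M.lcos_m_assoc)
        ultimately show ?thesis
          unfolding x(2) F[OF x(1) f] using F[OF gx I.act_closed[OF g f]] by metis
      qed
      have "act M g (q f) = (\<Oplus>\<^bsub>M\<^esub>C\<in>?C. act M g (s C (F f C)))"
        unfolding q_def using sc Fc[OF f]
        by (intro module_hom_finsum[OF M.act_linear[OF g] M.module_axioms M.module_axioms]) auto
      also have "\<dots> = (\<Oplus>\<^bsub>M\<^esub>C\<in>?C. s (g <#\<^bsub>G\<^esub> C) (F (act ?I g f) (g <#\<^bsub>G\<^esub> C)))"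
        using g s(2) sc Fc[OF I.act_closed[OF g f]] Fc[OF f] C.closed[OF g] eq
        by (intro M.M.finsum_cong') (auto simp del: induced_module_simps)
      also have "\<dots> = q (act ?I g f)"
        unfolding q_def
        by (rule M.M.finsum_reindex_bij_witness[where i = "l_coset G (inv\<^bsub>G\<^esub> g)" and j = "l_coset G g"])
          (use g C.closed sc Fc[OF I.act_closed[OF g f]] in \<open>auto simp del: induced_module_simps\<close>)
      finally show ?thesis by simp
    qed
  qed
  moreover have "q (i v) = v" if v: "v \<in> carrier M" for v
  proof -
    have "F (i v) C = v" if C: "C \<in> ?C" for C
    proof -
      obtain x where x: "x \<in> carrier G" "C = x <#\<^bsub>G\<^esub> H" using Cs[OF C] by blast
      have "act M x (\<eta> (i v x)) = v" using x v by (simp add: i_def \<eta>\<theta>)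
      then show ?thesis unfolding x(2) F[OF x(1) iI[OF v]] .
    qed
    then have "q (i v) = (\<Oplus>\<^bsub>M\<^esub>C\<in>?C. s C v)"
      unfolding q_def using sc v by (intro M.M.finsum_cong') auto
    then show ?thesis using s(3)[OF v] by simp
  qed
  ultimately have "iso_to_summand K G M ?I"
    by (intro retract_imp_iso_to_summand[OF rep I']) auto
  then show ?thesis using V(1) by (auto simp: relatively_projective_def)
qed

section \<open>Endomorphisms of the augmentation kernel\<close>

lemma (in abelian_group) finsum_diff:
  "\<lbrakk>f \<in> A \<rightarrow> carrier G; h \<in> A \<rightarrow> carrier G\<rbrakk>
    \<Longrightarrow> (\<Oplus>a\<in>A. f a \<ominus> h a) = (\<Oplus>a\<in>A. f a) \<ominus> (\<Oplus>a\<in>A. h a)"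
proof -
  have z: "\<zero> \<ominus> \<zero> = \<zero>" by (simp add: minus_eq_zero_iff)
  show "\<lbrakk>f \<in> A \<rightarrow> carrier G; h \<in> A \<rightarrow> carrier G\<rbrakk>
    \<Longrightarrow> (\<Oplus>a\<in>A. f a \<ominus> h a) = (\<Oplus>a\<in>A. f a) \<ominus> (\<Oplus>a\<in>A. h a)"
  proof (induct A rule: infinite_finite_induct)
  case (insert a A)
  then show ?case by (simp add: Pi_iff a_minus_def minus_add a_ac)
  qed (simp_all add: z)
qed

lemma End_module_simps [simp]:
  "carrier (End_module K G M) = module_hom K M M \<inter> extensional (carrier M)"
  "zero (End_module K G M) = (\<lambda>v\<in>carrier M. \<zero>\<^bsub>M\<^esub>)"
  "add (End_module K G M) = (\<lambda>f f'. \<lambda>v\<in>carrier M. f v \<oplus>\<^bsub>M\<^esub> f' v)"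
  "smult (End_module K G M) = (\<lambda>c f. \<lambda>v\<in>carrier M. c \<odot>\<^bsub>M\<^esub> f v)"
  "act (End_module K G M) = (\<lambda>g f. \<lambda>v\<in>carrier M. act M g (f (act M (inv\<^bsub>G\<^esub> g) v)))"
  by (simp_all add: End_module_def)

lemma linear_rep_End_module:
  assumes M: "linear_rep K G M"
  shows "linear_rep K G (End_module K G M)"
proof -
  interpret M: linear_rep K G M by fact
  let ?a = "\<lambda>g f. \<lambda>v\<in>carrier M. act M g (f (act M (inv\<^bsub>G\<^esub> g) v))"
  let ?F = "with_action (fun_module (carrier M) M) ?a"
  let ?E = "module_hom K M M \<inter> extensional (carrier M)"
  have F: "linear_rep K G ?F"
    by (rule linear_rep_with_action[OF fun_module_is_module[OF M.module_axioms] M.field_axioms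
          M.group_axioms])
      (auto intro!: module_homI simp: fun_eq_iff M.act_add M.act_smult M.act_one M.act_mult
        M.inv_mult_group PiE_iff extensional_def)
  have "kG_submodule K G ?F ?E"
  proof (rule kG_submoduleI[OF F])
    show "?E \<subseteq> carrier ?F" by (auto simp: module_hom_mem extensional_def)
    show "\<zero>\<^bsub>?F\<^esub> \<in> ?E" by (auto intro!: module_homI)
    show "f \<oplus>\<^bsub>?F\<^esub> f' \<in> ?E" if "f \<in> ?E" "f' \<in> ?E" for f f'
      using that
      by (auto intro!: module_homI simp: module_hom_mem module_hom_add[of f] module_hom_add[of f']
          module_hom_smult[of f] module_hom_smult[of f'] M.M.a_ac M.smult_r_distr)
    show "c \<odot>\<^bsub>?F\<^esub> f \<in> ?E" if "c \<in> carrier K" "f \<in> ?E" for c f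
      using that
      by (auto intro!: module_homI simp: module_hom_mem module_hom_add[of f] module_hom_smult[of f]
          M.smult_r_distr M.R.m_comm simp flip: M.smult_assoc1)
    show "act ?F g f \<in> ?E" if "g \<in> carrier G" "f \<in> ?E" for g f
      using that
      by (auto intro!: module_homI simp: module_hom_mem module_hom_add[of f] module_hom_smult[of f]
          M.act_add M.act_smult)
  qed
  then show ?thesis
    using linear_rep_submodule[OF F] by (simp add: End_module_def with_action_carrier_update)
qed

lemma Delta_simps:
  assumes "field K"
  shows "carrier (Delta K G \<Omega> \<phi>) = {c \<in> \<Omega> \<rightarrow>\<^sub>E carrier K. (\<Oplus>\<^bsub>K\<^esub>x\<in>\<Omega>. c x) = \<zero>\<^bsub>K\<^esub>}"
    "zero (Delta K G \<Omega> \<phi>) = (\<lambda>y\<in>\<Omega>. \<zero>\<^bsub>K\<^esub>)"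
    "add (Delta K G \<Omega> \<phi>) = (\<lambda>f f'. \<lambda>y\<in>\<Omega>. f y \<oplus>\<^bsub>K\<^esub> f' y)"
    "smult (Delta K G \<Omega> \<phi>) = (\<lambda>c f. \<lambda>y\<in>\<Omega>. c \<otimes>\<^bsub>K\<^esub> f y)"
    "act (Delta K G \<Omega> \<phi>) = (\<lambda>g c. \<lambda>x\<in>\<Omega>. c (\<phi> (inv\<^bsub>G\<^esub> g) x))"
  using assms by (simp_all add: Delta_def augmentation_def)

text \<open>Of the absence of fixed points only the consequence that the number of points vanishes
  in \<open>K\<close> is recorded here; the prime and the Sylow subgroup enter later, as hypotheses
  of single lemmas.\<close>

locale augmentation_kernel = gset G \<Omega> \<phi> + K: field K
  for K :: "('k, 'a) ring_scheme" and G :: "('g, 'b) monoid_scheme" (structure)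
    and \<Omega> :: "'x set" and \<phi> :: "'g \<Rightarrow> 'x \<Rightarrow> 'x" +
  assumes nonempty: "\<Omega> \<noteq> {}"
    and card_eq_zero: "[card \<Omega>] \<cdot>\<^bsub>K\<^esub> \<one>\<^bsub>K\<^esub> = \<zero>\<^bsub>K\<^esub>"
begin

abbreviation D where "D \<equiv> Delta K G \<Omega> \<phi>"

declare K.field_axioms [simp]

lemma finsum_closed' [simp, intro]:
  "(\<And>x. x \<in> \<Omega> \<Longrightarrow> f x \<in> carrier K) \<Longrightarrow> (\<Oplus>\<^bsub>K\<^esub>x\<in>\<Omega>. f x) \<in> carrier K"
  by (intro K.finsum_closed) auto

lemma finsum_reindex_action:
  assumes g: "g \<in> carrier G" and f: "\<And>x. x \<in> \<Omega> \<Longrightarrow> f x \<in> carrier K"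
  shows "(\<Oplus>\<^bsub>K\<^esub>x\<in>\<Omega>. f (\<phi> g x)) = (\<Oplus>\<^bsub>K\<^esub>x\<in>\<Omega>. f x)"
  by (rule K.finsum_reindex_bij_witness[where i = "\<phi> (inv g)" and j = "\<phi> g"])
    (use g f closed in auto)

lemma finsum_point:
  "\<lbrakk>y \<in> \<Omega>; c \<in> carrier K\<rbrakk> \<Longrightarrow> (\<Oplus>\<^bsub>K\<^esub>x\<in>\<Omega>. if x = y then c else \<zero>\<^bsub>K\<^esub>) = c"
  using K.add.finprod_singleton_swap[of y \<Omega> "\<lambda>_. c"] finite_set by simp

text \<open>This is where \<open>card_eq_zero\<close> is applied. It yields both
  \<open>tau_id\<close> and \<open>proj_column_sum\<close>.\<close>

lemma finsum_const: "c \<in> carrier K \<Longrightarrow> (\<Oplus>\<^bsub>K\<^esub>x\<in>\<Omega>. c) = \<zero>\<^bsub>K\<^esub>"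
  using K.add_pow_ldistr[of "\<one>\<^bsub>K\<^esub>" c "card \<Omega>"] card_eq_zero by (simp add: K.add.finprod_const)

lemma linear_rep_Delta: "linear_rep K G D"
proof -
  note P = linear_rep_perm_module[OF K.field_axioms gset_axioms]
  let ?P = "perm_module K G \<Omega> \<phi>"
  let ?D = "{c \<in> carrier ?P. augmentation K \<Omega> c = \<zero>\<^bsub>K\<^esub>}"
  have val: "v x \<in> carrier K" if "v \<in> ?D" "x \<in> \<Omega>" for v x using that by auto
  have sum: "(\<Oplus>\<^bsub>K\<^esub>x\<in>\<Omega>. v x) = \<zero>\<^bsub>K\<^esub>" if "v \<in> ?D" for v
    using that by (simp add: augmentation_def)
  have DI: "w \<in> ?D" if "w \<in> carrier ?P" "\<And>x. x \<in> \<Omega> \<Longrightarrow> w x = u x" "(\<Oplus>\<^bsub>K\<^esub>x\<in>\<Omega>. u x) = \<zero>\<^bsub>K\<^esub>" for w u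
  proof -
    have "(\<Oplus>\<^bsub>K\<^esub>x\<in>\<Omega>. w x) = (\<Oplus>\<^bsub>K\<^esub>x\<in>\<Omega>. u x)"
      using that(1) by (intro K.finsum_cong') (auto simp flip: that(2))
    then show ?thesis using that(1,3) by (simp add: augmentation_def)
  qed
  interpret P: linear_rep K G ?P by (rule P)
  have "kG_submodule K G ?P ?D"
  proof (rule kG_submoduleI[OF P])
    show "act ?P g v \<in> ?D" if g: "g \<in> carrier G" and v: "v \<in> ?D" for g v
    proof (rule DI[of _ "\<lambda>x. v (\<phi> (inv g) x)"])
      show "(\<Oplus>\<^bsub>K\<^esub>x\<in>\<Omega>. v (\<phi> (inv g) x)) = \<zero>\<^bsub>K\<^esub>"
        using finsum_reindex_action[of "inv g" v] g val[OF v] sum[OF v] by simp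
      show "act ?P g v \<in> carrier ?P" using g v by (intro P.act_closed) auto
    qed simp
    show "c \<odot>\<^bsub>?P\<^esub> v \<in> ?D" if c: "c \<in> carrier K" and v: "v \<in> ?D" for c v
    proof (rule DI[of _ "\<lambda>x. c \<otimes>\<^bsub>K\<^esub> v x"])
      show "(\<Oplus>\<^bsub>K\<^esub>x\<in>\<Omega>. c \<otimes>\<^bsub>K\<^esub> v x) = \<zero>\<^bsub>K\<^esub>"
        using K.finsum_rdistr[OF finite_set c, of v] c val[OF v] sum[OF v] by (simp add: Pi_iff)
      show "c \<odot>\<^bsub>?P\<^esub> v \<in> carrier ?P" using c v by (intro P.smult_closed) auto
    qed simp
    show "v \<oplus>\<^bsub>?P\<^esub> w \<in> ?D" if v: "v \<in> ?D" and w: "w \<in> ?D" for v w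
    proof (rule DI[of _ "\<lambda>x. v x \<oplus>\<^bsub>K\<^esub> w x"])
      show "(\<Oplus>\<^bsub>K\<^esub>x\<in>\<Omega>. v x \<oplus>\<^bsub>K\<^esub> w x) = \<zero>\<^bsub>K\<^esub>"
        using K.finsum_addf[of v \<Omega> w] val[OF v] sum[OF v] val[OF w] sum[OF w] by (simp add: Pi_iff)
      show "v \<oplus>\<^bsub>?P\<^esub> w \<in> carrier ?P" using v w by (intro P.M.a_closed) auto
    qed simp
    show "\<zero>\<^bsub>?P\<^esub> \<in> ?D"
      by (rule DI[of _ "\<lambda>_. \<zero>\<^bsub>K\<^esub>"]) auto
  qed auto
  then show ?thesis using linear_rep_submodule[OF P] by (simp add: Delta_def)
qed

sublocale D: linear_rep K G D
  by (rule linear_rep_Delta)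

lemma DeltaI: "\<lbrakk>v \<in> \<Omega> \<rightarrow>\<^sub>E carrier K; (\<Oplus>\<^bsub>K\<^esub>x\<in>\<Omega>. v x) = \<zero>\<^bsub>K\<^esub>\<rbrakk> \<Longrightarrow> v \<in> carrier D"
  by (simp add: Delta_simps)

lemma Delta_extensional: "v \<in> carrier D \<Longrightarrow> v \<in> extensional \<Omega>"
  by (simp add: PiE_iff Delta_simps)

lemma Delta_value [simp, intro]: "\<lbrakk>v \<in> carrier D; x \<in> \<Omega>\<rbrakk> \<Longrightarrow> v x \<in> carrier K"
  by (auto simp: Delta_simps)

lemma Delta_sum: "v \<in> carrier D \<Longrightarrow> (\<Oplus>\<^bsub>K\<^esub>x\<in>\<Omega>. v x) = \<zero>\<^bsub>K\<^esub>"
  by (simp add: Delta_simps)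

lemma Delta_apply [simp]:
  assumes "x \<in> \<Omega>"
  shows "\<zero>\<^bsub>D\<^esub> x = \<zero>\<^bsub>K\<^esub>" "(u \<oplus>\<^bsub>D\<^esub> v) x = u x \<oplus>\<^bsub>K\<^esub> v x" "(c \<odot>\<^bsub>D\<^esub> v) x = c \<otimes>\<^bsub>K\<^esub> v x"
    "act D g v x = v (\<phi> (inv g) x)"
  using assms by (simp_all add: Delta_simps)

lemma Delta_eqI:
  "\<lbrakk>v \<in> carrier D; w \<in> carrier D; \<And>x. x \<in> \<Omega> \<Longrightarrow> v x = w x\<rbrakk> \<Longrightarrow> v = w"
  by (rule extensionalityI[OF Delta_extensional Delta_extensional])

lemma Delta_finsum:
  "\<lbrakk>x \<in> \<Omega>; f \<in> A \<rightarrow> carrier D\<rbrakk> \<Longrightarrow> (\<Oplus>\<^bsub>D\<^esub>a\<in>A. f a) x = (\<Oplus>\<^bsub>K\<^esub>a\<in>A. f a x)"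
  by (rule finsum_pointwise[OF D.M.abelian_monoid_axioms K.abelian_monoid_axioms]) auto

definition d :: "'x \<Rightarrow> 'x \<Rightarrow> 'x \<Rightarrow> 'k"
  where "d x y = (\<lambda>z\<in>\<Omega>. (if z = x then \<one>\<^bsub>K\<^esub> else \<zero>\<^bsub>K\<^esub>) \<ominus>\<^bsub>K\<^esub> (if z = y then \<one>\<^bsub>K\<^esub> else \<zero>\<^bsub>K\<^esub>))"

lemma d_apply:
  "z \<in> \<Omega> \<Longrightarrow> d x y z = (if z = x then \<one>\<^bsub>K\<^esub> else \<zero>\<^bsub>K\<^esub>) \<ominus>\<^bsub>K\<^esub> (if z = y then \<one>\<^bsub>K\<^esub> else \<zero>\<^bsub>K\<^esub>)"
  by (simp add: d_def)

lemma d_closed [simp, intro]: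
  assumes "x \<in> \<Omega>" "y \<in> \<Omega>"
  shows "d x y \<in> carrier D"
proof -
  have "(\<Oplus>\<^bsub>K\<^esub>z\<in>\<Omega>. d x y z) = (\<Oplus>\<^bsub>K\<^esub>z\<in>\<Omega>. (if z = x then \<one>\<^bsub>K\<^esub> else \<zero>\<^bsub>K\<^esub>) \<ominus>\<^bsub>K\<^esub> (if z = y then \<one>\<^bsub>K\<^esub> else \<zero>\<^bsub>K\<^esub>))"
    by (intro K.finsum_cong') (auto simp: d_def)
  also have "\<dots> = \<zero>\<^bsub>K\<^esub>"
    using assms by (subst K.finsum_diff) (auto simp: finsum_point K.minus_eq_zero_iff)
  finally have "(\<Oplus>\<^bsub>K\<^esub>z\<in>\<Omega>. d x y z) = \<zero>\<^bsub>K\<^esub>" .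
  moreover have "d x y \<in> \<Omega> \<rightarrow>\<^sub>E carrier K" by (auto simp: d_def)
  ultimately show ?thesis by (intro DeltaI)
qed

lemma d_split:
  assumes "x \<in> \<Omega>" "y \<in> \<Omega>" "z \<in> \<Omega>"
  shows "d x z = d x y \<oplus>\<^bsub>D\<^esub> d y z"
proof -
  have "a \<ominus>\<^bsub>K\<^esub> c = (a \<ominus>\<^bsub>K\<^esub> b) \<oplus>\<^bsub>K\<^esub> (b \<ominus>\<^bsub>K\<^esub> c)"
    if "a \<in> carrier K" "b \<in> carrier K" "c \<in> carrier K" for a b c
    using that by (simp add: a_minus_def K.a_assoc K.r_neg2 K.r_neg1)
  then show ?thesis
    using assms by (intro Delta_eqI D.M.a_closed d_closed) (auto simp: d_apply)
qed

lemma d_self: "x \<in> \<Omega> \<Longrightarrow> d x x = \<zero>\<^bsub>D\<^esub>"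
  by (rule Delta_eqI) (auto simp: d_apply K.minus_eq_zero_iff)

lemma d_act:
  assumes "g \<in> carrier G" "x \<in> \<Omega>" "y \<in> \<Omega>"
  shows "act D g (d x y) = d (\<phi> g x) (\<phi> g y)"
proof -
  have "\<phi> (inv g) z = x \<longleftrightarrow> z = \<phi> g x" if "z \<in> \<Omega>" "x \<in> \<Omega>" for z x
    using that assms(1) by auto
  then show ?thesis
    using assms closed by (intro Delta_eqI D.act_closed d_closed) (auto simp: d_apply)
qed

text \<open>The multiples of the base point \<open>x\<close> add up to the coefficient sum of
  \<open>v\<close> times \<open>x\<close>, which is zero. The base point is arbitrary, so it may
  later vary with the matrix row.\<close>

lemma d_expansion:
  assumes v: "v \<in> carrier D" and x: "x \<in> \<Omega>"
  shows "v = (\<Oplus>\<^bsub>D\<^esub>y\<in>\<Omega>. v y \<odot>\<^bsub>D\<^esub> d y x)"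
proof (rule Delta_eqI[OF v])
  have cl: "v y \<odot>\<^bsub>D\<^esub> d y x \<in> carrier D" if "y \<in> \<Omega>" for y
    using that v x by (intro D.smult_closed) auto
  then show "(\<Oplus>\<^bsub>D\<^esub>y\<in>\<Omega>. v y \<odot>\<^bsub>D\<^esub> d y x) \<in> carrier D" by (intro D.M.finsum_closed) blast
  fix z assume z: "z \<in> \<Omega>"
  let ?c = "if z = x then \<one>\<^bsub>K\<^esub> else \<zero>\<^bsub>K\<^esub>"
  have "(\<Oplus>\<^bsub>D\<^esub>y\<in>\<Omega>. v y \<odot>\<^bsub>D\<^esub> d y x) z = (\<Oplus>\<^bsub>K\<^esub>y\<in>\<Omega>. (v y \<odot>\<^bsub>D\<^esub> d y x) z)"
    using z cl by (intro Delta_finsum) blast+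
  also have "\<dots> = (\<Oplus>\<^bsub>K\<^esub>y\<in>\<Omega>. (if y = z then v z else \<zero>\<^bsub>K\<^esub>) \<ominus>\<^bsub>K\<^esub> v y \<otimes>\<^bsub>K\<^esub> ?c)"
    using v z
    by (intro K.finsum_cong') (auto simp: d_apply a_minus_def K.r_distr K.r_minus)
  also have "\<dots> = v z \<ominus>\<^bsub>K\<^esub> (\<Oplus>\<^bsub>K\<^esub>y\<in>\<Omega>. v y \<otimes>\<^bsub>K\<^esub> ?c)"
    using v z by (subst K.finsum_diff) (auto simp: finsum_point)
  also have "(\<Oplus>\<^bsub>K\<^esub>y\<in>\<Omega>. v y \<otimes>\<^bsub>K\<^esub> ?c) = (\<Oplus>\<^bsub>K\<^esub>y\<in>\<Omega>. v y) \<otimes>\<^bsub>K\<^esub> ?c"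
    using v finite_set by (intro K.finsum_ldistr[symmetric]) auto
  also have "v z \<ominus>\<^bsub>K\<^esub> \<dots> = v z"
    using v z Delta_sum[OF v] by (simp add: a_minus_def)
  finally show "v z = (\<Oplus>\<^bsub>D\<^esub>y\<in>\<Omega>. v y \<odot>\<^bsub>D\<^esub> d y x) z" by simp
qed

lemma kG_module_Delta: "kG_module K G D"
proof -
  obtain x where x: "x \<in> \<Omega>" using nonempty by blast
  show ?thesis
  proof (rule kG_module_spanned[OF linear_rep_Delta finite_set])
    show "d y x \<in> carrier D" if "y \<in> \<Omega>" for y using that x by blast
    show "\<exists>c\<in>\<Omega> \<rightarrow> carrier K. v = (\<Oplus>\<^bsub>D\<^esub>y\<in>\<Omega>. c y \<odot>\<^bsub>D\<^esub> d y x)" if "v \<in> carrier D" for v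
      using that by (intro bexI[of _ v] d_expansion x) auto
  qed
qed

text \<open>
  \<open>m f\<close> is the unique matrix with zero diagonal that represents \<open>f\<close>; since \<open>f\<close> is only defined on the
  augmentation kernel, the rows of a representing matrix are determined up to additive constants.
  The column sums of \<open>m f\<close> agree (\<open>tau_eq\<close>), and their common value \<open>tau f\<close> is minus the trace of \<open>f\<close>.
\<close>

definition m :: "(('x \<Rightarrow> 'k) \<Rightarrow> 'x \<Rightarrow> 'k) \<Rightarrow> 'x \<Rightarrow> 'x \<Rightarrow> 'k"
  where "m f x y = f (d y x) x"

definition tau :: "(('x \<Rightarrow> 'k) \<Rightarrow> 'x \<Rightarrow> 'k) \<Rightarrow> 'k"
  where "tau f = (\<Oplus>\<^bsub>K\<^esub>x\<in>\<Omega>. m f x (SOME y. y \<in> \<Omega>))"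

lemma m_closed [simp, intro]:
  assumes "f \<in> module_hom K D D" "x \<in> \<Omega>" "y \<in> \<Omega>"
  shows "m f x y \<in> carrier K"
  unfolding m_def by (rule Delta_value[OF module_hom_mem[OF assms(1) d_closed[OF assms(3,2)]] assms(2)])

lemma m_self: "\<lbrakk>f \<in> module_hom K D D; x \<in> \<Omega>\<rbrakk> \<Longrightarrow> m f x x = \<zero>\<^bsub>K\<^esub>"
  unfolding m_def d_self using module_hom_zero[of f K D D] D.module_axioms by simp

text \<open>To compute the coefficient at \<open>x\<close>, the vector is expanded with that same
  \<open>x\<close> as base point. This choice is what gives the matrix its zero diagonal.\<close>

lemma apply_eq_m:
  assumes f: "f \<in> module_hom K D D" and v: "v \<in> carrier D" and x: "x \<in> \<Omega>"
  shows "f v x = (\<Oplus>\<^bsub>K\<^esub>y\<in>\<Omega>. v y \<otimes>\<^bsub>K\<^esub> m f x y)"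
proof -
  have cl: "v y \<odot>\<^bsub>D\<^esub> d y x \<in> carrier D" "v y \<odot>\<^bsub>D\<^esub> f (d y x) \<in> carrier D" if "y \<in> \<Omega>" for y
    using that v x module_hom_mem[OF f] by (auto intro!: D.smult_closed)
  have "f v = f (\<Oplus>\<^bsub>D\<^esub>y\<in>\<Omega>. v y \<odot>\<^bsub>D\<^esub> d y x)" using d_expansion[OF v x] by (rule arg_cong)
  also have "\<dots> = (\<Oplus>\<^bsub>D\<^esub>y\<in>\<Omega>. f (v y \<odot>\<^bsub>D\<^esub> d y x))"
    using cl by (intro module_hom_finsum[OF f D.module_axioms D.module_axioms]) blast
  also have "\<dots> = (\<Oplus>\<^bsub>D\<^esub>y\<in>\<Omega>. v y \<odot>\<^bsub>D\<^esub> f (d y x))"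
    using cl v x by (intro D.M.finsum_cong') (auto simp: module_hom_smult[OF f])
  finally have "f v x = (\<Oplus>\<^bsub>D\<^esub>y\<in>\<Omega>. v y \<odot>\<^bsub>D\<^esub> f (d y x)) x" by simp
  also have "\<dots> = (\<Oplus>\<^bsub>K\<^esub>y\<in>\<Omega>. (v y \<odot>\<^bsub>D\<^esub> f (d y x)) x)"
    using x cl by (intro Delta_finsum) blast+
  also have "\<dots> = (\<Oplus>\<^bsub>K\<^esub>y\<in>\<Omega>. v y \<otimes>\<^bsub>K\<^esub> m f x y)"
    using v x m_closed[OF f] by (intro K.finsum_cong') (auto simp: m_def)
  finally show ?thesis .
qed

text \<open>Since y - x = (y - z) + (z - x), the columns at \<open>y\<close> and at \<open>z\<close>
  differ by the coefficients of \<open>f (d y z)\<close>, a vector of the augmentation kernel, whose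
  coefficients sum to zero.\<close>

lemma tau_eq:
  assumes f: "f \<in> module_hom K D D" and y: "y \<in> \<Omega>"
  shows "(\<Oplus>\<^bsub>K\<^esub>x\<in>\<Omega>. m f x y) = tau f"
proof -
  define z where "z = (SOME y. y \<in> \<Omega>)"
  have z: "z \<in> \<Omega>" unfolding z_def using y by (rule someI)
  have fd: "f (d y z) \<in> carrier D" by (rule module_hom_mem[OF f d_closed[OF y z]])
  have "m f x y = f (d y z) x \<oplus>\<^bsub>K\<^esub> m f x z" if "x \<in> \<Omega>" for x
    using that y z d_split[OF y z that] by (simp add: m_def module_hom_add[OF f d_closed d_closed])
  then have "(\<Oplus>\<^bsub>K\<^esub>x\<in>\<Omega>. m f x y) = (\<Oplus>\<^bsub>K\<^esub>x\<in>\<Omega>. f (d y z) x \<oplus>\<^bsub>K\<^esub> m f x z)"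
    using f fd z by (intro K.finsum_cong') auto
  also have "\<dots> = (\<Oplus>\<^bsub>K\<^esub>x\<in>\<Omega>. f (d y z) x) \<oplus>\<^bsub>K\<^esub> (\<Oplus>\<^bsub>K\<^esub>x\<in>\<Omega>. m f x z)"
    using f fd z by (intro K.finsum_addf) auto
  also have "\<dots> = tau f"
    using f z Delta_sum[OF fd] by (simp add: tau_def flip: z_def)
  finally show ?thesis .
qed

lemma some_mem: "(SOME y. y \<in> \<Omega>) \<in> \<Omega>"
  using nonempty by (simp add: some_in_eq)

lemma m_cong: "\<lbrakk>\<And>v. v \<in> carrier D \<Longrightarrow> f v = f' v; x \<in> \<Omega>; y \<in> \<Omega>\<rbrakk> \<Longrightarrow> m f x y = m f' x y"
  using d_closed by (simp add: m_def)

lemma tau_cong: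
  assumes "f' \<in> module_hom K D D" "\<And>v. v \<in> carrier D \<Longrightarrow> f v = f' v"
  shows "tau f = tau f'"
  unfolding tau_def using assms some_mem m_cong[of f f'] by (intro K.finsum_cong') auto

lemma tau_closed [simp, intro]: "f \<in> module_hom K D D \<Longrightarrow> tau f \<in> carrier K"
  unfolding tau_def using some_mem by blast

text \<open>The matrix of the identity is 0 on the diagonal and -1 elsewhere, so a column sums to 1
  minus the number of points, which is 1 in \<open>K\<close>.\<close>

lemma tau_id: "tau (\<lambda>v. v) = \<one>\<^bsub>K\<^esub>"
proof -
  let ?y = "SOME y. y \<in> \<Omega>"
  have "tau (\<lambda>v. v) = (\<Oplus>\<^bsub>K\<^esub>x\<in>\<Omega>. (if x = ?y then \<one>\<^bsub>K\<^esub> else \<zero>\<^bsub>K\<^esub>) \<ominus>\<^bsub>K\<^esub> \<one>\<^bsub>K\<^esub>)"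
    unfolding tau_def m_def by (intro K.finsum_cong') (auto simp: d_apply)
  also have "\<dots> = \<one>\<^bsub>K\<^esub>"
    using some_mem by (subst K.finsum_diff) (auto simp: finsum_point finsum_const a_minus_def)
  finally show ?thesis .
qed

lemma tau_add:
  assumes "f \<in> module_hom K D D" "f' \<in> module_hom K D D"
  shows "tau (\<lambda>v. f v \<oplus>\<^bsub>D\<^esub> f' v) = tau f \<oplus>\<^bsub>K\<^esub> tau f'"
proof -
  have "tau (\<lambda>v. f v \<oplus>\<^bsub>D\<^esub> f' v) = (\<Oplus>\<^bsub>K\<^esub>x\<in>\<Omega>. m f x (SOME y. y \<in> \<Omega>) \<oplus>\<^bsub>K\<^esub> m f' x (SOME y. y \<in> \<Omega>))"
    unfolding tau_def using assms some_mem m_closed by (intro K.finsum_cong') (auto simp: m_def)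
  then show ?thesis unfolding tau_def using assms some_mem by (simp add: Pi_iff)
qed

lemma tau_smult:
  assumes "c \<in> carrier K" "f \<in> module_hom K D D"
  shows "tau (\<lambda>v. c \<odot>\<^bsub>D\<^esub> f v) = c \<otimes>\<^bsub>K\<^esub> tau f"
proof -
  have "tau (\<lambda>v. c \<odot>\<^bsub>D\<^esub> f v) = (\<Oplus>\<^bsub>K\<^esub>x\<in>\<Omega>. c \<otimes>\<^bsub>K\<^esub> m f x (SOME y. y \<in> \<Omega>))"
    unfolding tau_def using assms some_mem m_closed by (intro K.finsum_cong') (auto simp: m_def)
  also have "\<dots> = c \<otimes>\<^bsub>K\<^esub> tau f"
    unfolding tau_def using assms some_mem finite_set by (intro K.finsum_rdistr[symmetric]) auto
  finally show ?thesis .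
qed

lemma tau_finsum:
  assumes A: "finite A" and f: "\<And>a. a \<in> A \<Longrightarrow> f a \<in> module_hom K D D"
  shows "tau (\<lambda>v. \<Oplus>\<^bsub>D\<^esub>a\<in>A. f a v) = (\<Oplus>\<^bsub>K\<^esub>a\<in>A. tau (f a))"
proof -
  let ?y = "SOME y. y \<in> \<Omega>"
  have cl: "f a (d ?y x) \<in> carrier D" if "a \<in> A" "x \<in> \<Omega>" for a x
    using module_hom_mem[OF f] that some_mem by blast
  have "tau (\<lambda>v. \<Oplus>\<^bsub>D\<^esub>a\<in>A. f a v) = (\<Oplus>\<^bsub>K\<^esub>x\<in>\<Omega>. \<Oplus>\<^bsub>K\<^esub>a\<in>A. m (f a) x ?y)"
    unfolding tau_def
  proof (intro K.finsum_cong')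
    show "m (\<lambda>v. \<Oplus>\<^bsub>D\<^esub>a\<in>A. f a v) x ?y = (\<Oplus>\<^bsub>K\<^esub>a\<in>A. m (f a) x ?y)" if "x \<in> \<Omega>" for x
      unfolding m_def using that cl by (intro Delta_finsum) blast+
  qed (use f some_mem in \<open>auto intro!: K.finsum_closed\<close>)
  also have "\<dots> = (\<Oplus>\<^bsub>K\<^esub>a\<in>A. tau (f a))"
    unfolding tau_def using A f some_mem finite_set by (intro K.finsum_finsum_swap) auto
  finally show ?thesis .
qed

text \<open>The hypothesis says that \<open>f'\<close> is the conjugate of \<open>f\<close> by
  \<open>g\<close>, in a form met both by the action on endomorphisms and by the members of a family
  as in \<open>set_projective\<close>.\<close>

lemma m_conj:
  assumes f: "f \<in> module_hom K D D" and g: "g \<in> carrier G"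
    and f': "\<And>v. v \<in> carrier D \<Longrightarrow> act D g (f v) = f' (act D g v)" and x: "x \<in> \<Omega>" and y: "y \<in> \<Omega>"
  shows "m f' (\<phi> g x) (\<phi> g y) = m f x y"
proof -
  have "m f' (\<phi> g x) (\<phi> g y) = f' (act D g (d y x)) (\<phi> g x)"
    by (simp only: m_def d_act[OF g y x])
  also have "\<dots> = act D g (f (d y x)) (\<phi> g x)" by (simp only: f'[OF d_closed[OF y x]])
  also have "\<dots> = m f x y" using g x closed by (simp add: m_def)
  finally show ?thesis .
qed

text \<open>Conjugation permutes rows and columns of the matrix simultaneously. The sum moves to
  another column, which by \<open>tau_eq\<close> has the same value.\<close>

lemma tau_conj:
  assumes f: "f \<in> module_hom K D D" and g: "g \<in> carrier G" and f'': "f' \<in> module_hom K D D"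
    and f': "\<And>v. v \<in> carrier D \<Longrightarrow> act D g (f v) = f' (act D g v)"
  shows "tau f' = tau f"
proof -
  let ?y = "SOME y. y \<in> \<Omega>"
  have "tau f' = (\<Oplus>\<^bsub>K\<^esub>x\<in>\<Omega>. m f' x (\<phi> g ?y))"
    using tau_eq[OF f'', of "\<phi> g ?y"] closed[OF g some_mem] by simp
  also have "\<dots> = (\<Oplus>\<^bsub>K\<^esub>x\<in>\<Omega>. m f' (\<phi> g x) (\<phi> g ?y))"
    using f'' closed[OF g some_mem] by (intro finsum_reindex_action[OF g, symmetric]) auto
  also have "\<dots> = tau f"
    unfolding tau_def using f some_mem m_conj[OF f g f'] by (intro K.finsum_cong') auto
  finally show ?thesis .
qed

end

text \<open>An injective homomorphism reflects the equations for linearity and equivariance, so they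
  may be checked after composing with \<open>i\<close>.\<close>

lemma kG_hom_lift:
  assumes W: "linear_rep K G W" and P: "linear_rep K G P" and Q: "linear_rep K G Q"
    and i: "i \<in> kG_hom K G W P" and inj: "inj_on i (carrier W)"
    and q: "\<And>v. v \<in> carrier Q \<Longrightarrow> q v \<in> carrier W" and iq: "(\<lambda>v. i (q v)) \<in> kG_hom K G Q P"
  shows "q \<in> kG_hom K G Q W"
proof -
  interpret W: linear_rep K G W by fact
  interpret Q: linear_rep K G Q by fact
  note i' = kG_hom_module_hom[OF i] and iq' = kG_hom_module_hom[OF iq]
  show ?thesis
  proof (intro kG_homI module_homI q)
    fix v w assume v: "v \<in> carrier Q" and w: "w \<in> carrier Q"
    show "q (v \<oplus>\<^bsub>Q\<^esub> w) = q v \<oplus>\<^bsub>W\<^esub> q w"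
      using v w module_hom_add[OF iq' v w]
      by (intro inj_onD[OF inj]) (auto simp: q module_hom_add[OF i'])
  next
    fix c v assume c: "c \<in> carrier K" and v: "v \<in> carrier Q"
    show "q (c \<odot>\<^bsub>Q\<^esub> v) = c \<odot>\<^bsub>W\<^esub> q v"
      using c v module_hom_smult[OF iq' c v]
      by (intro inj_onD[OF inj]) (auto simp: q module_hom_smult[OF i'])
  next
    fix g v assume g: "g \<in> carrier G" and v: "v \<in> carrier Q"
    show "q (act Q g v) = act W g (q v)"
      using g v kG_hom_act[OF iq g v]
      by (intro inj_onD[OF inj]) (auto simp: q kG_hom_act[OF i])
  qed
qed

lemma kG_hom_perm_module_pullback:
  assumes K: "field K" and Y: "gset G Y \<psi>" and Z: "gset G Z \<chi>"
    and h: "\<And>y. y \<in> Y \<Longrightarrow> h y \<in> Z"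
    and h_act: "\<And>g y. \<lbrakk>g \<in> carrier G; y \<in> Y\<rbrakk> \<Longrightarrow> h (\<psi> g y) = \<chi> g (h y)"
  shows "(\<lambda>c. \<lambda>y\<in>Y. c (h y)) \<in> kG_hom K G (perm_module K G Z \<chi>) (perm_module K G Y \<psi>)"
proof -
  interpret Y: gset G Y \<psi> by fact
  show ?thesis
    using h h_act by (intro kG_homI module_homI) (auto simp: K Y.closed fun_eq_iff)
qed

text \<open>\<open>p_permutation\<close> asks for a G-set of natural numbers, so the points of
  \<open>Z\<close> are numbered and the action is carried over. It is restricted to \<open>Y\<close>
  because a \<open>group_action\<close> consists of extensional maps.\<close>

lemma perm_module_nat_retract:
  fixes K :: "('k, 'a) ring_scheme" and G :: "('g, 'b) monoid_scheme" and Z :: "'z set"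
  assumes K: "field K" and Z: "gset G Z \<chi>" and "Z \<noteq> {}"
  obtains Y :: "nat set" and \<psi> i q where "finite Y" "Y \<noteq> {}" "group_action G Y \<psi>"
    "i \<in> kG_hom K G (perm_module K G Z \<chi>) (perm_module K G Y \<psi>)"
    "q \<in> kG_hom K G (perm_module K G Y \<psi>) (perm_module K G Z \<chi>)"
    "\<And>c. c \<in> carrier (perm_module K G Z \<chi>) \<Longrightarrow> q (i c) = c"
proof -
  interpret Z: gset G Z \<chi> by fact
  obtain h where h: "bij_betw h {..<card Z} Z"
    using ex_bij_betw_nat_finite[OF Z.finite_set] atLeast0LessThan by metis
  define Y where "Y = {..<card Z}"
  define h' where "h' = inv_into Y h"
  have hh': "h (h' z) = z" "h' z \<in> Y" if "z \<in> Z" for z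
    using h that inv_into_into[of z h Y] by (auto simp: h'_def Y_def bij_betw_def f_inv_into_f)
  have h'h: "h' (h y) = y" "h y \<in> Z" if "y \<in> Y" for y
    using h that by (auto simp: h'_def Y_def bij_betw_inv_into_left bij_betwE)
  define \<psi>0 where "\<psi>0 g y = h' (\<chi> g (h y))" for g y
  have Y0: "gset G Y \<psi>0"
  proof unfold_locales
    show "finite Y" by (simp add: Y_def)
  qed (auto simp: \<psi>0_def hh' h'h Z.closed Z.one_act Z.mult_act)
  define \<psi> where "\<psi> = (\<lambda>g. \<lambda>y\<in>Y. \<psi>0 g y)"
  have act: "group_action G Y \<psi>" unfolding \<psi>_def by (rule gset.group_action[OF Y0])
  have finY: "finite Y" by (simp add: Y_def)
  note Y = group_action_gset[OF act finY]
  show ?thesis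
  proof (rule that[OF finY _ act])
    show "Y \<noteq> {}" using \<open>Z \<noteq> {}\<close> hh' by blast
    show "(\<lambda>c. \<lambda>y\<in>Y. c (h y)) \<in> kG_hom K G (perm_module K G Z \<chi>) (perm_module K G Y \<psi>)"
      by (rule kG_hom_perm_module_pullback[OF K Y Z])
        (auto simp: \<psi>_def \<psi>0_def hh' h'h Z.closed)
    show "(\<lambda>c. \<lambda>z\<in>Z. c (h' z)) \<in> kG_hom K G (perm_module K G Y \<psi>) (perm_module K G Z \<chi>)"
      by (rule kG_hom_perm_module_pullback[OF K Z Y])
        (auto simp: \<psi>_def \<psi>0_def hh' h'h Z.closed)
    show "(\<lambda>z\<in>Z. (\<lambda>y\<in>Y. c (h y)) (h' z)) = c" if "c \<in> carrier (perm_module K G Z \<chi>)" for c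
      using that by (auto simp: K fun_eq_iff hh' PiE_iff extensional_def)
  qed
qed

lemma gmodule_sum_simps [simp]:
  "carrier (gmodule_sum M N) = carrier M \<times> carrier N"
  "add (gmodule_sum M N) = (\<lambda>v w. (fst v \<oplus>\<^bsub>M\<^esub> fst w, snd v \<oplus>\<^bsub>N\<^esub> snd w))"
  "smult (gmodule_sum M N) = (\<lambda>c v. (c \<odot>\<^bsub>M\<^esub> fst v, c \<odot>\<^bsub>N\<^esub> snd v))"
  "act (gmodule_sum M N) = (\<lambda>g (v, w). (act M g v, act N g w))"
  by (simp_all add: gmodule_sum_def direct_sum_def module.defs)

section \<open>The trace-zero endomorphisms as a direct summand of the matrices over pairs of
  points\<close>

context augmentation_kernel
begin

abbreviation E where "E \<equiv> End_module K G D"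

text \<open>The endomorphisms of trace zero. They are kept inside \<open>E\<close>, which gives them
  the type that \<open>Dade_module\<close> prescribes for the complement of the trivial
  part.\<close>

definition W where "W = E\<lparr>carrier := {f \<in> carrier E. tau f = \<zero>\<^bsub>K\<^esub>}\<rparr>"

abbreviation sq :: "'g \<Rightarrow> 'x \<times> 'x \<Rightarrow> 'x \<times> 'x"
  where "sq \<equiv> \<lambda>g (x, y). (\<phi> g x, \<phi> g y)"

abbreviation P2 where "P2 \<equiv> perm_module K G (\<Omega> \<times> \<Omega>) sq"

sublocale E: linear_rep K G E
  by (rule linear_rep_End_module[OF linear_rep_Delta])

lemma gset_sq: "gset G (\<Omega> \<times> \<Omega>) sq"
  by (rule gset_times[OF gset_axioms gset_axioms])

sublocale P2: linear_rep K G P2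
  by (rule linear_rep_perm_module[OF K.field_axioms gset_sq])

lemma E_hom: "f \<in> carrier E \<Longrightarrow> f \<in> module_hom K D D"
  by simp

lemma E_apply [simp]:
  assumes "v \<in> carrier D"
  shows "(f \<oplus>\<^bsub>E\<^esub> f') v = f v \<oplus>\<^bsub>D\<^esub> f' v" "(c \<odot>\<^bsub>E\<^esub> f) v = c \<odot>\<^bsub>D\<^esub> f v" "\<zero>\<^bsub>E\<^esub> v = \<zero>\<^bsub>D\<^esub>"
    "act E g f v = act D g (f (act D (inv g) v))"
  using assms by simp_all

lemma tau_E:
  assumes f: "f \<in> carrier E"
  shows "f' \<in> carrier E \<Longrightarrow> tau (f \<oplus>\<^bsub>E\<^esub> f') = tau f \<oplus>\<^bsub>K\<^esub> tau f'"
    and "c \<in> carrier K \<Longrightarrow> tau (c \<odot>\<^bsub>E\<^esub> f) = c \<otimes>\<^bsub>K\<^esub> tau f"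
    and "g \<in> carrier G \<Longrightarrow> tau (act E g f) = tau f"
proof -
  show "tau (f \<oplus>\<^bsub>E\<^esub> f') = tau f \<oplus>\<^bsub>K\<^esub> tau f'" if f': "f' \<in> carrier E"
    unfolding tau_add[OF E_hom[OF f] E_hom[OF f'], symmetric]
    by (rule tau_cong[symmetric, OF E_hom[OF E.M.a_closed[OF f f']]]) (simp only: E_apply)
  show "tau (c \<odot>\<^bsub>E\<^esub> f) = c \<otimes>\<^bsub>K\<^esub> tau f" if c: "c \<in> carrier K"
    unfolding tau_smult[OF c E_hom[OF f], symmetric]
    by (rule tau_cong[symmetric, OF E_hom[OF E.smult_closed[OF c f]]]) (simp only: E_apply)
  show "tau (act E g f) = tau f" if g: "g \<in> carrier G"
    by (rule tau_conj[OF E_hom[OF f] g E_hom[OF E.act_closed[OF g f]]])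
      (use g module_hom_mem[OF E_hom[OF f]] in \<open>simp add: E_apply del: End_module_simps\<close>)
qed

lemma kG_submodule_W: "kG_submodule K G E {f \<in> carrier E. tau f = \<zero>\<^bsub>K\<^esub>}"
proof (rule kG_submoduleI[OF E.linear_rep_axioms])
  have "tau \<zero>\<^bsub>E\<^esub> = tau (\<zero>\<^bsub>K\<^esub> \<odot>\<^bsub>E\<^esub> \<zero>\<^bsub>E\<^esub>)" by (simp only: E.smult_r_null K.zero_closed)
  also have "\<dots> = \<zero>\<^bsub>K\<^esub>"
    using tau_closed[OF E_hom[OF E.M.zero_closed]]
    by (simp only: tau_E(2)[OF E.M.zero_closed K.zero_closed] K.l_null)
  finally show "\<zero>\<^bsub>E\<^esub> \<in> {f \<in> carrier E. tau f = \<zero>\<^bsub>K\<^esub>}" using E.M.zero_closed by blast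
qed (auto simp: tau_E simp del: End_module_simps)

lemma linear_rep_W: "linear_rep K G W"
  unfolding W_def by (rule linear_rep_submodule[OF E.linear_rep_axioms kG_submodule_W])

sublocale W: linear_rep K G W
  by (rule linear_rep_W)

lemma W_simps:
  "carrier W = {f \<in> carrier E. tau f = \<zero>\<^bsub>K\<^esub>}" "add W = add E" "zero W = zero E" "smult W = smult E"
  "act W = act E"
  by (simp_all add: W_def)

lemma W_hom: "f \<in> carrier W \<Longrightarrow> f \<in> module_hom K D D"
  by (simp add: W_simps)

definition mat :: "(('x \<Rightarrow> 'k) \<Rightarrow> 'x \<Rightarrow> 'k) \<Rightarrow> 'x \<times> 'x \<Rightarrow> 'k"
  where "mat f = (\<lambda>(x, y)\<in>\<Omega> \<times> \<Omega>. m f x y)"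

lemma mat_closed: "f \<in> module_hom K D D \<Longrightarrow> mat f \<in> carrier P2"
  by (auto simp: mat_def)

lemma P2_eqI:
  "\<lbrakk>A \<in> carrier P2; B \<in> carrier P2; \<And>x y. \<lbrakk>x \<in> \<Omega>; y \<in> \<Omega>\<rbrakk> \<Longrightarrow> A (x, y) = B (x, y)\<rbrakk> \<Longrightarrow> A = B"
  by (rule extensionalityI[of _ "\<Omega> \<times> \<Omega>"]) (auto simp: PiE_iff)

text \<open>By \<open>apply_eq_m\<close> the matrix entries determine every value of the
  endomorphism.\<close>

lemma mat_inj:
  assumes f: "f \<in> carrier E" and f': "f' \<in> carrier E" and eq: "mat f = mat f'"
  shows "f = f'"
proof (rule extensionalityI[of _ "carrier D"])
  fix v assume v: "v \<in> carrier D"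
  have eq: "m f x y = m f' x y" if "x \<in> \<Omega>" "y \<in> \<Omega>" for x y
    using fun_cong[OF eq, of "(x, y)"] that by (simp add: mat_def)
  note hom = E_hom[OF f] E_hom[OF f']
  show "f v = f' v"
  proof (rule Delta_eqI[OF module_hom_mem[OF hom(1) v] module_hom_mem[OF hom(2) v]])
    fix x assume x: "x \<in> \<Omega>"
    show "f v x = f' v x"
      unfolding apply_eq_m[OF hom(1) v x] apply_eq_m[OF hom(2) v x]
      using v x hom by (intro K.finsum_cong') (auto simp: eq)
  qed
qed (use f f' in auto)

lemma mat_kG_hom: "mat \<in> kG_hom K G W P2"
proof (intro kG_homI module_homI)
  show "mat f \<in> carrier P2" if "f \<in> carrier W" for f by (rule mat_closed[OF W_hom[OF that]])
  show "mat (f \<oplus>\<^bsub>W\<^esub> f') = mat f \<oplus>\<^bsub>P2\<^esub> mat f'" for f f'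
    by (auto simp: mat_def m_def W_simps fun_eq_iff simp del: End_module_simps)
  show "mat (c \<odot>\<^bsub>W\<^esub> f) = c \<odot>\<^bsub>P2\<^esub> mat f" for c f
    by (auto simp: mat_def m_def W_simps fun_eq_iff simp del: End_module_simps)
  show "mat (act W g f) = act P2 g (mat f)" if g: "g \<in> carrier G" and f: "f \<in> carrier W" for g f
  proof (rule P2_eqI[OF mat_closed[OF W_hom[OF W.act_closed[OF g f]]]
        P2.act_closed[OF g mat_closed[OF W_hom[OF f]]]])
    fix x y assume x: "x \<in> \<Omega>" and y: "y \<in> \<Omega>"
    have x': "\<phi> (inv g) x \<in> \<Omega>" and y': "\<phi> (inv g) y \<in> \<Omega>" using g x y closed by auto
    have "m (act W g f) (\<phi> g (\<phi> (inv g) x)) (\<phi> g (\<phi> (inv g) y)) = m f (\<phi> (inv g) x) (\<phi> (inv g) y)"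
      by (rule m_conj[OF W_hom[OF f] g _ x' y'])
        (use g module_hom_mem[OF W_hom[OF f]] in \<open>simp add: W_simps E_apply del: End_module_simps\<close>)
    then show "mat (act W g f) (x, y) = act P2 g (mat f) (x, y)"
      using g x y x' y' by (simp add: mat_def)
  qed
qed

definition sig :: "('x \<times> 'x \<Rightarrow> 'k) \<Rightarrow> 'x \<Rightarrow> 'k"
  where "sig A y = (\<Oplus>\<^bsub>K\<^esub>x\<in>\<Omega>. if x = y then \<zero>\<^bsub>K\<^esub> else A (x, y))"

text \<open>
  Since \<open>card \<Omega> - 1 = -1\<close> in \<open>K\<close>, adding its sum to every off-diagonal entry of a column makes the
  column sum vanish.
\<close>

definition proj :: "('x \<times> 'x \<Rightarrow> 'k) \<Rightarrow> 'x \<times> 'x \<Rightarrow> 'k"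
  where "proj A = (\<lambda>(x, y)\<in>\<Omega> \<times> \<Omega>. if x = y then \<zero>\<^bsub>K\<^esub> else A (x, y) \<oplus>\<^bsub>K\<^esub> sig A y)"

lemma P2_value [intro]: "\<lbrakk>A \<in> carrier P2; x \<in> \<Omega>; y \<in> \<Omega>\<rbrakk> \<Longrightarrow> A (x, y) \<in> carrier K"
  by auto

lemma sig_closed: "\<lbrakk>A \<in> carrier P2; y \<in> \<Omega>\<rbrakk> \<Longrightarrow> sig A y \<in> carrier K"
  unfolding sig_def using P2_value[of A] by auto

lemma proj_closed: "A \<in> carrier P2 \<Longrightarrow> proj A \<in> carrier P2"
  using P2_value[of A] sig_closed[of A] by (auto simp: proj_def)

lemma P2_apply [simp]:
  assumes "x \<in> \<Omega>" "y \<in> \<Omega>"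
  shows "(A \<oplus>\<^bsub>P2\<^esub> B) (x, y) = A (x, y) \<oplus>\<^bsub>K\<^esub> B (x, y)" "(c \<odot>\<^bsub>P2\<^esub> A) (x, y) = c \<otimes>\<^bsub>K\<^esub> A (x, y)"
    "act P2 g A (x, y) = A (\<phi> (inv g) x, \<phi> (inv g) y)"
    "proj A (x, y) = (if x = y then \<zero>\<^bsub>K\<^esub> else A (x, y) \<oplus>\<^bsub>K\<^esub> sig A y)"
  using assms by (simp_all add: proj_def)

lemma proj_column_sum:
  assumes A: "A \<in> carrier P2" and y: "y \<in> \<Omega>"
  shows "(\<Oplus>\<^bsub>K\<^esub>x\<in>\<Omega>. proj A (x, y)) = \<zero>\<^bsub>K\<^esub>"
proof -
  note Av = P2_value[OF A] and s = sig_closed[OF A y]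
  \<comment> \<open>The summand added off the diagonal is written as a constant minus its value on
    the diagonal. The constant part sums to zero and the diagonal part leaves
    \<open>-sig A y\<close>, which cancels the old column sum.\<close>
  have "(\<Oplus>\<^bsub>K\<^esub>x\<in>\<Omega>. proj A (x, y)) = (\<Oplus>\<^bsub>K\<^esub>x\<in>\<Omega>. (if x = y then \<zero>\<^bsub>K\<^esub> else A (x, y))
      \<oplus>\<^bsub>K\<^esub> (sig A y \<ominus>\<^bsub>K\<^esub> (if x = y then sig A y else \<zero>\<^bsub>K\<^esub>)))"
    using Av s y by (intro K.finsum_cong') (auto simp: a_minus_def K.r_neg)
  also have "\<dots> = sig A y \<oplus>\<^bsub>K\<^esub> (\<Oplus>\<^bsub>K\<^esub>x\<in>\<Omega>. sig A y \<ominus>\<^bsub>K\<^esub> (if x = y then sig A y else \<zero>\<^bsub>K\<^esub>))"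
    unfolding sig_def[of A y, symmetric]
    using Av s y by (subst K.finsum_addf) (auto simp: sig_def[symmetric])
  also have "(\<Oplus>\<^bsub>K\<^esub>x\<in>\<Omega>. sig A y \<ominus>\<^bsub>K\<^esub> (if x = y then sig A y else \<zero>\<^bsub>K\<^esub>)) = \<zero>\<^bsub>K\<^esub> \<ominus>\<^bsub>K\<^esub> sig A y"
    using s y by (subst K.finsum_diff) (auto simp: finsum_const finsum_point)
  also have "sig A y \<oplus>\<^bsub>K\<^esub> (\<zero>\<^bsub>K\<^esub> \<ominus>\<^bsub>K\<^esub> sig A y) = \<zero>\<^bsub>K\<^esub>"
    using s by (simp add: a_minus_def K.r_neg)
  finally show ?thesis .
qed

lemma proj_kG_hom: "proj \<in> kG_hom K G P2 P2"
proof (intro kG_homI module_homI proj_closed)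
  fix A B assume A: "A \<in> carrier P2" and B: "B \<in> carrier P2"
  note v = P2_value[OF A] P2_value[OF B] sig_closed[OF A] sig_closed[OF B]
  have s: "sig (A \<oplus>\<^bsub>P2\<^esub> B) y = sig A y \<oplus>\<^bsub>K\<^esub> sig B y" if "y \<in> \<Omega>" for y
  proof -
    have "sig (A \<oplus>\<^bsub>P2\<^esub> B) y = (\<Oplus>\<^bsub>K\<^esub>x\<in>\<Omega>. (if x = y then \<zero>\<^bsub>K\<^esub> else A (x, y)) \<oplus>\<^bsub>K\<^esub> (if x = y then \<zero>\<^bsub>K\<^esub> else B (x, y)))"
      unfolding sig_def using that v(1,2)
      by (intro K.finsum_cong') (auto simp del: perm_module_simps)
    also have "\<dots> = sig A y \<oplus>\<^bsub>K\<^esub> sig B y"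
      unfolding sig_def using that v(1,2) by (intro K.finsum_addf) auto
    finally show ?thesis .
  qed
  show "proj (A \<oplus>\<^bsub>P2\<^esub> B) = proj A \<oplus>\<^bsub>P2\<^esub> proj B"
    by (rule P2_eqI[OF proj_closed[OF P2.M.a_closed[OF A B]] P2.M.a_closed[OF proj_closed[OF A] proj_closed[OF B]]])
      (use v s in \<open>auto simp: K.a_ac simp del: perm_module_simps\<close>)
next
  fix c A assume c: "c \<in> carrier K" and A: "A \<in> carrier P2"
  note v = P2_value[OF A] sig_closed[OF A]
  have s: "sig (c \<odot>\<^bsub>P2\<^esub> A) y = c \<otimes>\<^bsub>K\<^esub> sig A y" if "y \<in> \<Omega>" for y
  proof -
    have "sig (c \<odot>\<^bsub>P2\<^esub> A) y = (\<Oplus>\<^bsub>K\<^esub>x\<in>\<Omega>. c \<otimes>\<^bsub>K\<^esub> (if x = y then \<zero>\<^bsub>K\<^esub> else A (x, y)))"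
      unfolding sig_def using that c v(1)
      by (intro K.finsum_cong') (auto simp del: perm_module_simps)
    also have "\<dots> = c \<otimes>\<^bsub>K\<^esub> sig A y"
      unfolding sig_def using that c v(1) finite_set by (intro K.finsum_rdistr[symmetric]) auto
    finally show ?thesis .
  qed
  show "proj (c \<odot>\<^bsub>P2\<^esub> A) = c \<odot>\<^bsub>P2\<^esub> proj A"
    by (rule P2_eqI[OF proj_closed[OF P2.smult_closed[OF c A]] P2.smult_closed[OF c proj_closed[OF A]]])
      (use c v s in \<open>auto simp: K.r_distr simp del: perm_module_simps\<close>)
next
  fix g A assume g: "g \<in> carrier G" and A: "A \<in> carrier P2"
  note v = P2_value[OF A] sig_closed[OF A]
  have cl: "\<phi> (inv g) x \<in> \<Omega>" if "x \<in> \<Omega>" for x using g that closed by auto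
  have eq: "\<phi> (inv g) x = \<phi> (inv g) y \<longleftrightarrow> x = y" if "x \<in> \<Omega>" "y \<in> \<Omega>" for x y
    using that g by (metis act_inv(1))
  have s: "sig (act P2 g A) y = sig A (\<phi> (inv g) y)" if y: "y \<in> \<Omega>" for y
  proof -
    have "sig (act P2 g A) y = (\<Oplus>\<^bsub>K\<^esub>x\<in>\<Omega>. (\<lambda>x. if x = \<phi> (inv g) y then \<zero>\<^bsub>K\<^esub> else A (x, \<phi> (inv g) y)) (\<phi> (inv g) x))"
      unfolding sig_def using y v(1) cl
      by (intro K.finsum_cong') (auto simp: eq simp del: perm_module_simps)
    also have "\<dots> = sig A (\<phi> (inv g) y)"
      unfolding sig_def using v(1) cl[OF y] g
      by (intro finsum_reindex_action) auto
    finally show ?thesis .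
  qed
  show "proj (act P2 g A) = act P2 g (proj A)"
    by (rule P2_eqI[OF proj_closed[OF P2.act_closed[OF g A]] P2.act_closed[OF g proj_closed[OF A]]])
      (use v s cl eq in \<open>auto simp del: perm_module_simps\<close>)
qed

definition mul :: "('x \<times> 'x \<Rightarrow> 'k) \<Rightarrow> ('x \<Rightarrow> 'k) \<Rightarrow> 'x \<Rightarrow> 'k"
  where "mul A = (\<lambda>v\<in>carrier D. \<lambda>x\<in>\<Omega>. \<Oplus>\<^bsub>K\<^esub>y\<in>\<Omega>. A (x, y) \<otimes>\<^bsub>K\<^esub> v y)"

lemma mul_apply: "\<lbrakk>v \<in> carrier D; x \<in> \<Omega>\<rbrakk> \<Longrightarrow> mul A v x = (\<Oplus>\<^bsub>K\<^esub>y\<in>\<Omega>. A (x, y) \<otimes>\<^bsub>K\<^esub> v y)"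
  by (simp add: mul_def)

text \<open>Zero column sums make the image of every vector lie in the augmentation kernel. There,
  adding a constant to a row of \<open>A\<close> changes nothing, and \<open>m\<close> picks the
  representative with zero diagonal by subtracting the diagonal entry from its row.\<close>

lemma
  assumes A: "A \<in> carrier P2" and sum: "\<And>y. y \<in> \<Omega> \<Longrightarrow> (\<Oplus>\<^bsub>K\<^esub>x\<in>\<Omega>. A (x, y)) = \<zero>\<^bsub>K\<^esub>"
  shows mul_hom: "mul A \<in> module_hom K D D"
    and m_mul: "\<lbrakk>x \<in> \<Omega>; y \<in> \<Omega>\<rbrakk> \<Longrightarrow> m (mul A) x y = A (x, y) \<ominus>\<^bsub>K\<^esub> A (x, x)"
proof -
  note Av = P2_value[OF A]
  have mul_D: "mul A v \<in> carrier D" if v: "v \<in> carrier D" for v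
  proof (rule DeltaI)
    show "mul A v \<in> \<Omega> \<rightarrow>\<^sub>E carrier K" using v Av by (auto simp: mul_def)
    have "(\<Oplus>\<^bsub>K\<^esub>x\<in>\<Omega>. mul A v x) = (\<Oplus>\<^bsub>K\<^esub>x\<in>\<Omega>. \<Oplus>\<^bsub>K\<^esub>y\<in>\<Omega>. A (x, y) \<otimes>\<^bsub>K\<^esub> v y)"
      using v Av by (intro K.finsum_cong') (auto simp: mul_apply)
    also have "\<dots> = (\<Oplus>\<^bsub>K\<^esub>y\<in>\<Omega>. \<Oplus>\<^bsub>K\<^esub>x\<in>\<Omega>. A (x, y) \<otimes>\<^bsub>K\<^esub> v y)"
      using v Av finite_set by (intro K.finsum_finsum_swap) auto
    also have "\<dots> = (\<Oplus>\<^bsub>K\<^esub>y\<in>\<Omega>. (\<Oplus>\<^bsub>K\<^esub>x\<in>\<Omega>. A (x, y)) \<otimes>\<^bsub>K\<^esub> v y)"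
      using v Av finite_set by (intro K.finsum_cong' K.finsum_ldistr[symmetric]) auto
    also have "\<dots> = (\<Oplus>\<^bsub>K\<^esub>y\<in>\<Omega>. \<zero>\<^bsub>K\<^esub>)"
      using v by (intro K.finsum_cong') (auto simp: sum)
    finally show "(\<Oplus>\<^bsub>K\<^esub>x\<in>\<Omega>. mul A v x) = \<zero>\<^bsub>K\<^esub>" by simp
  qed
  show "mul A \<in> module_hom K D D"
  proof (intro module_homI mul_D)
    fix v w assume v: "v \<in> carrier D" and w: "w \<in> carrier D"
    show "mul A (v \<oplus>\<^bsub>D\<^esub> w) = mul A v \<oplus>\<^bsub>D\<^esub> mul A w"
    proof (rule Delta_eqI[OF mul_D[OF D.M.a_closed[OF v w]] D.M.a_closed[OF mul_D[OF v] mul_D[OF w]]])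
      fix x assume x: "x \<in> \<Omega>"
      have "mul A (v \<oplus>\<^bsub>D\<^esub> w) x = (\<Oplus>\<^bsub>K\<^esub>y\<in>\<Omega>. A (x, y) \<otimes>\<^bsub>K\<^esub> v y \<oplus>\<^bsub>K\<^esub> A (x, y) \<otimes>\<^bsub>K\<^esub> w y)"
        unfolding mul_apply[OF D.M.a_closed[OF v w] x] using v w x Av
        by (intro K.finsum_cong') (auto simp: K.r_distr)
      also have "\<dots> = mul A v x \<oplus>\<^bsub>K\<^esub> mul A w x"
        unfolding mul_apply[OF v x] mul_apply[OF w x] using v w x Av by (intro K.finsum_addf) auto
      finally show "mul A (v \<oplus>\<^bsub>D\<^esub> w) x = (mul A v \<oplus>\<^bsub>D\<^esub> mul A w) x" using x by simp
    qed
  next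
    fix c v assume c: "c \<in> carrier K" and v: "v \<in> carrier D"
    show "mul A (c \<odot>\<^bsub>D\<^esub> v) = c \<odot>\<^bsub>D\<^esub> mul A v"
    proof (rule Delta_eqI[OF mul_D[OF D.smult_closed[OF c v]] D.smult_closed[OF c mul_D[OF v]]])
      fix x assume x: "x \<in> \<Omega>"
      have "mul A (c \<odot>\<^bsub>D\<^esub> v) x = (\<Oplus>\<^bsub>K\<^esub>y\<in>\<Omega>. c \<otimes>\<^bsub>K\<^esub> (A (x, y) \<otimes>\<^bsub>K\<^esub> v y))"
        unfolding mul_apply[OF D.smult_closed[OF c v] x] using v c x Av
        by (intro K.finsum_cong') (auto simp: K.m_lcomm)
      also have "\<dots> = c \<otimes>\<^bsub>K\<^esub> mul A v x"
        unfolding mul_apply[OF v x] using v c x Av finite_set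
        by (intro K.finsum_rdistr[symmetric]) auto
      finally show "mul A (c \<odot>\<^bsub>D\<^esub> v) x = (c \<odot>\<^bsub>D\<^esub> mul A v) x" using x by simp
    qed
  qed
  show "m (mul A) x y = A (x, y) \<ominus>\<^bsub>K\<^esub> A (x, x)" if x: "x \<in> \<Omega>" and y: "y \<in> \<Omega>"
  proof -
    have "m (mul A) x y = (\<Oplus>\<^bsub>K\<^esub>z\<in>\<Omega>. A (x, z) \<otimes>\<^bsub>K\<^esub> d y x z)"
      using x y by (simp add: m_def mul_apply)
    also have "\<dots> = (\<Oplus>\<^bsub>K\<^esub>z\<in>\<Omega>. (if z = y then A (x, y) else \<zero>\<^bsub>K\<^esub>) \<ominus>\<^bsub>K\<^esub> (if z = x then A (x, x) else \<zero>\<^bsub>K\<^esub>))"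
      using x y Av by (intro K.finsum_cong') (auto simp: d_apply a_minus_def K.r_distr K.r_minus)
    also have "\<dots> = A (x, y) \<ominus>\<^bsub>K\<^esub> A (x, x)"
      using x y Av by (subst K.finsum_diff) (auto simp: finsum_point)
    finally show ?thesis .
  qed
qed

text \<open>\<open>proj A\<close> already has zero diagonal, so it is the matrix \<open>m\<close> of
  the endomorphism it defines; its zero column sums are the vanishing of \<open>tau\<close>.\<close>

lemma
  assumes A: "A \<in> carrier P2"
  shows mul_proj_W: "mul (proj A) \<in> carrier W" and mat_mul_proj: "mat (mul (proj A)) = proj A"
proof -
  have hom: "mul (proj A) \<in> module_hom K D D"
    by (rule mul_hom[OF proj_closed[OF A]]) (rule proj_column_sum[OF A])
  have m: "m (mul (proj A)) x y = proj A (x, y) \<ominus>\<^bsub>K\<^esub> proj A (x, x)" if "x \<in> \<Omega>" "y \<in> \<Omega>" for x y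
    by (rule m_mul[OF proj_closed[OF A] _ that]) (rule proj_column_sum[OF A])
  have m: "m (mul (proj A)) x y = proj A (x, y)" if "x \<in> \<Omega>" "y \<in> \<Omega>" for x y
    using m[OF that] that P2_value[OF proj_closed[OF A] that] by (simp add: a_minus_def)
  obtain y where y: "y \<in> \<Omega>" using nonempty by blast
  have "tau (mul (proj A)) = (\<Oplus>\<^bsub>K\<^esub>x\<in>\<Omega>. proj A (x, y))"
    unfolding tau_eq[OF hom y, symmetric]
    using y P2_value[OF proj_closed[OF A]] m by (intro K.finsum_cong') auto
  then show "mul (proj A) \<in> carrier W"
    using hom proj_column_sum[OF A y] by (simp add: W_simps) (simp add: mul_def)
  show "mat (mul (proj A)) = proj A"
    by (rule P2_eqI[OF mat_closed[OF hom] proj_closed[OF A]]) (simp add: mat_def m del: P2_apply)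
qed

lemma W_E: "f \<in> carrier W \<Longrightarrow> f \<in> carrier E"
  by (simp add: W_simps)

lemma inj_mat: "inj_on mat (carrier W)"
  by (rule inj_onI) (rule mat_inj[OF W_E W_E])

text \<open>After composition with the injective \<open>mat\<close> the map becomes
  \<open>proj\<close>, which is known to be linear and equivariant.\<close>

lemma mul_proj_kG_hom: "(\<lambda>A. mul (proj A)) \<in> kG_hom K G P2 W"
proof (rule kG_hom_lift[OF linear_rep_W P2.linear_rep_axioms P2.linear_rep_axioms mat_kG_hom inj_mat])
  show "(\<lambda>A. mat (mul (proj A))) \<in> kG_hom K G P2 P2"
  proof (intro kG_homI)
    show "(\<lambda>A. mat (mul (proj A))) \<in> module_hom K P2 P2"
      by (rule module_hom_cong[OF kG_hom_module_hom[OF proj_kG_hom] P2.module_axioms])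
        (simp only: mat_mul_proj)
    show "mat (mul (proj (act P2 g A))) = act P2 g (mat (mul (proj A)))"
      if "g \<in> carrier G" "A \<in> carrier P2" for g A
      unfolding mat_mul_proj[OF that(2)] mat_mul_proj[OF P2.act_closed[OF that]]
      by (rule kG_hom_act[OF proj_kG_hom that])
  qed
qed (rule mul_proj_W)

text \<open>For \<open>f\<close> in \<open>W\<close> the columns of \<open>mat f\<close> already sum
  to zero, so \<open>proj\<close> has nothing to correct. With this, \<open>mat\<close> and
  \<open>mul (proj A)\<close> exhibit \<open>W\<close> as a retract of \<open>P2\<close>.\<close>

lemma mul_proj_mat:
  assumes f: "f \<in> carrier W"
  shows "mul (proj (mat f)) = f"
proof -
  note hom = W_hom[OF f] and mat = mat_closed[OF W_hom[OF f]]
  have "sig (mat f) y = \<zero>\<^bsub>K\<^esub>" if y: "y \<in> \<Omega>" for y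
  proof -
    have "sig (mat f) y = (\<Oplus>\<^bsub>K\<^esub>x\<in>\<Omega>. m f x y)"
      unfolding sig_def using y hom
      by (intro K.finsum_cong') (auto simp: mat_def m_self)
    then show ?thesis using tau_eq[OF hom y] f by (simp add: W_simps)
  qed
  then have "proj (mat f) = mat f"
    using hom by (intro P2_eqI proj_closed mat) (auto simp: mat_def m_self)
  then show ?thesis
    using inj_onD[OF inj_mat _ mul_proj_W[OF mat] f] mat_mul_proj[OF mat] by simp
qed

lemma kG_module_W: "kG_module K G W"
proof (rule fin_dim_surjective_image[OF kG_module_perm_module[OF K.field_axioms gset_sq] linear_rep_W
      kG_hom_module_hom[OF mul_proj_kG_hom]])
  have "f \<in> (\<lambda>A. mul (proj A)) ` carrier P2" if "f \<in> carrier W" for f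
    by (rule image_eqI[where x = "mat f"]) (simp_all only: mul_proj_mat[OF that] mat_closed[OF W_hom[OF that]])
  then show "(\<lambda>A. mul (proj A)) ` carrier P2 = carrier W" using mul_proj_W by blast
qed

lemma p_permutation_W: "p_permutation K G W"
proof -
  have ne: "\<Omega> \<times> \<Omega> \<noteq> {}" using nonempty by simp
  obtain Y :: "nat set" and \<psi> i q where Y: "finite Y" "Y \<noteq> {}" "group_action G Y \<psi>"
    and i: "i \<in> kG_hom K G P2 (perm_module K G Y \<psi>)" and q: "q \<in> kG_hom K G (perm_module K G Y \<psi>) P2"
    and qi: "\<And>c. c \<in> carrier P2 \<Longrightarrow> q (i c) = c"
    by (rule perm_module_nat_retract[OF K.field_axioms gset_sq ne]) (rule that; assumption)
  have qi': "mul (proj (q (i (mat f)))) = f" if "f \<in> carrier W" for f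
    by (simp only: qi[OF mat_closed[OF W_hom[OF that]]] mul_proj_mat[OF that])
  have "iso_to_summand K G W (perm_module K G Y \<psi>)"
    by (rule retract_imp_iso_to_summand[OF linear_rep_W
          linear_rep_perm_module[OF K.field_axioms group_action_gset[OF Y(3,1)]]
          kG_hom_comp[OF mat_kG_hom i] kG_hom_comp[OF q mul_proj_kG_hom]]) (rule qi')
  then show ?thesis using Y kG_module_W unfolding p_permutation_def by blast
qed

lemma set_projective_W: "set_projective K G W (\<Omega> \<times> \<Omega>) sq"
  by (rule set_projective_retract[OF linear_rep_W P2.linear_rep_axioms mat_kG_hom mul_proj_kG_hom
        mul_proj_mat set_projective_perm_module[OF K.field_axioms gset_sq]])

lemma trivial_module_simps [simp]:
  "carrier (trivial_module K n) = {..<n} \<rightarrow>\<^sub>E carrier K"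
  "add (trivial_module K n) = (\<lambda>f f'. \<lambda>i\<in>{..<n}. f i \<oplus>\<^bsub>K\<^esub> f' i)"
  "smult (trivial_module K n) = (\<lambda>c f. \<lambda>i\<in>{..<n}. c \<otimes>\<^bsub>K\<^esub> f i)"
  "act (trivial_module K n) = (\<lambda>g c. c)"
  by (simp_all add: trivial_module_def K.func_space_def)

definition one where "one = (\<lambda>v\<in>carrier D. v)"

lemma one_E: "one \<in> carrier E"
  by (auto simp: one_def intro!: module_homI)

lemma tau_one: "tau one = \<one>\<^bsub>K\<^esub>"
proof -
  have "tau one = tau (\<lambda>v. v)"
    by (rule tau_cong) (auto simp: one_def intro!: module_homI)
  then show ?thesis by (simp add: tau_id)
qed

lemma act_one_E: "g \<in> carrier G \<Longrightarrow> act E g one = one"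
  by (auto simp: one_def fun_eq_iff)

text \<open>The identity is fixed by \<open>G\<close> and has \<open>tau\<close> equal to 1, so it
  spans a trivial complement of the kernel \<open>W\<close> of the invariant functional
  \<open>tau\<close>. The number of trivial summands is therefore 1.\<close>

lemma End_module_iso: "kG_iso K G E (gmodule_sum (trivial_module K 1) W)"
proof -
  define F where "F f = ((\<lambda>i\<in>{..<1::nat}. tau f), f \<ominus>\<^bsub>E\<^esub> (tau f \<odot>\<^bsub>E\<^esub> one))" for f
  \<comment> \<open>Subtraction is rewritten as adding a multiple by -1, so that the linearity rules
    for \<open>tau\<close> and for the action apply to it.\<close>
  have mo: "f \<ominus>\<^bsub>E\<^esub> h = f \<oplus>\<^bsub>E\<^esub> (\<ominus>\<^bsub>K\<^esub> \<one>\<^bsub>K\<^esub>) \<odot>\<^bsub>E\<^esub> h" if "h \<in> carrier E" for f h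
    using that by (simp add: a_minus_def E.smult_minus_1 del: End_module_simps)
  have t: "tau f \<in> carrier K" if "f \<in> carrier E" for f by (rule tau_closed[OF E_hom[OF that]])
  have FW: "f \<ominus>\<^bsub>E\<^esub> (tau f \<odot>\<^bsub>E\<^esub> one) \<in> carrier W" if f: "f \<in> carrier E" for f
  proof -
    have "f \<ominus>\<^bsub>E\<^esub> (tau f \<odot>\<^bsub>E\<^esub> one) \<in> carrier E" using f t[OF f] one_E by (intro E.M.minus_closed E.smult_closed)
    moreover have "tau (f \<ominus>\<^bsub>E\<^esub> (tau f \<odot>\<^bsub>E\<^esub> one)) = \<zero>\<^bsub>K\<^esub>"
      using f t[OF f] one_E
      by (simp add: mo tau_E tau_one K.l_minus K.r_neg E.smult_closed del: End_module_simps)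
    ultimately show ?thesis unfolding W_simps by blast
  qed
  have hom: "F \<in> kG_hom K G E (gmodule_sum (trivial_module K 1) W)"
  proof (intro kG_homI module_homI)
    show "F f \<in> carrier (gmodule_sum (trivial_module K 1) W)" if "f \<in> carrier E" for f
      using FW[OF that] t[OF that] by (simp add: F_def del: End_module_simps)
    show "F (f \<oplus>\<^bsub>E\<^esub> h) = F f \<oplus>\<^bsub>gmodule_sum (trivial_module K 1) W\<^esub> F h"
      if "f \<in> carrier E" "h \<in> carrier E" for f h
      using that t one_E
      by (simp add: F_def tau_E W_simps fun_eq_iff a_minus_def E.smult_l_distr E.M.minus_add E.M.a_ac
          E.smult_closed del: End_module_simps)
    show "F (c \<odot>\<^bsub>E\<^esub> f) = c \<odot>\<^bsub>gmodule_sum (trivial_module K 1) W\<^esub> F f"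
      if "c \<in> carrier K" "f \<in> carrier E" for c f
      using that t one_E
      by (simp add: F_def tau_E W_simps fun_eq_iff mo E.smult_r_distr K.m_ac
          E.smult_closed del: End_module_simps flip: E.smult_assoc1)
    show "F (act E g f) = act (gmodule_sum (trivial_module K 1) W) g (F f)"
      if "g \<in> carrier G" "f \<in> carrier E" for g f
      using that t one_E
      by (simp add: F_def tau_E W_simps mo E.act_add E.act_smult act_one_E
          E.smult_closed del: End_module_simps)
  qed
  have split: "f = (f \<ominus>\<^bsub>E\<^esub> (tau f \<odot>\<^bsub>E\<^esub> one)) \<oplus>\<^bsub>E\<^esub> (tau f \<odot>\<^bsub>E\<^esub> one)" if "f \<in> carrier E" for f
    using that t one_E
    by (simp add: a_minus_def E.M.a_assoc E.M.l_neg E.smult_closed del: End_module_simps)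
  have "inj_on F (carrier E)"
  proof (rule inj_onI)
    fix f h assume f: "f \<in> carrier E" and h: "h \<in> carrier E" and eq: "F f = F h"
    have "fst (F f) 0 = fst (F h) 0" by (simp only: eq)
    then have "tau f = tau h" by (simp add: F_def)
    then show "f = h" using split[OF f] split[OF h] eq by (simp add: F_def del: End_module_simps)
  qed
  moreover have "cw \<in> F ` carrier E" if cw: "cw \<in> carrier (gmodule_sum (trivial_module K 1) W)" for cw
  proof -
    obtain c w where cw': "cw = (c, w)" "c \<in> {..<1} \<rightarrow>\<^sub>E carrier K" and w: "w \<in> carrier W"
      using cw by auto
    then have c: "c 0 \<in> carrier K" by auto
    have wE: "w \<in> carrier E" "tau w = \<zero>\<^bsub>K\<^esub>" using w unfolding W_simps by blast+
    let ?f = "w \<oplus>\<^bsub>E\<^esub> (c 0 \<odot>\<^bsub>E\<^esub> one)"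
    have f: "?f \<in> carrier E" using wE c one_E by (intro E.M.a_closed E.smult_closed)
    have tf: "tau ?f = c 0"
      using wE c one_E by (simp add: tau_E tau_one E.smult_closed del: End_module_simps)
    have "?f \<ominus>\<^bsub>E\<^esub> (tau ?f \<odot>\<^bsub>E\<^esub> one) = w"
      unfolding tf using wE c one_E
      by (simp add: a_minus_def E.M.a_assoc E.M.r_neg E.smult_closed del: End_module_simps)
    moreover have "(\<lambda>i\<in>{..<1::nat}. tau ?f) = c"
      unfolding tf using cw'(2) by (auto simp: fun_eq_iff PiE_iff extensional_def)
    ultimately have "F ?f = cw" unfolding F_def cw'(1) by simp
    then show ?thesis using f by blast
  qed
  ultimately have "bij_betw F (carrier E) (carrier (gmodule_sum (trivial_module K 1) W))"
    using module_hom_mem[OF kG_hom_module_hom[OF hom]] unfolding bij_betw_def by blast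
  then show ?thesis using hom unfolding kG_iso_def by blast
qed

end

section \<open>Vertices\<close>

lemma sylow_subgroup_of_subgroup:
  assumes G: "group G" and fin: "finite (carrier G)" and p: "prime p" and R: "subgroup R G"
  obtains P n k where "subgroup P G" "P \<subseteq> R" "card P = p ^ n" "card R = k * card P" "\<not> p dvd k"
proof -
  have finR: "finite R" using subgroup.subset[OF R] fin by (rule finite_subset)
  then have "card R \<noteq> 0" using subgroup.one_closed[OF R] by auto
  then obtain k where k: "card R = p ^ multiplicity p (card R) * k" "\<not> p dvd k"
    using p multiplicity_decompose'[of "card R" p] by (metis not_prime_unit)
  then obtain P where P: "subgroup P (G\<lparr>carrier := R\<rparr>)" "card P = p ^ multiplicity p (card R)"
    using sylow_thm[OF p group.subgroup_imp_group[OF G R], of "multiplicity p (card R)" k] finR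
    by (auto simp: order_def)
  show ?thesis
    using that[OF group.incl_subgroup[OF G R P(1)] _ P(2), of k] subgroup.subset[OF P(1)] k P(2)
    by (simp add: mult.commute)
qed

text \<open>Orbit sizes divide the order of the group and are thus powers of \<open>p\<close>; none
  of them is 1 when no point is fixed.\<close>

lemma prime_dvd_card_gset:
  assumes "gset G Y \<psi>" and p: "prime p" and ord: "order G = p ^ n"
    and nofix: "\<And>y. y \<in> Y \<Longrightarrow> \<exists>g\<in>carrier G. \<psi> g y \<noteq> y"
  shows "p dvd card Y"
proof -
  interpret gset G Y \<psi> by fact
  interpret act: group_action G Y "\<lambda>g. \<lambda>y\<in>Y. \<psi> g y" by (rule group_action)
  have "p dvd card B" if B: "B \<in> orbits G Y (\<lambda>g. \<lambda>y\<in>Y. \<psi> g y)" for B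
  proof -
    obtain y where y: "y \<in> Y" "B = (\<lambda>g. \<psi> g y) ` carrier G"
      using B by (auto simp: orbits_def orbit_def Setcompr_eq_image)
    have "card B dvd p ^ n" using orbit_stab[OF y(1)] ord y(2) by (metis dvd_triv_left)
    then obtain i where i: "card B = p ^ i" using p by (auto simp: divides_primepow_nat)
    have "i \<noteq> 0"
    proof
      assume "i = 0"
      then obtain z where z: "B = {z}" using i by (auto simp: card_1_singleton_iff)
      have "y \<in> B" using y one_act by force
      moreover obtain g where "g \<in> carrier G" "\<psi> g y \<noteq> y" using nofix[OF y(1)] by blast
      moreover from this have "\<psi> g y \<in> B" using y(2) by blast
      ultimately show False using z by simp
    qed
    then show ?thesis using i by simp
  qed
  moreover have "card Y = (\<Sum>B\<in>orbits G Y (\<lambda>g. \<lambda>y\<in>Y. \<psi> g y). card B)"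
    using act.disjoint_sum[OF finite_set, of "\<lambda>_. 1::nat"] by simp
  ultimately show ?thesis by (simp add: dvd_sum)
qed

lemma (in gset) gset_subgroup:
  assumes "subgroup H G"
  shows "gset (G\<lparr>carrier := H\<rparr>) Y \<psi>"
  using subgroup.mem_carrier[OF assms] subgroup_imp_group[OF assms]
  by (intro gset.intro gset_axioms.intro) (auto simp: finite_set closed one_act mult_act)

lemma (in group) card_subgroup_dvd:
  assumes "subgroup P G" "subgroup Q G" "P \<subseteq> Q"
  shows "card P dvd card Q"
proof -
  have "card (rcosets\<^bsub>G\<lparr>carrier := Q\<rparr>\<^esub> P) * card P = card Q"
    using group.lagrange[OF subgroup_imp_group[OF assms(2)] subgroup_incl[OF assms]]
    by (simp add: order_def)
  then show ?thesis by (metis dvd_triv_right)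
qed

text \<open>
  A point fixed by a Sylow subgroup \<open>Q\<close> has an orbit of size prime to \<open>p\<close>, on which every other
  Sylow subgroup \<open>S\<close> has a fixed point.
\<close>

lemma sylow_fixed_point:
  assumes "gset G Y \<psi>" and fin: "finite (carrier G)" and p: "prime p"
    and Q: "sylow_subgroup p G Q" and S: "sylow_subgroup p G S"
    and y: "y \<in> Y" and fixed: "\<And>g. g \<in> Q \<Longrightarrow> \<psi> g y = y"
  shows "\<exists>y\<in>Y. \<forall>s\<in>S. \<psi> s y = y"
proof (rule ccontr)
  assume no: "\<not> ?thesis"
  interpret gset G Y \<psi> by fact
  let ?a = "multiplicity p (order G)"
  have Q': "subgroup Q G" "card Q = p ^ ?a" and S': "subgroup S G" "card S = p ^ ?a"
    using Q S by (auto simp: sylow_subgroup_def)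
  let ?O = "(\<lambda>g. \<psi> g y) ` carrier G"
  have ord0: "order G \<noteq> 0" using fin by (simp add: order_gt_0_iff_finite)
  have "Q \<subseteq> stab y" using fixed subgroup.mem_carrier[OF Q'(1)] by (auto simp: stab_def)
  then have "card Q dvd card (stab y)"
    by (rule card_subgroup_dvd[OF Q'(1) stab_subgroup[OF y]])
  moreover have "p dvd card ?O"
  proof (rule prime_dvd_card_gset[OF _ p])
    have "gset G ?O \<psi>"
      using y closed by (intro subset) (auto simp flip: mult_act)
    then show "gset (G\<lparr>carrier := S\<rparr>) ?O \<psi>" by (rule gset.gset_subgroup[OF _ S'(1)])
    show "order (G\<lparr>carrier := S\<rparr>) = p ^ ?a" using S'(2) by (simp add: order_def)
    show "\<exists>g\<in>carrier (G\<lparr>carrier := S\<rparr>). \<psi> g z \<noteq> z" if "z \<in> ?O" for z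
      using that no y closed by auto
  qed
  ultimately have "p * p ^ ?a dvd order G"
    using orbit_stab[OF y] Q'(2) by (metis mult_dvd_mono)
  then have "Suc ?a \<le> ?a"
    using ord0 p by (intro multiplicity_geI) (auto simp: not_prime_unit)
  then show False by simp
qed

text \<open>The map from G/P to G/Q has fibres of size \<open>k\<close>, and averaging over them is
  possible because \<open>k\<close> is invertible in \<open>K\<close>.\<close>

lemma relatively_projective_subgroup:
  assumes M: "kG_module K G M" and fin: "finite (carrier G)" and Q: "subgroup Q G"
    and rp: "relatively_projective K G Q M"
    and P: "subgroup P G" "P \<subseteq> Q" and k: "card Q = k * card P" "[k] \<cdot>\<^bsub>K\<^esub> \<one>\<^bsub>K\<^esub> \<noteq> \<zero>\<^bsub>K\<^esub>"
  shows "relatively_projective K G P M"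
proof -
  have rep: "linear_rep K G M" using M by (simp add: kG_module_iff)
  interpret M: linear_rep K G M by fact
  show ?thesis
  proof (rule set_projective_imp_relatively_projective[OF fin P(1) M])
    show "set_projective K G M (left_cosets G P) (l_coset G)"
      by (rule set_projective_left_cosets[OF rep fin M.gset_left_cosets[OF Q fin]
            relatively_projective_imp_set_projective[OF fin Q rep rp] M.self_mem_left_cosets[OF Q] _ P(1)])
        (use P k in \<open>simp_all add: M.stab_left_cosets[OF Q fin] left_cosets_def\<close>)
  qed
qed

text \<open>The families over \<open>Y\<close> and over G/Q combine to one over the product, and
  indecomposability reduces it to a single orbit. That orbit contains a point (y', Q), whose
  stabilizer consists of the elements of \<open>Q\<close> fixing y'. The module is projective
  relative to this stabilizer, so minimality of \<open>Q\<close> makes it all of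
  \<open>Q\<close>.\<close>

lemma vertex_fixes_point:
  assumes M: "kG_module K G M" and ind: "indecomposable K G M" and fin: "finite (carrier G)"
    and Y: "gset G Y \<psi>" and p: "set_projective K G M Y \<psi>" and vx: "is_vertex K G M Q"
  shows "\<exists>y\<in>Y. \<forall>g\<in>Q. \<psi> g y = y"
proof -
  have rep: "linear_rep K G M" using M by (simp add: kG_module_iff)
  interpret M: linear_rep K G M by fact
  have Q: "subgroup Q G" and rp: "relatively_projective K G Q M"
    and min: "\<And>R. \<lbrakk>subgroup R G; R \<subseteq> Q; relatively_projective K G R M\<rbrakk> \<Longrightarrow> R = Q"
    using vx by (auto simp: is_vertex_def)
  interpret Y: gset G Y \<psi> by fact
  interpret C: gset G "left_cosets G Q" "l_coset G" by (rule M.gset_left_cosets[OF Q fin])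
  let ?Z = "Y \<times> left_cosets G Q" and ?\<chi> = "\<lambda>g (y, C). (\<psi> g y, g <#\<^bsub>G\<^esub> C)"
  interpret Z: gset G ?Z ?\<chi> by (rule gset_times[OF Y C.gset_axioms])
  have "set_projective K G M ?Z ?\<chi>"
    by (rule set_projective_times[OF rep Y C.gset_axioms p
          relatively_projective_imp_set_projective[OF fin Q rep rp]])
  then obtain z where z: "z \<in> ?Z" and pz: "set_projective K G M ((\<lambda>g. ?\<chi> g z) ` carrier G) ?\<chi>"
    using set_projective_orbit[OF M ind Z.gset_axioms] by blast
  let ?O = "(\<lambda>g. ?\<chi> g z) ` carrier G"
  have O: "gset G ?O ?\<chi>"
  proof (rule Z.subset)
    show "?O \<subseteq> ?Z" using z Z.closed by blast
    show "?\<chi> g w \<in> ?O" if g: "g \<in> carrier G" and w: "w \<in> ?O" for g w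
    proof -
      obtain h where h: "h \<in> carrier G" "w = ?\<chi> h z" using w by blast
      then have "?\<chi> g w = ?\<chi> (g \<otimes>\<^bsub>G\<^esub> h) z" using Z.mult_act[OF g h(1) z] by simp
      then show ?thesis using g h by blast
    qed
  qed
  obtain y C where yC: "z = (y, C)" "y \<in> Y" "C \<in> left_cosets G Q" using z by blast
  obtain g where g: "g \<in> carrier G" "C = g <#\<^bsub>G\<^esub> Q" using yC(3) by (auto simp: left_cosets_def)
  \<comment> \<open>Translation by the inverse of \<open>g\<close> moves the second coordinate to
    the coset \<open>Q\<close> itself; this puts the stabilizer inside \<open>Q\<close> and not
    inside a conjugate of it.\<close>
  define y' where "y' = \<psi> (inv\<^bsub>G\<^esub> g) y"
  have y': "y' \<in> Y" using yC g Y.closed by (simp add: y'_def)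
  have "(y', Q) = ?\<chi> (inv\<^bsub>G\<^esub> g) z"
    using C.act_inv(2)[OF g(1) M.self_mem_left_cosets[OF Q]] g yC by (simp add: y'_def)
  then have mem: "(y', Q) \<in> ?O" by (rule image_eqI) (rule M.inv_closed[OF g(1)])
  interpret Orb: gset G ?O ?\<chi> by (rule O)
  have trans: "(\<lambda>h. ?\<chi> h (y', Q)) ` carrier G = ?O"
  proof
    show "(\<lambda>h. ?\<chi> h (y', Q)) ` carrier G \<subseteq> ?O" using Orb.closed[OF _ mem] by blast
    show "?O \<subseteq> (\<lambda>h. ?\<chi> h (y', Q)) ` carrier G"
    proof
      fix w assume "w \<in> ?O"
      then obtain h where h: "h \<in> carrier G" "w = ?\<chi> h z" by blast
      have "z = ?\<chi> g (y', Q)" using g yC by (simp add: y'_def)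
      then have "w = ?\<chi> (h \<otimes>\<^bsub>G\<^esub> g) (y', Q)"
        using Orb.mult_act[OF h(1) g(1) mem] h(2) by metis
      then show "w \<in> (\<lambda>h. ?\<chi> h (y', Q)) ` carrier G" using g h by blast
    qed
  qed
  let ?H = "Orb.stab (y', Q)"
  have H: "subgroup ?H G" by (rule Orb.stab_subgroup[OF mem])
  have HQ: "h \<in> Q \<and> \<psi> h y' = y'" if "h \<in> ?H" for h
    using that M.stab_left_cosets[OF Q fin] by (auto simp: Orb.stab_def C.stab_def)
  \<comment> \<open>The orbit is identified with the cosets of the full stabilizer, so the index to
    be inverted is 1.\<close>
  have one: "[(1::nat)] \<cdot>\<^bsub>K\<^esub> \<one>\<^bsub>K\<^esub> \<noteq> \<zero>\<^bsub>K\<^esub>" by simp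
  have "relatively_projective K G ?H M"
    by (rule set_projective_imp_relatively_projective[OF fin H M
          set_projective_left_cosets[OF rep fin O pz mem trans H order_refl _ one]]) simp
  then have "?H = Q" using min[OF H] HQ by blast
  then show ?thesis using HQ y' by blast
qed

lemma set_projective_summand:
  assumes M: "linear_rep K G M" and AB: "internal_direct_sum K G M A B"
    and p: "set_projective K G M Y \<psi>"
  shows "set_projective K G (M\<lparr>carrier := A\<rparr>) Y \<psi>"
proof -
  obtain e where e: "e \<in> kG_hom K G M (M\<lparr>carrier := A\<rparr>)" and ea: "\<And>a. a \<in> A \<Longrightarrow> e a = a"
    using internal_direct_sum_projections[OF M AB] by metis
  have A: "kG_submodule K G M A" using AB by (simp add: internal_direct_sum_def)
  have i: "(\<lambda>v. v) \<in> kG_hom K G (M\<lparr>carrier := A\<rparr>) M"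
    using kG_submodule_subset[OF A] by (auto intro!: kG_homI module_homI)
  show ?thesis
    by (rule set_projective_retract[OF linear_rep_submodule[OF M A] M i e _ p]) (simp add: ea)
qed

section \<open>Vertices of the summands of \<open>W\<close>, and a summand of the augmentation
  kernel with vertex \<open>S\<close>\<close>

context augmentation_kernel
begin

text \<open>A Sylow subgroup \<open>P\<close> of a vertex \<open>Q\<close> has index invertible in
  \<open>K\<close>, so the summand is already projective relative to \<open>P\<close>, and
  minimality gives \<open>P = Q\<close>. Moreover \<open>Q\<close> fixes a pair of points, hence its
  first coordinate; were \<open>Q\<close> a Sylow subgroup of \<open>G\<close>, then
  \<open>S\<close> would fix a point too.\<close>

lemma vertex_of_summand_W:
  assumes fin: "finite (carrier G)" and p: "prime p" and S: "sylow_subgroup p G S"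
    and char: "\<And>n :: nat. [n] \<cdot>\<^bsub>K\<^esub> \<one>\<^bsub>K\<^esub> = \<zero>\<^bsub>K\<^esub> \<longleftrightarrow> p dvd n"
    and nofix: "{x \<in> \<Omega>. \<forall>s\<in>S. \<phi> s x = x} = {}"
    and N: "indecomposable_summand K G W N" and Q: "is_vertex K G (W\<lparr>carrier := N\<rparr>) Q"
  shows "p_subgroup p G Q \<and> \<not> sylow_subgroup p G Q"
proof -
  obtain N' where NN': "internal_direct_sum K G W N N'" and ind: "indecomposable K G (W\<lparr>carrier := N\<rparr>)"
    using N by (auto simp: indecomposable_summand_def)
  note kN = kG_module_summand[OF kG_module_W NN']
  have sQ: "subgroup Q G" and rp: "relatively_projective K G Q (W\<lparr>carrier := N\<rparr>)"
    and min: "\<And>R. \<lbrakk>subgroup R G; R \<subseteq> Q; relatively_projective K G R (W\<lparr>carrier := N\<rparr>)\<rbrakk> \<Longrightarrow> R = Q"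
    using Q by (auto simp: is_vertex_def)
  obtain P n k where P: "subgroup P G" "P \<subseteq> Q" "card P = p ^ n" "card Q = k * card P" "\<not> p dvd k"
    using sylow_subgroup_of_subgroup[OF group_axioms fin p sQ] by metis
  have "relatively_projective K G P (W\<lparr>carrier := N\<rparr>)"
    using relatively_projective_subgroup[OF kN fin sQ rp P(1,2,4)] P(5) char by blast
  then have "P = Q" using min P by blast
  then have "p_subgroup p G Q" using sQ P(3) by (auto simp: p_subgroup_def)
  moreover obtain x y where xy: "x \<in> \<Omega>" "\<And>g. g \<in> Q \<Longrightarrow> \<phi> g x = x"
    using vertex_fixes_point[OF kN ind fin gset_sq
        set_projective_summand[OF linear_rep_W NN' set_projective_W] Q] by auto
  then have "\<not> sylow_subgroup p G Q"
    using sylow_fixed_point[OF gset_axioms fin p _ S xy(1)] nofix by blast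
  ultimately show ?thesis by blast
qed

lemma Dade_module_Delta:
  assumes "finite (carrier G)" "prime p" "sylow_subgroup p G S"
    and "\<And>n :: nat. [n] \<cdot>\<^bsub>K\<^esub> \<one>\<^bsub>K\<^esub> = \<zero>\<^bsub>K\<^esub> \<longleftrightarrow> p dvd n"
    and "{x \<in> \<Omega>. \<forall>s\<in>S. \<phi> s x = x} = {}"
  shows "Dade_module K G p D"
  unfolding Dade_module_def
  using kG_module_Delta p_permutation_W End_module_iso vertex_of_summand_W[OF assms] by blast

lemma tau_zero: "tau (\<lambda>v. \<zero>\<^bsub>D\<^esub>) = \<zero>\<^bsub>K\<^esub>"
proof -
  have id: "(\<lambda>v. v) \<in> module_hom K D D" by (auto intro: module_homI)
  have z: "(\<lambda>v. \<zero>\<^bsub>D\<^esub>) \<in> module_hom K D D" by (rule module_homI) auto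
  have "tau (\<lambda>v. \<zero>\<^bsub>K\<^esub> \<odot>\<^bsub>D\<^esub> v) = tau (\<lambda>v. \<zero>\<^bsub>D\<^esub>)" by (rule tau_cong[OF z]) simp
  then show ?thesis using tau_smult[OF K.zero_closed id] by (simp add: tau_id)
qed

text \<open>
  The projection \<open>e\<close> is a relative trace from \<open>R\<close>, that is, a sum of conjugates of one endomorphism,
  one for each coset of \<open>R\<close>.
\<close>

lemma tau_projection_eq_zero:
  assumes fin: "finite (carrier G)" and R: "subgroup R G"
    and e: "e \<in> kG_hom K G D D" and idem: "\<And>v. v \<in> carrier D \<Longrightarrow> e (e v) = e v"
    and rp: "relatively_projective K G R (D\<lparr>carrier := e ` carrier D\<rparr>)"
    and index: "[card (left_cosets G R)] \<cdot>\<^bsub>K\<^esub> \<one>\<^bsub>K\<^esub> = \<zero>\<^bsub>K\<^esub>"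
  shows "tau e = \<zero>\<^bsub>K\<^esub>"
proof -
  let ?N = "D\<lparr>carrier := e ` carrier D\<rparr>" and ?C = "left_cosets G R"
  have N: "linear_rep K G ?N" by (rule linear_rep_image[OF linear_rep_Delta linear_rep_Delta e])
  interpret N: linear_rep K G ?N by (rule N)
  interpret C: gset G ?C "l_coset G" by (rule gset_left_cosets[OF R fin])
  note ec = module_hom_mem[OF kG_hom_module_hom[OF e]]
  obtain s where s: "\<And>C. C \<in> ?C \<Longrightarrow> s C \<in> module_hom K ?N ?N"
    "\<And>g C v. \<lbrakk>g \<in> carrier G; C \<in> ?C; v \<in> carrier ?N\<rbrakk>
      \<Longrightarrow> act ?N g (s C v) = s (g <#\<^bsub>G\<^esub> C) (act ?N g v)"
    "\<And>v. v \<in> carrier ?N \<Longrightarrow> (\<Oplus>\<^bsub>?N\<^esub>C\<in>?C. s C v) = v"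
    by (rule set_projectiveE[OF relatively_projective_imp_set_projective[OF fin R N rp]])
      (rule that; assumption)
  have i: "(\<lambda>v. v) \<in> module_hom K ?N D"
    using ec by (intro module_homI) auto
  have eN: "e \<in> module_hom K D ?N"
    using module_hom_add[OF kG_hom_module_hom[OF e]] module_hom_smult[OF kG_hom_module_hom[OF e]]
    by (intro module_homI) simp_all
  \<comment> \<open>\<open>s C\<close> is given on the image of \<open>e\<close> only. Composing
    with \<open>e\<close> extends it by zero on the kernel of \<open>e\<close> to the whole
    augmentation kernel, where \<open>tau\<close> is defined.\<close>
  define b where "b C v = s C (e v)" for C v
  have b: "b C \<in> module_hom K D D" if "C \<in> ?C" for C
    unfolding b_def using module_hom_comp[OF module_hom_comp[OF eN s(1)[OF that]] i] .
  have eeN: "e v \<in> carrier ?N" if "v \<in> carrier D" for v using that by simp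
  have t: "tau (b C) = tau (b R)" if C: "C \<in> ?C" for C
  proof -
    obtain g where g: "g \<in> carrier G" "C = g <#\<^bsub>G\<^esub> R" using C by (auto simp: left_cosets_def)
    have RC: "R \<in> ?C" by (rule self_mem_left_cosets[OF R])
    show ?thesis
    proof (rule tau_conj[OF b[OF RC] g(1) b[OF C]])
      show "act D g (b R v) = b C (act D g v)" if v: "v \<in> carrier D" for v
        using s(2)[OF g(1) RC eeN[OF v]] by (simp add: b_def g(2) kG_hom_act[OF e g(1) v])
    qed
  qed
  have "(\<Oplus>\<^bsub>D\<^esub>C\<in>?C. b C v) = e v" if v: "v \<in> carrier D" for v
    using module_hom_finsum[OF i N.module_axioms D.module_axioms, of "\<lambda>C. s C (e v)" ?C]
      s(3)[OF eeN[OF v]] module_hom_mem[OF s(1) eeN[OF v]] by (auto simp: b_def)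
  then have "tau e = tau (\<lambda>v. \<Oplus>\<^bsub>D\<^esub>C\<in>?C. b C v)"
    using tau_cong[OF kG_hom_module_hom[OF e], of "\<lambda>v. \<Oplus>\<^bsub>D\<^esub>C\<in>?C. b C v"] by simp
  also have "\<dots> = (\<Oplus>\<^bsub>K\<^esub>C\<in>?C. tau (b C))"
    by (rule tau_finsum[OF C.finite_set b])
  also have "\<dots> = (\<Oplus>\<^bsub>K\<^esub>C\<in>?C. tau (b R))"
    using tau_closed[OF b[OF self_mem_left_cosets[OF R]]] t by (intro K.finsum_cong') auto
  also have "\<dots> = \<zero>\<^bsub>K\<^esub>"
    using tau_closed[OF b[OF self_mem_left_cosets[OF R]]] index
      K.add_pow_ldistr[of "\<one>\<^bsub>K\<^esub>" "tau (b R)" "card ?C"]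
    by (simp add: K.add.finprod_const)
  finally show ?thesis .
qed

text \<open>The identity is an equivariant idempotent with \<open>tau\<close> nonzero, so there is
  one of minimal rank. A decomposition of its image writes it as a sum of two idempotents; by
  additivity one of them has nonzero \<open>tau\<close>, and by minimality that one has the whole
  image.\<close>

lemma indecomposable_summand_tau:
  obtains e where "e \<in> kG_hom K G D D" "\<And>v. v \<in> carrier D \<Longrightarrow> e (e v) = e v" "tau e \<noteq> \<zero>\<^bsub>K\<^esub>"
    "indecomposable K G (D\<lparr>carrier := e ` carrier D\<rparr>)"
proof -
  interpret kD: kG_module K G D by (rule kG_module_Delta)
  define P where "P e \<longleftrightarrow> e \<in> kG_hom K G D D \<and> (\<forall>v\<in>carrier D. e (e v) = e v) \<and> tau e \<noteq> \<zero>\<^bsub>K\<^esub>" for e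
  have "P (\<lambda>v. v)" by (simp add: P_def kG_hom_id tau_id)
  then obtain e where Pe: "P e" and min: "\<And>f. P f \<Longrightarrow> D.rk (e ` carrier D) \<le> D.rk (f ` carrier D)"
    using ex_has_least_nat[of P _ "\<lambda>e. D.rk (e ` carrier D)"] by blast
  have e: "e \<in> kG_hom K G D D" and idem: "\<And>v. v \<in> carrier D \<Longrightarrow> e (e v) = e v"
    and te: "tau e \<noteq> \<zero>\<^bsub>K\<^esub>" using Pe by (auto simp: P_def)
  let ?A = "e ` carrier D"
  note ec = module_hom_mem[OF kG_hom_module_hom[OF e]]
  \<comment> \<open>Minimality of the rank in usable form: an admissible idempotent whose image lies
    in \<open>?A\<close> has image exactly \<open>?A\<close>.\<close>
  have eq: "f ` carrier D = ?A" if f: "P f" and sub: "f ` carrier D \<subseteq> ?A" for f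
  proof (rule D.rk_eq_imp_eq[OF kD.fin_dim _ sub _ min[OF f]])
    show "submodule K (f ` carrier D) D"
      using kG_submodule_image[OF linear_rep_Delta linear_rep_Delta] f
      by (auto simp: P_def kG_submodule_def)
    show "?A \<subseteq> carrier D" using ec by blast
  qed
  let ?N = "D\<lparr>carrier := ?A\<rparr>"
  have N: "linear_rep K G ?N" by (rule linear_rep_image[OF linear_rep_Delta linear_rep_Delta e])
  have eN: "e \<in> kG_hom K G D ?N" using e by (auto simp: kG_hom_def module_hom_def)
  have e_id: "e a = a" if "a \<in> ?A" for a using that idem by auto
  have "indecomposable K G ?N"
    unfolding indecomposable_def
  proof (intro conjI allI impI)
    show "carrier ?N \<noteq> {\<zero>\<^bsub>?N\<^esub>}"
    proof
      assume "carrier ?N = {\<zero>\<^bsub>?N\<^esub>}"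
      then have "\<zero>\<^bsub>D\<^esub> = e v" if "v \<in> carrier D" for v
        using imageI[OF that, of e] by simp
      then have "tau (\<lambda>v. \<zero>\<^bsub>D\<^esub>) = tau e"
        by (rule tau_cong[OF kG_hom_module_hom[OF e]])
      then show False using te tau_zero by simp
    qed
    fix A1 A2 assume dec: "internal_direct_sum K G ?N A1 A2"
    obtain f1 f2 where f1: "f1 \<in> kG_hom K G ?N (?N\<lparr>carrier := A1\<rparr>)"
      and f2: "f2 \<in> kG_hom K G ?N (?N\<lparr>carrier := A2\<rparr>)"
      and f1_id: "\<And>a. a \<in> A1 \<Longrightarrow> f1 a = a" and f1_z: "\<And>a. a \<in> A2 \<Longrightarrow> f1 a = \<zero>\<^bsub>?N\<^esub>"
      and sum: "\<And>v. v \<in> carrier ?N \<Longrightarrow> v = f1 v \<oplus>\<^bsub>?N\<^esub> f2 v"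
      by (rule internal_direct_sum_projections[OF N dec]) (rule that; assumption)
    have A12: "A1 \<subseteq> ?A" "A2 \<subseteq> ?A" "A1 \<inter> A2 = {\<zero>\<^bsub>D\<^esub>}"
      using dec kG_submodule_subset[of K G ?N] by (auto simp: internal_direct_sum_def)
    have AD: "?A \<subseteq> carrier D" using ec by blast
    \<comment> \<open>The projections come with the values of the first one on both parts; those of
      the second follow from \<open>v\<close> being the sum of its components.\<close>
    have f2_id: "f2 a = a" if a: "a \<in> A2" for a
    proof -
      have "f2 a \<in> A2" using module_hom_mem[OF kG_hom_module_hom[OF f2], of a] a A12 by auto
      then have "f2 a \<in> carrier D" using A12 AD by blast
      moreover have "a = f1 a \<oplus>\<^bsub>D\<^esub> f2 a" using sum[of a] a A12 by auto
      ultimately show ?thesis using f1_z[OF a] by simp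
    qed
    have sub: "(\<lambda>v. v) \<in> kG_hom K G (?N\<lparr>carrier := B\<rparr>) D" if "B \<subseteq> ?A" for B
      using subset_trans[OF that AD] by (intro kG_homI module_homI) (simp_all add: subsetD)
    have hom1: "(\<lambda>v. f1 (e v)) \<in> kG_hom K G D D"
      using kG_hom_comp[OF kG_hom_comp[OF eN f1] sub[OF A12(1)]] .
    have hom2: "(\<lambda>v. f2 (e v)) \<in> kG_hom K G D D"
      using kG_hom_comp[OF kG_hom_comp[OF eN f2] sub[OF A12(2)]] .
    have mem1: "f1 (e v) \<in> A1" and mem2: "f2 (e v) \<in> A2" if "v \<in> carrier D" for v
      using that module_hom_mem[OF kG_hom_module_hom[OF f1], of "e v"]
        module_hom_mem[OF kG_hom_module_hom[OF f2], of "e v"] by auto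
    have fix1: "f1 (e a) = a" if "a \<in> A1" for a 
      using e_id[OF subsetD[OF A12(1) that]] f1_id[OF that] by simp
    have fix2: "f2 (e a) = a" if "a \<in> A2" for a 
      using e_id[OF subsetD[OF A12(2) that]] f2_id[OF that] by simp
    have im1: "(\<lambda>v. f1 (e v)) ` carrier D = A1"
    proof
      show "A1 \<subseteq> (\<lambda>v. f1 (e v)) ` carrier D"
      proof
        fix a assume a: "a \<in> A1"
        show "a \<in> (\<lambda>v. f1 (e v)) ` carrier D"
        proof (rule image_eqI)
          show "a = f1 (e a)" by (rule fix1[OF a, symmetric])
          show "a \<in> carrier D" using a A12 AD by blast
        qed
      qed
    qed (use mem1 in blast)
    have im2: "(\<lambda>v. f2 (e v)) ` carrier D = A2"
    proof
      show "A2 \<subseteq> (\<lambda>v. f2 (e v)) ` carrier D"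
      proof
        fix a assume a: "a \<in> A2"
        show "a \<in> (\<lambda>v. f2 (e v)) ` carrier D"
        proof (rule image_eqI)
          show "a = f2 (e a)" by (rule fix2[OF a, symmetric])
          show "a \<in> carrier D" using a A12 AD by blast
        qed
      qed
    qed (use mem2 in blast)
    have "tau e = tau (\<lambda>v. f1 (e v) \<oplus>\<^bsub>D\<^esub> f2 (e v))"
    proof (rule tau_cong[symmetric, OF kG_hom_module_hom[OF e]])
      show "f1 (e v) \<oplus>\<^bsub>D\<^esub> f2 (e v) = e v" if "v \<in> carrier D" for v
        using sum[of "e v"] that by simp
    qed
    also have "\<dots> = tau (\<lambda>v. f1 (e v)) \<oplus>\<^bsub>K\<^esub> tau (\<lambda>v. f2 (e v))"
      by (rule tau_add[OF kG_hom_module_hom[OF hom1] kG_hom_module_hom[OF hom2]])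
    finally consider "tau (\<lambda>v. f1 (e v)) \<noteq> \<zero>\<^bsub>K\<^esub>" | "tau (\<lambda>v. f2 (e v)) \<noteq> \<zero>\<^bsub>K\<^esub>"
      using te tau_closed[OF kG_hom_module_hom[OF hom2]]
      by (cases "tau (\<lambda>v. f1 (e v)) = \<zero>\<^bsub>K\<^esub>") auto
    \<comment> \<open>A part equal to the whole image leaves only zero for the other, since the two
      parts meet in zero.\<close>
    then have "A1 = ?A \<or> A2 = ?A"
    proof cases
      case 1
      then have "P (\<lambda>v. f1 (e v))" using hom1 fix1 mem1 by (simp add: P_def)
      then show ?thesis using eq[of "\<lambda>v. f1 (e v)"] im1 A12 by blast
    next
      case 2
      then have "P (\<lambda>v. f2 (e v))" using hom2 fix2 mem2 by (simp add: P_def)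
      then show ?thesis using eq[of "\<lambda>v. f2 (e v)"] im2 A12 by blast
    qed
    then show "A1 = {\<zero>\<^bsub>?N\<^esub>} \<or> A2 = {\<zero>\<^bsub>?N\<^esub>}" using A12 by auto
  qed
  then show ?thesis using that e idem te by blast
qed

text \<open>The image of the idempotent found above has vertex \<open>S\<close>: it is projective
  relative to \<open>S\<close> because the index of \<open>S\<close> is prime to \<open>p\<close>,
  and projectivity relative to a proper subgroup of \<open>S\<close>, whose index is divisible by
  \<open>p\<close>, would force \<open>tau e\<close> to vanish.\<close>

lemma Delta_capped:
  assumes fin: "finite (carrier G)" and p: "prime p" and S: "sylow_subgroup p G S"
    and char: "\<And>n :: nat. [n] \<cdot>\<^bsub>K\<^esub> \<one>\<^bsub>K\<^esub> = \<zero>\<^bsub>K\<^esub> \<longleftrightarrow> p dvd n"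
  shows "\<exists>N. indecomposable_summand K G D N \<and> is_vertex K G (D\<lparr>carrier := N\<rparr>) S"
proof -
  obtain e where e: "e \<in> kG_hom K G D D" and idem: "\<And>v. v \<in> carrier D \<Longrightarrow> e (e v) = e v"
    and te: "tau e \<noteq> \<zero>\<^bsub>K\<^esub>" and ind: "indecomposable K G (D\<lparr>carrier := e ` carrier D\<rparr>)"
    using indecomposable_summand_tau by metis
  let ?N = "D\<lparr>carrier := e ` carrier D\<rparr>"
  note dec = internal_direct_sum_idempotent[OF linear_rep_Delta e idem]
  note kN = kG_module_summand[OF kG_module_Delta dec]
  have rep: "linear_rep K G ?N" using kN by (simp add: kG_module_iff)
  have S': "subgroup S G" "card S = p ^ multiplicity p (order G)" using S by (auto simp: sylow_subgroup_def)
  have ord0: "order G \<noteq> 0" using fin by (simp add: order_gt_0_iff_finite)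
  obtain k where k: "order G = p ^ multiplicity p (order G) * k" "\<not> p dvd k"
    using p multiplicity_decompose'[of "order G" p] ord0 by (metis not_prime_unit)
  \<comment> \<open>The stabilizer of the single point is \<open>G\<close>, so passing from this set
    to the cosets of \<open>S\<close> costs the index \<open>k\<close> of \<open>S\<close> in
    \<open>G\<close>, which is prime to \<open>p\<close>.\<close>
  have U: "gset G {()} (\<lambda>_ _. ())" by unfold_locales auto
  have "relatively_projective K G S ?N"
  proof (rule set_projective_imp_relatively_projective[OF fin S'(1) kN])
    show "set_projective K G ?N (left_cosets G S) (l_coset G)"
    proof (rule set_projective_left_cosets[OF rep fin U set_projective_singleton[OF rep] _ _ S'(1)])
      show "card (gset.stab G (\<lambda>_ _. ()) ()) = k * card S"
        using k(1) S'(2) by (simp add: gset.stab_def[OF U] order_def mult.commute)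
      show "S \<subseteq> gset.stab G (\<lambda>_ _. ()) ()"
        using subgroup.subset[OF S'(1)] by (simp add: gset.stab_def[OF U])
      show "[k] \<cdot>\<^bsub>K\<^esub> \<one>\<^bsub>K\<^esub> \<noteq> \<zero>\<^bsub>K\<^esub>" using k(2) char by simp
    qed auto
  qed
  moreover have "R = S" if R: "subgroup R G" "R \<subseteq> S" and rp: "relatively_projective K G R ?N" for R
  proof (rule ccontr)
    assume "R \<noteq> S"
    have finS: "finite S" using subgroup.subset[OF S'(1)] fin by (rule finite_subset)
    have "card R dvd card S" by (rule card_subgroup_dvd[OF R(1) S'(1) R(2)])
    then obtain j where j: "card S = card R * j" by blast
    \<comment> \<open>The index \<open>j\<close> of \<open>R\<close> in \<open>S\<close> divides a
      power of \<open>p\<close> and is not 1, so \<open>p\<close> divides it and hence the index of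
      \<open>R\<close> in \<open>G\<close>.\<close>
    have "j \<noteq> 1" using card_subset_eq[OF finS R(2)] j \<open>R \<noteq> S\<close> by auto
    moreover have "j dvd p ^ multiplicity p (order G)" using j S'(2) by (metis dvd_triv_right)
    ultimately have "p dvd j" using p by (auto simp: divides_primepow_nat)
    have "card R \<noteq> 0" using j S'(2) p by (metis mult_is_0 not_prime_0 power_not_zero)
    moreover have "card (left_cosets G R) * card R = (j * k) * card R"
    proof -
      have "order G = (card R * j) * k" using k(1) S'(2) j by metis
      then show ?thesis using card_left_cosets[OF R(1) fin] by (simp add: ac_simps)
    qed
    ultimately have "card (left_cosets G R) = j * k" by simp
    then have "[card (left_cosets G R)] \<cdot>\<^bsub>K\<^esub> \<one>\<^bsub>K\<^esub> = \<zero>\<^bsub>K\<^esub>" using \<open>p dvd j\<close> char by simp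
    then show False using tau_projection_eq_zero[OF fin R(1) e idem rp] te by blast
  qed
  ultimately have "is_vertex K G ?N S" using S'(1) by (auto simp: is_vertex_def)
  then show ?thesis using dec ind by (auto simp: indecomposable_summand_def)
qed

end

theorem proposition5p5:
  fixes K :: "('k, 'a) ring_scheme" and G :: "('g, 'b) monoid_scheme"
    and p :: nat and S :: "'g set" and \<Omega> :: "'x set" and \<phi> :: "'g \<Rightarrow> 'x \<Rightarrow> 'x"
  assumes "group G" and "finite (carrier G)"
    and "prime p" and "sylow_subgroup p G S"
    and "algebraically_closed K"
    and "\<And>n :: nat. [n] \<cdot>\<^bsub>K\<^esub> \<one>\<^bsub>K\<^esub> = \<zero>\<^bsub>K\<^esub> \<longleftrightarrow> p dvd n"
    and "group_action G \<Omega> \<phi>" and "finite \<Omega>" and "\<Omega> \<noteq> {}"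
    and "{x \<in> \<Omega>. \<forall>s\<in>S. \<phi> s x = x} = {}"
  shows "capped_Dade_module K G p S (Delta K G \<Omega> \<phi>)"
proof -
  interpret gset G \<Omega> \<phi> by (rule group_action_gset[OF assms(7,8)])
  have "subgroup S G" "order (G\<lparr>carrier := S\<rparr>) = p ^ multiplicity p (order G)"
    using assms(4) by (auto simp: sylow_subgroup_def order_def)
  \<comment> \<open>The orbit count is made for the p-group \<open>S\<close>, which acts on \<Omega>
    by restriction and has no fixed point there.\<close>
  then have "p dvd card \<Omega>"
    using assms(10) by (intro prime_dvd_card_gset[OF gset_subgroup assms(3)]) auto
  then interpret augmentation_kernel K G \<Omega> \<phi>
    using assms(5,6,9)
    by (intro augmentation_kernel.intro augmentation_kernel_axioms.intro gset_axioms)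
      (auto simp: algebraically_closed_def)
  show ?thesis
    unfolding capped_Dade_module_def
    using Dade_module_Delta[OF assms(2,3,4,6,10)] Delta_capped[OF assms(2,3,4,6)] by blast
qed

end
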